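(* Let $X$ be a locally compact Hausdorff space. The monoidal category $\mathbf{Hilb}_{C_0(X)}$ of Hilbert $C_0(X)$-modules and bounded $C_0(X)$-linear maps is firm, and its idempotent subunits are exactly the subobjects of the tensor unit $C_0(X)$ given by $$\{ f \in C_0(X) \mid f(X \setminus U)=0 \} \simeq C_0(U)$$ (with the inclusion into $C_0(X)$) for open subsets $U \subseteq X$.
   Context: For a locally compact Hausdorff space $X$, $C_0(X)$ is the commutative C*-algebra of continuous functions $f\colon X\to\mathbb{C}$ vanishing at infinity (for every $\varepsilon>0$ there is a compact $K\subseteq X$ with $|f|<\varepsilon$ on $X\setminus K$). A Hilbert module (over $C_0(X)$) is a (complex) $C_0(X)$-module $E$ with a map $\langle - \mid - \rangle \colon E\times E\to C_0(X)$ that is $C_0(X)$-linear in the second variable, satisfies $\langle x\mid y\rangle=\langle y\mid x\rangle^*$ and $\langle x\mid x\rangle\ge 0$ with equality only if $x=0$, and makes $E$ complete in the norm given by $\|x\|_E^2=\sup_{t\in X}\langle x\mid x\rangle(t)$. A function $f\colon E\to F$ between Hilbert modules is bounded if there is a real number $\|f\|$ with $\|f(x)\|_F\le\|f\|\,\|x\|_E$ for all $x \in E$. $\mathbf{Hilb}_{C_0(X)}$ is the symmetric monoidal category of Hilbert modules and bounded $C_0(X)$-linear maps; $E\otimes F$ is the completion of the algebraic tensor product over $C_0(X)$ under $\langle x\otimes y\mid x'\otimes y'\rangle=\langle x\mid x'\rangle\langle y\mid y'\rangle$; the tensor unit is $C_0(X)$ with $\langle f\mid g\rangle(t)=f(t)^*g(t)$.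 In a monoidal category with tensor unit $I$: a subobject of an object $E$ is an equivalence class of monomorphisms $s\colon S\rightarrowtail E$, where two monomorphisms are identified if they factor through each other; a subunit is a subobject of $I$. A subobject $s\colon S\rightarrowtail E$ is idempotent when $s\otimes\mathrm{id}_S\colon S\otimes S\to E\otimes S$ is an isomorphism. The monoidal category is firm when for any two subunits $s\colon S\rightarrowtail I$ and $t\colon T\rightarrowtail I$ the morphism $t\otimes \mathrm{id}_S$ is monic. *)

theory Defs
  imports "HOL-Analysis.Analysis" "HOL-Algebra.Module"
begin

section \<open>Continuous functions vanishing at infinity\<close>

text \<open>
  Functions on the carrier of a topology \<open>X\<close> are represented by their extension by zero to the
  whole type. Hence the pointwise operations need no restriction, and for \<open>U\<close> open in \<open>X\<close> the set
  \<open>C0 (subtopology X U)\<close> consists of functions on \<open>X\<close> as well, each element of \<open>C\<^sub>0(U)\<close> being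
  extended by zero.
\<close>

definition C0 :: "'x topology \<Rightarrow> ('x \<Rightarrow> complex) set" where
  "C0 X = {f. continuous_map X euclidean f
      \<and> (\<forall>\<epsilon>>0. \<exists>K. compactin X K \<and> (\<forall>t \<in> topspace X - K. cmod (f t) < \<epsilon>))
      \<and> (\<forall>t. t \<notin> topspace X \<longrightarrow> f t = 0)}"

text \<open>The value \<open>0\<close> is inserted so that the supremum is \<open>0\<close> if the space is empty.\<close>

definition sup_norm :: "'x topology \<Rightarrow> ('x \<Rightarrow> complex) \<Rightarrow> real" where
  "sup_norm X f = Sup (insert 0 ((\<lambda>t. cmod (f t)) ` topspace X))"


section \<open>Hilbert modules\<close>

definition complex_ring :: "complex ring" where
  "complex_ring = \<lparr>carrier = UNIV, monoid.mult = (*), one = 1, zero = 0, add = (+)\<rparr>"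

text \<open>
  \<open>smult\<close> is the multiplication by complex scalars, \<open>act\<close> the action of \<open>C\<^sub>0(X)\<close>. The library's
  locale \<open>module\<close> requires a unital ring, so it is only used for the scalars: \<open>C\<^sub>0(X)\<close> has
  a unit only if \<open>X\<close> is compact. The record fields \<open>mult\<close> and \<open>one\<close> are not used.
\<close>

record ('x, 'e) hmod = "(complex, 'e) module" +
  act :: "('x \<Rightarrow> complex) \<Rightarrow> 'e \<Rightarrow> 'e"
  ip :: "'e \<Rightarrow> 'e \<Rightarrow> 'x \<Rightarrow> complex"

definition hnorm :: "'x topology \<Rightarrow> ('x, 'e) hmod \<Rightarrow> 'e \<Rightarrow> real" where
  "hnorm X E x = sqrt (sup_norm X (ip E x x))"

locale hilbert_module = module complex_ring E
  for X :: "'x topology" and E :: "('x, 'e) hmod" (structure) +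
  assumes act_closed: "f \<in> C0 X \<Longrightarrow> x \<in> carrier E \<Longrightarrow> act E f x \<in> carrier E"
    and act_add_right: "f \<in> C0 X \<Longrightarrow> x \<in> carrier E \<Longrightarrow> y \<in> carrier E \<Longrightarrow>
      act E f (x \<oplus> y) = act E f x \<oplus> act E f y"
    and act_add_left: "f \<in> C0 X \<Longrightarrow> g \<in> C0 X \<Longrightarrow> x \<in> carrier E \<Longrightarrow>
      act E (\<lambda>t. f t + g t) x = act E f x \<oplus> act E g x"
    and act_mult: "f \<in> C0 X \<Longrightarrow> g \<in> C0 X \<Longrightarrow> x \<in> carrier E \<Longrightarrow>
      act E (\<lambda>t. f t * g t) x = act E f (act E g x)"
    and act_scale_left: "f \<in> C0 X \<Longrightarrow> x \<in> carrier E \<Longrightarrow>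
      act E (\<lambda>t. c * f t) x = c \<odot> act E f x"
    and act_scale_right: "f \<in> C0 X \<Longrightarrow> x \<in> carrier E \<Longrightarrow>
      act E f (c \<odot> x) = c \<odot> act E f x"
    and ip_closed: "x \<in> carrier E \<Longrightarrow> y \<in> carrier E \<Longrightarrow> ip E x y \<in> C0 X"
    and ip_add_right: "x \<in> carrier E \<Longrightarrow> y \<in> carrier E \<Longrightarrow> z \<in> carrier E \<Longrightarrow>
      ip E x (y \<oplus> z) = (\<lambda>t. ip E x y t + ip E x z t)"
    and ip_scale_right: "x \<in> carrier E \<Longrightarrow> y \<in> carrier E \<Longrightarrow>
      ip E x (c \<odot> y) = (\<lambda>t. c * ip E x y t)"
    and ip_act_right: "f \<in> C0 X \<Longrightarrow> x \<in> carrier E \<Longrightarrow> y \<in> carrier E \<Longrightarrow>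
      ip E x (act E f y) = (\<lambda>t. f t * ip E x y t)"
    and ip_commute: "x \<in> carrier E \<Longrightarrow> y \<in> carrier E \<Longrightarrow>
      ip E x y = (\<lambda>t. cnj (ip E y x t))"
    and ip_nonneg: "x \<in> carrier E \<Longrightarrow> ip E x x t \<in> \<real>\<^sub>\<ge>\<^sub>0"
    and ip_definite: "x \<in> carrier E \<Longrightarrow> ip E x x = (\<lambda>t. 0) \<Longrightarrow> x = \<zero>"
    and norm_complete: "(\<And>n. u n \<in> carrier E) \<Longrightarrow>
      (\<forall>\<epsilon>>0. \<exists>N. \<forall>m\<ge>N. \<forall>n\<ge>N. hnorm X E (u m \<ominus> u n) < \<epsilon>) \<Longrightarrow>
      \<exists>x \<in> carrier E. (\<lambda>n. hnorm X E (u n \<ominus> x)) \<longlonglongrightarrow> (0::real)"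

definition bounded_module_map ::
    "'x topology \<Rightarrow> ('x, 'e) hmod \<Rightarrow> ('x, 'f) hmod \<Rightarrow> ('e \<Rightarrow> 'f) \<Rightarrow> bool" where
  "bounded_module_map X E F h \<longleftrightarrow>
     h \<in> carrier E \<rightarrow> carrier F
     \<and> (\<forall>x \<in> carrier E. \<forall>y \<in> carrier E. h (x \<oplus>\<^bsub>E\<^esub> y) = h x \<oplus>\<^bsub>F\<^esub> h y)
     \<and> (\<forall>c. \<forall>x \<in> carrier E. h (c \<odot>\<^bsub>E\<^esub> x) = c \<odot>\<^bsub>F\<^esub> h x)
     \<and> (\<forall>f \<in> C0 X. \<forall>x \<in> carrier E. h (act E f x) = act F f (h x))
     \<and> (\<exists>B. \<forall>x \<in> carrier E. hnorm X F (h x) \<le> B * hnorm X E x)"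


section \<open>A universe of elements\<close>

text \<open>
  The category below has as objects the Hilbert modules whose carrier is a set of elements of the
  following type. It contains all functions on \<open>X\<close>, hence the tensor unit, and all sequences of
  finite formal sums of pairs of its own elements, hence the completed tensor product of any two
  Hilbert modules carried by it. The type \<open>'v\<close> is arbitrary, so that every Hilbert module is
  a copy of an object for suitable \<open>'v\<close>.
\<close>

datatype ('x, 'v) elt =
    Fun (fun_of: "'x \<Rightarrow> complex")
  | Seq (seq_of: "nat \<Rightarrow> (('x, 'v) elt \<times> ('x, 'v) elt) list")
  | Atom 'v

type_synonym ('x, 'v) hmodule = "('x, ('x, 'v) elt) hmod"


section \<open>The tensor product\<close>

text \<open>
  The list \<open>[(x\<^sub>1, y\<^sub>1), \<dots>, (x\<^sub>k, y\<^sub>k)]\<close> stands for the element \<open>x\<^sub>1 \<otimes> y\<^sub>1 + \<dots> + x\<^sub>k \<otimes> y\<^sub>k\<close> of the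
  algebraic tensor product.
\<close>

definition formal_sums :: "('x, 'e) hmod \<Rightarrow> ('x, 'f) hmod \<Rightarrow> ('e \<times> 'f) list set" where
  "formal_sums E F = lists (carrier E \<times> carrier F)"

definition fs_ip ::
    "('x, 'e) hmod \<Rightarrow> ('x, 'f) hmod \<Rightarrow> ('e \<times> 'f) list \<Rightarrow> ('e \<times> 'f) list \<Rightarrow> 'x \<Rightarrow> complex" where
  "fs_ip E F u v t = (\<Sum>(x, y)\<leftarrow>u. \<Sum>(x', y')\<leftarrow>v. ip E x x' t * ip F y y' t)"

definition fs_dist ::
    "'x topology \<Rightarrow> ('x, 'e) hmod \<Rightarrow> ('x, 'f) hmod \<Rightarrow> ('e \<times> 'f) list \<Rightarrow> ('e \<times> 'f) list \<Rightarrow> real" where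
  "fs_dist X E F u v =
     (let w = u @ map (\<lambda>(x, y). (\<ominus>\<^bsub>E\<^esub> x, y)) v in sqrt (sup_norm X (fs_ip E F w w)))"

text \<open>
  The relations of the algebraic tensor product over \<open>C\<^sub>0(X)\<close> are respected by \<open>fs_ip\<close>; formal sums
  that denote the same element of it are therefore at distance \<open>0\<close>. So its completion is obtained
  from the Cauchy sequences of formal sums by identifying those whose distance tends to \<open>0\<close>.
\<close>

lemma fs_ip_append:
  "fs_ip E F (u @ u') v t = fs_ip E F u v t + fs_ip E F u' v t"
  "fs_ip E F u (v @ v') t = fs_ip E F u v t + fs_ip E F u v' t"
  by (simp_all add: fs_ip_def sum_list_addf split_def)

lemma fs_ip_relations:
  assumes "hilbert_module X E" "hilbert_module X F" "w \<in> formal_sums E F"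
    and "x \<in> carrier E" "x' \<in> carrier E" "y \<in> carrier F" "y' \<in> carrier F" "f \<in> C0 X"
  shows "fs_ip E F w [(x \<oplus>\<^bsub>E\<^esub> x', y)] = fs_ip E F w [(x, y), (x', y)]"
    and "fs_ip E F w [(x, y \<oplus>\<^bsub>F\<^esub> y')] = fs_ip E F w [(x, y), (x, y')]"
    and "fs_ip E F w [(c \<odot>\<^bsub>E\<^esub> x, y)] = fs_ip E F w [(x, c \<odot>\<^bsub>F\<^esub> y)]"
    and "fs_ip E F w [(act E f x, y)] = fs_ip E F w [(x, act F f y)]"
proof -
  interpret E: hilbert_module X E by fact
  interpret F: hilbert_module X F by fact
  have w: "a \<in> carrier E" "b \<in> carrier F" if "(a, b) \<in> set w" for a b
    using assms(3) that by (auto simp: formal_sums_def)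
  show "fs_ip E F w [(x \<oplus>\<^bsub>E\<^esub> x', y)] = fs_ip E F w [(x, y), (x', y)]"
    unfolding fs_ip_def using assms w
    by (intro ext arg_cong[where f = sum_list] map_cong) (auto simp: E.ip_add_right algebra_simps)
  show "fs_ip E F w [(x, y \<oplus>\<^bsub>F\<^esub> y')] = fs_ip E F w [(x, y), (x, y')]"
    unfolding fs_ip_def using assms w
    by (intro ext arg_cong[where f = sum_list] map_cong) (auto simp: F.ip_add_right algebra_simps)
  show "fs_ip E F w [(c \<odot>\<^bsub>E\<^esub> x, y)] = fs_ip E F w [(x, c \<odot>\<^bsub>F\<^esub> y)]"
    unfolding fs_ip_def using assms w
    by (intro ext arg_cong[where f = sum_list] map_cong)
      (auto simp: E.ip_scale_right F.ip_scale_right)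
  show "fs_ip E F w [(act E f x, y)] = fs_ip E F w [(x, act F f y)]"
    unfolding fs_ip_def using assms w
    by (intro ext arg_cong[where f = sum_list] map_cong)
      (auto simp: E.ip_act_right F.ip_act_right)
qed

definition cauchy_sums ::
    "'x topology \<Rightarrow> ('x, 'e) hmod \<Rightarrow> ('x, 'f) hmod \<Rightarrow> (nat \<Rightarrow> ('e \<times> 'f) list) set" where
  "cauchy_sums X E F = {\<sigma>. (\<forall>n. \<sigma> n \<in> formal_sums E F)
      \<and> (\<forall>\<epsilon>>0. \<exists>N. \<forall>m\<ge>N. \<forall>n\<ge>N. fs_dist X E F (\<sigma> m) (\<sigma> n) < \<epsilon>)}"

text \<open>Each class of Cauchy sequences is encoded by a chosen representative.\<close>

definition lim_elt ::
    "'x topology \<Rightarrow> ('x, 'v) hmodule \<Rightarrow> ('x, 'v) hmodule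
      \<Rightarrow> (nat \<Rightarrow> (('x, 'v) elt \<times> ('x, 'v) elt) list) \<Rightarrow> ('x, 'v) elt" where
  "lim_elt X E F \<sigma> =
     Seq (SOME \<tau>. \<tau> \<in> cauchy_sums X E F \<and> (\<lambda>n. fs_dist X E F (\<sigma> n) (\<tau> n)) \<longlonglongrightarrow> 0)"

definition tensor ::
    "'x topology \<Rightarrow> ('x, 'v) hmodule \<Rightarrow> ('x, 'v) hmodule \<Rightarrow> ('x, 'v) hmodule" where
  "tensor X E F = \<lparr>
     carrier = lim_elt X E F ` cauchy_sums X E F,
     monoid.mult = undefined, one = undefined,
     zero = lim_elt X E F (\<lambda>n. []),
     add = (\<lambda>z w. lim_elt X E F (\<lambda>n. seq_of z n @ seq_of w n)),
     smult = (\<lambda>c z. lim_elt X E F (\<lambda>n. map (\<lambda>(x, y). (c \<odot>\<^bsub>E\<^esub> x, y)) (seq_of z n))),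
     act = (\<lambda>f z. lim_elt X E F (\<lambda>n. map (\<lambda>(x, y). (act E f x, y)) (seq_of z n))),
     ip = (\<lambda>z w t. lim (\<lambda>n. fs_ip E F (seq_of z n) (seq_of w n) t))\<rparr>"

definition tensor_map ::
    "'x topology \<Rightarrow> ('x, 'v) hmodule \<Rightarrow> ('x, 'v) hmodule \<Rightarrow> ('x, 'v) hmodule \<Rightarrow> ('x, 'v) hmodule
      \<Rightarrow> (('x, 'v) elt \<Rightarrow> ('x, 'v) elt) \<Rightarrow> (('x, 'v) elt \<Rightarrow> ('x, 'v) elt)
      \<Rightarrow> ('x, 'v) elt \<Rightarrow> ('x, 'v) elt" where
  "tensor_map X E F E' F' h k =
     (\<lambda>z \<in> carrier (tensor X E F). lim_elt X E' F' (\<lambda>n. map (map_prod h k) (seq_of z n)))"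

definition unit_module :: "'x topology \<Rightarrow> ('x, 'v) hmodule" where
  "unit_module X = \<lparr>
     carrier = Fun ` C0 X,
     monoid.mult = undefined, one = undefined,
     zero = Fun (\<lambda>t. 0),
     add = (\<lambda>a b. Fun (\<lambda>t. fun_of a t + fun_of b t)),
     smult = (\<lambda>c a. Fun (\<lambda>t. c * fun_of a t)),
     act = (\<lambda>f a. Fun (\<lambda>t. f t * fun_of a t)),
     ip = (\<lambda>a b t. cnj (fun_of a t) * fun_of b t)\<rparr>"


section \<open>Subunits in a category with tensor product\<close>

text \<open>
  Only those parts of a monoidal category are recorded that occur in the definitions of subunits,
  idempotence and firmness; these do not refer to associators, unitors and braidings.
\<close>

record ('o, 'm) tensor_cat =
  obj :: "'o set"
  arr :: "'m set"
  src :: "'m \<Rightarrow> 'o"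
  tgt :: "'m \<Rightarrow> 'o"
  ide :: "'o \<Rightarrow> 'm"
  cmp :: "'m \<Rightarrow> 'm \<Rightarrow> 'm"
  tensor_obj :: "'o \<Rightarrow> 'o \<Rightarrow> 'o"
  tensor_arr :: "'m \<Rightarrow> 'm \<Rightarrow> 'm"
  unit_obj :: "'o"

definition hom_set :: "('o, 'm) tensor_cat \<Rightarrow> 'o \<Rightarrow> 'o \<Rightarrow> 'm set" where
  "hom_set C A B = {f \<in> arr C. src C f = A \<and> tgt C f = B}"

definition monic :: "('o, 'm) tensor_cat \<Rightarrow> 'm \<Rightarrow> bool" where
  "monic C s \<longleftrightarrow> s \<in> arr C \<and>
     (\<forall>A \<in> obj C. \<forall>g \<in> hom_set C A (src C s). \<forall>h \<in> hom_set C A (src C s).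
        cmp C s g = cmp C s h \<longrightarrow> g = h)"

definition is_iso :: "('o, 'm) tensor_cat \<Rightarrow> 'm \<Rightarrow> bool" where
  "is_iso C f \<longleftrightarrow> f \<in> arr C \<and>
     (\<exists>g \<in> hom_set C (tgt C f) (src C f).
        cmp C g f = ide C (src C f) \<and> cmp C f g = ide C (tgt C f))"

definition monos_into :: "('o, 'm) tensor_cat \<Rightarrow> 'o \<Rightarrow> 'm set" where
  "monos_into C A = {s. monic C s \<and> tgt C s = A}"

definition factors_through :: "('o, 'm) tensor_cat \<Rightarrow> 'm \<Rightarrow> 'm \<Rightarrow> bool" where
  "factors_through C s t \<longleftrightarrow> (\<exists>h \<in> hom_set C (src C s) (src C t). s = cmp C t h)"

definition sub_rel :: "('o, 'm) tensor_cat \<Rightarrow> 'o \<Rightarrow> ('m \<times> 'm) set" where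
  "sub_rel C A = {(s, t). s \<in> monos_into C A \<and> t \<in> monos_into C A
      \<and> factors_through C s t \<and> factors_through C t s}"

definition subobjects :: "('o, 'm) tensor_cat \<Rightarrow> 'o \<Rightarrow> 'm set set" where
  "subobjects C A = monos_into C A // sub_rel C A"

abbreviation subobject_of :: "('o, 'm) tensor_cat \<Rightarrow> 'm \<Rightarrow> 'm set" where
  "subobject_of C s \<equiv> sub_rel C (tgt C s) `` {s}"

abbreviation subunits :: "('o, 'm) tensor_cat \<Rightarrow> 'm set set" where
  "subunits C \<equiv> subobjects C (unit_obj C)"

definition idempotent_subobject :: "('o, 'm) tensor_cat \<Rightarrow> 'm set \<Rightarrow> bool" where
  "idempotent_subobject C \<Sigma> \<longleftrightarrow> (\<exists>s \<in> \<Sigma>. is_iso C (tensor_arr C s (ide C (src C s))))"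

definition idempotent_subunits :: "('o, 'm) tensor_cat \<Rightarrow> 'm set set" where
  "idempotent_subunits C = {\<Sigma> \<in> subunits C. idempotent_subobject C \<Sigma>}"

definition firm :: "('o, 'm) tensor_cat \<Rightarrow> bool" where
  "firm C \<longleftrightarrow> (\<forall>\<Sigma> \<in> subunits C. \<forall>\<Theta> \<in> subunits C. \<forall>s \<in> \<Sigma>. \<forall>t \<in> \<Theta>.
     monic C (tensor_arr C t (ide C (src C s))))"


section \<open>The category of Hilbert modules\<close>

text \<open>
  An arrow is a triple of domain, underlying map and codomain. The map is \<open>extensional\<close>, so that
  arrows are equal iff their maps agree on the carrier of the domain.
\<close>

type_synonym ('x, 'v) harrow =
  "('x, 'v) hmodule \<times> (('x, 'v) elt \<Rightarrow> ('x, 'v) elt) \<times> ('x, 'v) hmodule"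

definition Hilb :: "'x topology \<Rightarrow> (('x, 'v) hmodule, ('x, 'v) harrow) tensor_cat" where
  "Hilb X = \<lparr>
     obj = {E. hilbert_module X E},
     arr = {(E, h, F). hilbert_module X E \<and> hilbert_module X F
              \<and> h \<in> extensional (carrier E) \<and> bounded_module_map X E F h},
     src = (\<lambda>(E, h, F). E),
     tgt = (\<lambda>(E, h, F). F),
     ide = (\<lambda>E. (E, \<lambda>x \<in> carrier E. x, E)),
     cmp = (\<lambda>(F', k, G) (E, h, F). (E, compose (carrier E) k h, G)),
     tensor_obj = tensor X,
     tensor_arr = (\<lambda>(E, h, E') (F, k, F').
       (tensor X E F, tensor_map X E F E' F' h k, tensor X E' F')),
     unit_obj = unit_module X\<rparr>"

definition C0_ideal :: "'x topology \<Rightarrow> 'x set \<Rightarrow> ('x \<Rightarrow> complex) set" where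
  "C0_ideal X U = {f \<in> C0 X. \<forall>t \<in> topspace X - U. f t = 0}"

definition ideal_inclusion :: "'x topology \<Rightarrow> 'x set \<Rightarrow> ('x, 'v) harrow" where
  "ideal_inclusion X U =
     (let S = (unit_module X)\<lparr>carrier := Fun ` C0_ideal X U\<rparr>
      in (S, \<lambda>x \<in> carrier S. x, unit_module X))"

end

theory Submission
  imports Defs
begin

text \<open>
  Everything is done fibrewise. For a Hilbert module \<open>E\<close> and a point \<open>t\<close>, the inner products at
  \<open>t\<close> form a positive semidefinite kernel on \<open>E\<close>. A bounded module map \<open>h\<close> with constant \<open>B\<close>
  satisfies \<open>\<langle>h x | h x\<rangle>(t) \<le> B\<^sup>2 \<langle>x | x\<rangle>(t)\<close> at every point \<open>t\<close>, because \<open>x\<close> may be multiplied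
  by a bump function at \<open>t\<close> (\<open>map_pointwise_bounded\<close>). Hence the difference of the two sides is
  again a positive semidefinite kernel, and Schur's product theorem (\<open>schur_product\<close>) gives what is
  needed of tensor products: the inner product of formal sums is positive, and \<open>h \<otimes> k\<close> is bounded
  (\<open>fs_map_bounded\<close>), although \<open>h\<close> and \<open>k\<close> need not have adjoints. Completeness of \<open>E \<otimes> F\<close> is a
  matter of Cauchy sequences for a semi-inner product (\<open>diagonal_limit\<close>).

  Firmness. Kernels of bounded module maps are Hilbert modules, so monomorphisms are injective
  (\<open>Hilb_monic_iff\<close>). If \<open>s: S \<rightarrow> C\<^sub>0(X)\<close> is injective, then \<open>s(a) x = s(x) a\<close> for \<open>a, x \<in> S\<close>, since
  both sides have the same image. So the fibres of \<open>S\<close> are at most one-dimensional wherever some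
  \<open>s(a)\<close> does not vanish, and
  \<open>|s(a)|\<^sup>2 \<langle>z | z\<rangle> = \<langle>a | a\<rangle> \<langle>(s \<otimes> 1) z | (s \<otimes> 1) z\<rangle>\<close> for \<open>z \<in> S \<otimes> F\<close> (\<open>ip_map\<close>). Suppose that
  \<open>(s \<otimes> 1) z = 0\<close> but \<open>\<langle>z | z\<rangle>(t) \<noteq> 0\<close>. Then \<open>\<langle>z | z\<rangle>\<close> has no zero in a neighbourhood of \<open>t\<close>, so all
  \<open>s(a)\<close> vanish there. Injectivity of \<open>s\<close> forces the fibre of \<open>S\<close> at \<open>t\<close> to be zero, hence also
  that of \<open>S \<otimes> F\<close>: a contradiction (\<open>tensor_map_kernel\<close>).

  Idempotent subunits. If \<open>J\<close> consists of the functions that vanish outside \<open>U\<close>, then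
  \<open>J \<otimes> J \<rightarrow> C\<^sub>0(X) \<otimes> J\<close> is isometric, and it is onto because \<open>f \<otimes> g\<close> equals
  \<open>f sqrt |g| \<otimes> g / sqrt |g|\<close> (\<open>tensor_map_surj\<close>). Conversely, if \<open>s \<otimes> 1: S \<otimes> S \<rightarrow> C\<^sub>0(X) \<otimes> S\<close> has an inverse
  bounded by \<open>C\<close>, then evaluation at \<open>x \<otimes> x\<close> yields \<open>\<langle>x | x\<rangle> \<le> C\<^sup>2 |s(x)|\<^sup>2\<close> (\<open>bounded_below\<close>). So \<open>s\<close>
  is an isomorphism of \<open>S\<close> onto a closed ideal of \<open>C\<^sub>0(X)\<close>, and a closed ideal contains all
  functions that vanish wherever all its members do (\<open>C0_ideal_approximation\<close>, \<open>image_eq\<close>).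
\<close>

section \<open>Functions vanishing at infinity\<close>

lemma continuous_map_complex_compose:
  assumes "continuous_map X euclidean f" "continuous_on UNIV \<phi>"
  shows "continuous_map X euclidean (\<lambda>t. \<phi> (f t))"
  using continuous_map_compose[OF assms(1), of euclidean \<phi>] assms(2) by (simp add: o_def)

lemma continuous_map_complex_mult:
  fixes f g :: "'x \<Rightarrow> complex"
  assumes "continuous_map X euclidean f" "continuous_map X euclidean g"
  shows "continuous_map X euclidean (\<lambda>t. f t * g t)"
proof -
  have "continuous_map X (prod_topology euclidean euclidean) (\<lambda>t. (f t, g t))"
    unfolding continuous_map_paired using assms by blast
  then show ?thesis
    using continuous_map_complex_compose[of X "\<lambda>t. (f t, g t)" "\<lambda>p. fst p * snd p"]
    by (simp add: continuous_on_mult[OF continuous_on_fst continuous_on_snd] continuous_on_id)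
qed

lemma C0_continuous: "f \<in> C0 X \<Longrightarrow> continuous_map X euclidean f"
  by (simp add: C0_def)

lemma C0_outside: "f \<in> C0 X \<Longrightarrow> t \<notin> topspace X \<Longrightarrow> f t = 0"
  by (simp add: C0_def)

lemma C0_zero [simp]: "(\<lambda>t. 0) \<in> C0 X"
  by (auto simp: C0_def intro: exI[of _ "{}"])

text \<open>
  The value \<open>0\<close> outside the space lets the bound hold at all points of the type outside the compact
  set, so that later estimates need not mention the carrier of the topology.
\<close>

lemma C0_compact_support:
  assumes "f \<in> C0 X" "\<epsilon> > 0"
  obtains K where "compactin X K" "\<And>t. t \<notin> K \<Longrightarrow> cmod (f t) < \<epsilon>"
proof -
  obtain K where K: "compactin X K" "\<And>t. t \<in> topspace X - K \<Longrightarrow> cmod (f t) < \<epsilon>"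
    using assms unfolding C0_def by blast
  have "cmod (f t) < \<epsilon>" if "t \<notin> K" for t
    using K(2)[of t] that assms C0_outside[OF assms(1), of t] by (cases "t \<in> topspace X") auto
  with K(1) show ?thesis using that by blast
qed

lemma C0_I:
  assumes "continuous_map X euclidean f"
    and "\<And>\<epsilon>. \<epsilon> > 0 \<Longrightarrow> \<exists>K. compactin X K \<and> (\<forall>t. t \<notin> K \<longrightarrow> cmod (f t) < \<epsilon>)"
    and "\<And>t. t \<notin> topspace X \<Longrightarrow> f t = 0"
  shows "f \<in> C0 X"
  using assms unfolding C0_def by blast

lemma C0_compose:
  assumes f: "f \<in> C0 X" and cont: "continuous_on UNIV \<phi>" and "\<phi> 0 = 0"
  shows "(\<lambda>t. \<phi> (f t)) \<in> C0 X"
proof (rule C0_I)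
  show "continuous_map X euclidean (\<lambda>t. \<phi> (f t))"
    using C0_continuous[OF f] cont by (rule continuous_map_complex_compose)
  show "\<phi> (f t) = 0" if "t \<notin> topspace X" for t
    using C0_outside[OF f that] assms by simp
  fix \<epsilon> :: real assume "\<epsilon> > 0"
  then have "\<exists>\<delta>>0. \<forall>z\<in>UNIV. dist z 0 < \<delta> \<longrightarrow> dist (\<phi> z) (\<phi> 0) < \<epsilon>"
    using cont unfolding continuous_on_iff by blast
  then obtain \<delta> where "\<delta> > 0" "\<And>z. cmod z < \<delta> \<Longrightarrow> cmod (\<phi> z) < \<epsilon>"
    using \<open>\<phi> 0 = 0\<close> by auto
  moreover obtain K where "compactin X K" "\<And>t. t \<notin> K \<Longrightarrow> cmod (f t) < \<delta>"
    using C0_compact_support[OF f \<open>\<delta> > 0\<close>] by blast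
  ultimately show "\<exists>K. compactin X K \<and> (\<forall>t. t \<notin> K \<longrightarrow> cmod (\<phi> (f t)) < \<epsilon>)"
    by blast
qed

lemma C0_dominated:
  assumes h: "continuous_map X euclidean h" and f: "f \<in> C0 X"
    and le: "\<And>t. cmod (h t) \<le> B * cmod (f t)"
  shows "h \<in> C0 X"
proof (rule C0_I[OF h])
  show "h t = 0" if "t \<notin> topspace X" for t
    using le[of t] C0_outside[OF f that] by simp
  fix \<epsilon> :: real assume "\<epsilon> > 0"
  then have "\<epsilon> / (\<bar>B\<bar> + 1) > 0" by simp
  then obtain K where "compactin X K" "\<And>t. t \<notin> K \<Longrightarrow> cmod (f t) < \<epsilon> / (\<bar>B\<bar> + 1)"
    using C0_compact_support[OF f] by blast
  moreover have "cmod (h t) < \<epsilon>" if "cmod (f t) < \<epsilon> / (\<bar>B\<bar> + 1)" for t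
  proof -
    have "cmod (h t) \<le> (\<bar>B\<bar> + 1) * cmod (f t)"
      using le[of t] by (smt (verit) mult_right_mono norm_ge_zero)
    also have "\<dots> < \<epsilon>"
      using that by (simp add: field_simps)
    finally show ?thesis .
  qed
  ultimately show "\<exists>K. compactin X K \<and> (\<forall>t. t \<notin> K \<longrightarrow> cmod (h t) < \<epsilon>)"
    by blast
qed

lemma C0_bounded:
  assumes "f \<in> C0 X"
  obtains B where "B \<ge> 0" "\<And>t. cmod (f t) \<le> B"
proof -
  obtain K where K: "compactin X K" "\<And>t. t \<notin> K \<Longrightarrow> cmod (f t) < 1"
    using C0_compact_support[OF assms zero_less_one] by blast
  have "compact (f ` K)"
    using image_compactin[OF K(1) C0_continuous[OF assms]] by simp
  then obtain B where "\<And>t. t \<in> K \<Longrightarrow> cmod (f t) \<le> B"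
    using compact_imp_bounded bounded_iff by (metis imageI)
  then show ?thesis
    by (intro that[of "max B 1"]) (use K(2) in \<open>force simp: le_max_iff_disj\<close>)+
qed

lemma C0_add:
  assumes "f \<in> C0 X" "g \<in> C0 X"
  shows "(\<lambda>t. f t + g t) \<in> C0 X"
proof (rule C0_I)
  show "continuous_map X euclidean (\<lambda>t. f t + g t)"
    using assms by (intro continuous_map_add C0_continuous)
  show "f t + g t = 0" if "t \<notin> topspace X" for t
    using assms that by (simp add: C0_outside)
  fix \<epsilon> :: real assume "\<epsilon> > 0"
  then have \<epsilon>: "\<epsilon> / 2 > 0" by simp
  obtain K where K: "compactin X K" "\<And>t. t \<notin> K \<Longrightarrow> cmod (f t) < \<epsilon> / 2"
    using C0_compact_support[OF assms(1) \<epsilon>] by blast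
  obtain L where L: "compactin X L" "\<And>t. t \<notin> L \<Longrightarrow> cmod (g t) < \<epsilon> / 2"
    using C0_compact_support[OF assms(2) \<epsilon>] by blast
  have "cmod (f t + g t) < \<epsilon>" if "t \<notin> K \<union> L" for t
    using norm_add_less[OF K(2)[of t] L(2)[of t]] that by simp
  with K(1) L(1) compactin_Un show "\<exists>K. compactin X K \<and> (\<forall>t. t \<notin> K \<longrightarrow> cmod (f t + g t) < \<epsilon>)"
    by blast
qed

lemma C0_mult_continuous:
  assumes "continuous_map X euclidean f" "g \<in> C0 X" "\<And>t. cmod (f t) \<le> B"
  shows "(\<lambda>t. f t * g t) \<in> C0 X"
proof (rule C0_dominated[OF _ assms(2), of _ B])
  show "continuous_map X euclidean (\<lambda>t. f t * g t)"
    using assms(1) C0_continuous[OF assms(2)] by (rule continuous_map_complex_mult)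
  show "cmod (f t * g t) \<le> B * cmod (g t)" for t
    using assms(3)[of t] by (simp add: norm_mult mult_right_mono)
qed

lemma C0_mult:
  assumes "f \<in> C0 X" "g \<in> C0 X"
  shows "(\<lambda>t. f t * g t) \<in> C0 X"
  by (rule C0_bounded[OF assms(1)])
    (rule C0_mult_continuous[OF C0_continuous[OF assms(1)] assms(2)])

lemma C0_cmult: "f \<in> C0 X \<Longrightarrow> (\<lambda>t. c * f t) \<in> C0 X"
  by (rule C0_compose) (auto intro: continuous_intros)

lemma C0_cnj: "f \<in> C0 X \<Longrightarrow> (\<lambda>t. cnj (f t)) \<in> C0 X"
  by (rule C0_compose) (auto intro: continuous_intros)

lemma C0_diff:
  assumes "f \<in> C0 X" "g \<in> C0 X"
  shows "(\<lambda>t. f t - g t) \<in> C0 X"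
  using C0_add[OF assms(1) C0_cmult[OF assms(2), of "-1"]] by simp

lemma C0_uniform_limit:
  assumes lim: "\<And>\<epsilon>. \<epsilon> > 0 \<Longrightarrow> \<exists>g \<in> C0 X. \<forall>t. cmod (f t - g t) < \<epsilon>"
  shows "f \<in> C0 X"
proof (rule C0_I)
  have "\<forall>n. \<exists>g \<in> C0 X. \<forall>t. cmod (f t - g t) < 1 / Suc n"
    by (intro allI lim) simp
  then obtain g where g: "\<And>n. g n \<in> C0 X" "\<And>n t. cmod (f t - g n t) < 1 / Suc n"
    by metis
  show "continuous_map X euclidean f"
  proof -
    have "continuous_map X (Met_TC.mtopology) f"
    proof (rule Met_TC.continuous_map_uniform_limit[where F = sequentially and f = g])
      show "\<forall>\<^sub>F n in sequentially. continuous_map X Met_TC.mtopology (g n)"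
        using g(1) by (auto simp: C0_continuous)
      fix \<epsilon> :: real assume "\<epsilon> > 0"
      then have "\<forall>\<^sub>F n in sequentially. 1 / Suc n < \<epsilon>"
        by real_asymp
      then show "\<forall>\<^sub>F n in sequentially. \<forall>t\<in>topspace X. f t \<in> UNIV \<and> dist (g n t) (f t) < \<epsilon>"
        by (rule eventually_mono) (auto simp: dist_commute dist_norm intro: less_trans[OF g(2)])
    qed simp
    then show ?thesis by simp
  qed
  show "f t = 0" if t: "t \<notin> topspace X" for t
  proof (rule ccontr)
    assume "f t \<noteq> 0"
    then obtain h where "h \<in> C0 X" "cmod (f t - h t) < cmod (f t)"
      using lim[of "cmod (f t)"] by auto
    then show False
      using C0_outside[OF _ t, of h] by simp
  qed
  fix \<epsilon> :: real assume "\<epsilon> > 0"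
  then obtain h where h: "h \<in> C0 X" "\<And>t. cmod (f t - h t) < \<epsilon> / 2"
    using lim[of "\<epsilon> / 2"] by auto
  obtain K where K: "compactin X K" "\<And>t. t \<notin> K \<Longrightarrow> cmod (h t) < \<epsilon> / 2"
    using C0_compact_support[OF h(1), of "\<epsilon> / 2"] \<open>\<epsilon> > 0\<close> by auto
  have "cmod (f t) < \<epsilon>" if "t \<notin> K" for t
    using norm_add_less[OF h(2)[of t] K(2)[OF that]] by simp
  with K(1) show "\<exists>K. compactin X K \<and> (\<forall>t. t \<notin> K \<longrightarrow> cmod (f t) < \<epsilon>)"
    by blast
qed

text \<open>
  Completeness of \<open>C\<^sub>0(X)\<close>, in a form that also identifies the limit as the pointwise one. It serves
  both the tensor unit and the inner product on completed tensor products.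
\<close>

lemma C0_uniform_limit_of_sequence:
  assumes f: "\<And>n. f n \<in> C0 X"
    and cauchy: "\<And>\<epsilon>. \<epsilon> > 0 \<Longrightarrow> \<exists>N. \<forall>m\<ge>N. \<forall>n\<ge>N. \<forall>t. cmod (f m t - f n t) < \<epsilon>"
  shows C0_limit_pointwise: "\<And>t. (\<lambda>n. f n t) \<longlonglongrightarrow> lim (\<lambda>n. f n t)"
    and C0_limit_uniform:
      "\<And>\<epsilon>. \<epsilon> > 0 \<Longrightarrow> \<exists>N. \<forall>n\<ge>N. \<forall>t. cmod (lim (\<lambda>k. f k t) - f n t) < \<epsilon>"
    and C0_limit: "(\<lambda>t. lim (\<lambda>n. f n t)) \<in> C0 X"
proof -
  show lim: "(\<lambda>n. f n t) \<longlonglongrightarrow> lim (\<lambda>n. f n t)" for t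
  proof -
    have "Cauchy (\<lambda>n. f n t)"
      by (rule CauchyI) (metis cauchy)
    then show ?thesis
      by (simp add: Cauchy_convergent_iff convergent_LIMSEQ_iff)
  qed
  show uniform: "\<exists>N. \<forall>n\<ge>N. \<forall>t. cmod (lim (\<lambda>k. f k t) - f n t) < \<epsilon>" if "\<epsilon> > 0" for \<epsilon>
  proof -
    obtain N where N: "\<forall>m\<ge>N. \<forall>n\<ge>N. \<forall>t. cmod (f m t - f n t) < \<epsilon> / 2"
      using cauchy[of "\<epsilon> / 2"] \<open>\<epsilon> > 0\<close> by auto
    have "cmod (lim (\<lambda>k. f k t) - f n t) < \<epsilon>" if "N \<le> n" for n t
    proof -
      have "cmod (lim (\<lambda>k. f k t) - f n t) \<le> \<epsilon> / 2"
      proof (rule tendsto_upperbound)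
        show "(\<lambda>m. cmod (f m t - f n t)) \<longlonglongrightarrow> cmod (lim (\<lambda>k. f k t) - f n t)"
          by (intro tendsto_intros lim)
        show "\<forall>\<^sub>F m in sequentially. cmod (f m t - f n t) \<le> \<epsilon> / 2"
          using N that by (intro eventually_sequentiallyI[of N]) (simp add: less_imp_le)
      qed simp
      with \<open>\<epsilon> > 0\<close> show ?thesis by simp
    qed
    then show ?thesis by blast
  qed
  show "(\<lambda>t. lim (\<lambda>n. f n t)) \<in> C0 X"
  proof (rule C0_uniform_limit)
    fix \<epsilon> :: real assume "\<epsilon> > 0"
    then obtain N where "\<forall>n\<ge>N. \<forall>t. cmod (lim (\<lambda>k. f k t) - f n t) < \<epsilon>"
      using uniform by blast
    then show "\<exists>g\<in>C0 X. \<forall>t. cmod (lim (\<lambda>n. f n t) - g t) < \<epsilon>"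
      using f by blast
  qed
qed

lemma sup_norm_upper:
  assumes "f \<in> C0 X"
  shows "cmod (f t) \<le> sup_norm X f"
proof -
  obtain B where "B \<ge> 0" "\<And>t. cmod (f t) \<le> B"
    using C0_bounded[OF assms] by blast
  then have "bdd_above (insert 0 ((\<lambda>t. cmod (f t)) ` topspace X))"
    by (intro bdd_aboveI[of _ B]) auto
  moreover have "cmod (f t) \<in> insert 0 ((\<lambda>t. cmod (f t)) ` topspace X)"
    using C0_outside[OF assms, of t] by auto
  ultimately show ?thesis
    unfolding sup_norm_def by (rule cSup_upper[rotated])
qed

lemma sup_norm_least:
  assumes "B \<ge> 0" "\<And>t. t \<in> topspace X \<Longrightarrow> cmod (f t) \<le> B"
  shows "sup_norm X f \<le> B"
  unfolding sup_norm_def using assms by (intro cSup_least) auto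

lemma sup_norm_nonneg: "f \<in> C0 X \<Longrightarrow> 0 \<le> sup_norm X f"
  by (rule order_trans[OF norm_ge_zero sup_norm_upper])

lemma sup_norm_diff_le:
  assumes C0: "f \<in> C0 X" "g \<in> C0 X" and le: "\<And>t. cmod (f t - g t) \<le> e"
  shows "\<bar>sup_norm X f - sup_norm X g\<bar> \<le> e"
proof -
  have e: "0 \<le> e" using le order_trans[OF norm_ge_zero] by blast
  have "sup_norm X f \<le> sup_norm X g + e"
    using C0 e le norm_triangle_sub[of "f t" "g t" for t]
    by (intro sup_norm_least add_nonneg_nonneg sup_norm_nonneg)
      (meson add_mono order_trans sup_norm_upper)+
  moreover have "sup_norm X g \<le> sup_norm X f + e"
    using C0 e le norm_triangle_sub[of "g t" "f t" for t]
    by (intro sup_norm_least add_nonneg_nonneg sup_norm_nonneg)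
      (metis add_mono norm_minus_commute order_trans sup_norm_upper)+
  ultimately show ?thesis by linarith
qed

lemma sup_norm_zero [simp]: "sup_norm X (\<lambda>t. 0) = 0"
  using sup_norm_least[of 0 X "\<lambda>t. 0"] sup_norm_nonneg[of "\<lambda>t. 0" X] by simp

text \<open>
  Complete regularity separates \<open>p\<close> from the complement of \<open>V \<inter> W\<close>, where \<open>W\<close> is an open
  neighbourhood of \<open>p\<close> inside a compact set; so the bump vanishes outside a compact set.
\<close>

lemma bump_function:
  assumes "locally_compact_space X" "Hausdorff_space X" "openin X V" "p \<in> V"
  obtains g :: "'x \<Rightarrow> real" where "(\<lambda>t. of_real (g t)) \<in> C0 X" "g p = 1"
    "\<And>t. 0 \<le> g t" "\<And>t. g t \<le> 1" "\<And>t. t \<notin> V \<Longrightarrow> g t = 0"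
proof -
  have creg: "completely_regular_space X"
    using assms(1,2) locally_compact_Hausdorff_imp_regular_space
      locally_compact_regular_imp_completely_regular_space by blast
  have p: "p \<in> topspace X"
    using assms(3,4) openin_subset by blast
  then obtain W K where W: "openin X W" "compactin X K" "p \<in> W" "W \<subseteq> K"
    using assms(1) unfolding locally_compact_space_def by blast
  have "closedin X (topspace X - V \<inter> W)"
    using assms(3) W(1) by blast
  with p assms(4) W(3) creg obtain f :: "'x \<Rightarrow> real"
    where f: "continuous_map X (top_of_set {0..1}) f" "f p = 0" "f ` (topspace X - V \<inter> W) \<subseteq> {1}"
    unfolding completely_regular_space_def by (elim allE[of _ "topspace X - V \<inter> W"] allE[of _ p]) auto
  define g where "g t = (if t \<in> topspace X then 1 - f t else 0)" for t
  have f': "continuous_map X euclideanreal f" "\<And>t. t \<in> topspace X \<Longrightarrow> f t \<in> {0..1}"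
    using f(1) by (auto simp: continuous_map_in_subtopology)
  have supp: "g t = 0" if "t \<notin> V \<inter> W" for t
    using f(3) that by (auto simp: g_def)
  have "(\<lambda>t. complex_of_real (g t)) \<in> C0 X"
  proof (rule C0_I)
    have "continuous_map X euclidean (\<lambda>t. complex_of_real (1 - f t))"
      by (rule continuous_map_complex_compose[OF f'(1)]) (auto intro: continuous_intros)
    then show "continuous_map X euclidean (\<lambda>t. complex_of_real (g t))"
      by (rule continuous_map_eq) (simp add: g_def)
    show "\<exists>K. compactin X K \<and> (\<forall>t. t \<notin> K \<longrightarrow> cmod (complex_of_real (g t)) < \<epsilon>)"
      if "\<epsilon> > 0" for \<epsilon>
    proof (intro exI[of _ K] conjI allI impI)
      fix t assume "t \<notin> K"
      then have "g t = 0" using supp W(4) by blast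
      then show "cmod (complex_of_real (g t)) < \<epsilon>" using that by simp
    qed (rule W(2))
  qed (simp add: g_def)
  moreover have "0 \<le> g t" "g t \<le> 1" for t
    using f'(2) by (auto simp: g_def)
  ultimately show ?thesis
    using that[of g] f(2) p supp by (auto simp: g_def)
qed

text \<open>
  The point is continuity of the extension by zero. An open set that avoids \<open>0\<close> has the same preimage
  in \<open>U\<close> and in \<open>X\<close>; one that contains \<open>0\<close> has a preimage whose complement is a compact, hence
  closed, subset of \<open>X\<close>.
\<close>

lemma C0_ideal_eq_C0_subtopology:
  assumes "Hausdorff_space X" "openin X U"
  shows "C0_ideal X U = C0 (subtopology X U)"
proof -
  have U: "U \<subseteq> topspace X" "topspace (subtopology X U) = U"
    using assms(2) openin_subset by auto
  show ?thesis
  proof (intro equalityI subsetI)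
    fix f assume "f \<in> C0_ideal X U"
    then have f: "f \<in> C0 X" "\<And>t. t \<notin> U \<Longrightarrow> f t = 0"
      using C0_outside[of f X] by (auto simp: C0_ideal_def)
    show "f \<in> C0 (subtopology X U)"
    proof (rule C0_I)
      show "continuous_map (subtopology X U) euclidean f"
        using C0_continuous[OF f(1)] continuous_map_from_subtopology by blast
      show "f t = 0" if "t \<notin> topspace (subtopology X U)" for t
        using f(2) U that by auto
      fix \<epsilon> :: real assume \<epsilon>: "\<epsilon> > 0"
      obtain K where K: "compactin X K" "\<And>t. t \<notin> K \<Longrightarrow> cmod (f t) < \<epsilon>"
        using C0_compact_support[OF f(1) \<epsilon>] by blast
      define L where "L = {t \<in> topspace X. f t \<in> {z. \<epsilon> \<le> cmod z}}"
      have "closedin X L"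
        unfolding L_def
        by (rule closedin_continuous_map_preimage[OF C0_continuous[OF f(1)]])
          (auto intro: closed_Collect_le continuous_intros)
      moreover have "L \<subseteq> K" "L \<subseteq> U"
        using K(2) f(2) \<epsilon> by (force simp: L_def)+
      ultimately have "compactin (subtopology X U) L"
        using K(1) closed_compactin compactin_subtopology by blast
      moreover have "cmod (f t) < \<epsilon>" if "t \<notin> L" for t
        using that C0_outside[OF f(1), of t] \<epsilon> by (auto simp: L_def not_le)
      ultimately show "\<exists>K. compactin (subtopology X U) K \<and> (\<forall>t. t \<notin> K \<longrightarrow> cmod (f t) < \<epsilon>)"
        by blast
    qed
  next
    fix f assume f: "f \<in> C0 (subtopology X U)"
    have zero: "f t = 0" if "t \<notin> U" for t
      using C0_outside[OF f] U that by auto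
    have "f \<in> C0 X"
    proof (rule C0_I)
      show "f t = 0" if "t \<notin> topspace X" for t
        using zero that U by blast
      show "\<exists>K. compactin X K \<and> (\<forall>t. t \<notin> K \<longrightarrow> cmod (f t) < \<epsilon>)" if "\<epsilon> > 0" for \<epsilon>
        by (rule C0_compact_support[OF f that]) (auto simp: compactin_subtopology)
      show "continuous_map X euclidean f"
        unfolding continuous_map
      proof (intro conjI allI impI)
        fix W :: "complex set" assume "openin euclidean W"
        then have W: "open W" by simp
        have pre: "openin (subtopology X U) {t \<in> U. f t \<in> W}"
          using openin_continuous_map_preimage[OF C0_continuous[OF f], of W] W
          unfolding U(2) by simp
        then have preX: "openin X {t \<in> U. f t \<in> W}"
          using assms(2) openin_trans_full by blast
        show "openin X {t \<in> topspace X. f t \<in> W}"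
        proof (cases "0 \<in> W")
          case False
          then have "{t \<in> topspace X. f t \<in> W} = {t \<in> U. f t \<in> W}"
            using zero U by auto
          with preX show ?thesis by simp
        next
          case True
          \<comment> \<open>The complement of the preimage stays away from \<open>0\<close>, hence is compact in \<open>U\<close>.\<close>
          then obtain \<epsilon> where \<epsilon>: "\<epsilon> > 0" "\<And>z. cmod z < \<epsilon> \<Longrightarrow> z \<in> W"
            using W[unfolded open_dist] by (force simp: dist_norm)
          obtain K where K: "compactin (subtopology X U) K" "\<And>t. t \<notin> K \<Longrightarrow> cmod (f t) < \<epsilon>"
            using C0_compact_support[OF f \<epsilon>(1)] by blast
          have "closedin (subtopology X U) (U - {t \<in> U. f t \<in> W})"
            using closedin_diff[OF closedin_topspace pre] unfolding U(2) .
          moreover have "U - {t \<in> U. f t \<in> W} \<subseteq> K"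
            using K(2) \<epsilon>(2) by blast
          ultimately have "compactin X (U - {t \<in> U. f t \<in> W})"
            using K(1) closed_compactin compactin_subtopology by blast
          then have "closedin X (U - {t \<in> U. f t \<in> W})"
            using assms(1) compactin_imp_closedin by blast
          moreover have "{t \<in> topspace X. f t \<in> W} = topspace X - (U - {t \<in> U. f t \<in> W})"
            using zero True U by auto
          ultimately show ?thesis by auto
        qed
      qed auto
    qed
    then show "f \<in> C0_ideal X U"
      using zero by (simp add: C0_ideal_def)
  qed
qed

section \<open>Positive semidefinite kernels\<close>

lemma nonneg_Reals_iff_cmod: "z \<in> \<real>\<^sub>\<ge>\<^sub>0 \<longleftrightarrow> z = of_real (cmod z)"
proof
  show "z = of_real (cmod z)" if "z \<in> \<real>\<^sub>\<ge>\<^sub>0"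
    using that by (auto elim: nonneg_Reals_cases)
  show "z \<in> \<real>\<^sub>\<ge>\<^sub>0" if "z = of_real (cmod z)"
    by (subst that) simp
qed

lemma cnj_mult_eq_cmod_power2: "cnj z * z = of_real ((cmod z)\<^sup>2)"
  using complex_norm_square[of z] by (simp add: mult.commute)

lemma sum_list_cong:
  "(\<And>x. x \<in> set l \<Longrightarrow> f x = g x) \<Longrightarrow> (\<Sum>x\<leftarrow>l. f x) = (\<Sum>x\<leftarrow>l. g x)"
  by (intro arg_cong[where f = sum_list] map_cong) auto

lemma cauchy_schwarz_from_quadratic:
  assumes a: "a \<in> \<real>\<^sub>\<ge>\<^sub>0" and c: "c \<in> \<real>\<^sub>\<ge>\<^sub>0"
    and q: "\<And>z. a + z * b + cnj z * cnj b + z * cnj z * c \<in> \<real>\<^sub>\<ge>\<^sub>0"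
  shows "(cmod b)\<^sup>2 \<le> cmod a * cmod c"
proof -
  define A C where "A = cmod a" and "C = cmod c"
  have aA: "a = of_real A" and cC: "c = of_real C"
    using a c nonneg_Reals_iff_cmod by (auto simp: A_def C_def)
  have bb: "b * cnj b = of_real ((cmod b)\<^sup>2)"
    using complex_norm_square[of b] by simp
  \<comment> \<open>At \<open>z = - s * cnj b\<close> the hypothesis is a real quadratic in \<open>s\<close>; a large \<open>s\<close> (if \<open>C = 0\<close>)
      or its minimiser \<open>1 / C\<close> gives the claim.\<close>
  have ineq: "0 \<le> A - 2 * s * (cmod b)\<^sup>2 + s\<^sup>2 * (cmod b)\<^sup>2 * C" for s :: real
  proof -
    have "a + (- s * cnj b) * b + cnj (- s * cnj b) * cnj b
        + (- s * cnj b) * cnj (- s * cnj b) * c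
      = of_real A - 2 * s * (b * cnj b) + s\<^sup>2 * (b * cnj b) * of_real C"
      by (simp add: aA cC algebra_simps power2_eq_square)
    also have "\<dots> = of_real (A - 2 * s * (cmod b)\<^sup>2 + s\<^sup>2 * (cmod b)\<^sup>2 * C)"
      unfolding bb by simp
    finally show ?thesis
      using q[of "- s * cnj b"] nonneg_Reals_of_real_iff by metis
  qed
  show ?thesis
  proof (cases "C = 0")
    case True
    have "(cmod b)\<^sup>2 = 0"
    proof (rule ccontr)
      assume "(cmod b)\<^sup>2 \<noteq> 0"
      with ineq[of "(A + 1) / (cmod b)\<^sup>2"] True show False
        by (simp add: A_def) (use norm_ge_zero[of a] in linarith)
    qed
    with True show ?thesis by (simp add: A_def C_def)
  next
    case False
    then have "C > 0" by (simp add: C_def)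
    with ineq[of "1 / C"] have "(cmod b)\<^sup>2 / C \<le> A"
      by (simp add: power2_eq_square field_simps)
    with \<open>C > 0\<close> show ?thesis
      by (simp add: A_def[symmetric] C_def[symmetric] field_simps)
  qed
qed

text \<open>
  Lists, in which an entry may be repeated, avoid the question whether the vectors
  of a linear combination are distinct; formal sums are lists as well.
\<close>

definition quad_form :: "('a \<Rightarrow> 'a \<Rightarrow> complex) \<Rightarrow> (complex \<times> 'a) list \<Rightarrow> complex" where
  "quad_form K l = (\<Sum>(c, x)\<leftarrow>l. \<Sum>(d, y)\<leftarrow>l. cnj c * d * K x y)"

definition psd_kernel :: "'a set \<Rightarrow> ('a \<Rightarrow> 'a \<Rightarrow> complex) \<Rightarrow> bool" where
  "psd_kernel S K \<longleftrightarrow> (\<forall>x\<in>S. \<forall>y\<in>S. K y x = cnj (K x y))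
     \<and> (\<forall>l \<in> lists (UNIV \<times> S). quad_form K l \<in> \<real>\<^sub>\<ge>\<^sub>0)"

lemma psd_kernel_commute: "psd_kernel S K \<Longrightarrow> x \<in> S \<Longrightarrow> y \<in> S \<Longrightarrow> K y x = cnj (K x y)"
  unfolding psd_kernel_def by blast

lemma psd_kernel_quad_form: "psd_kernel S K \<Longrightarrow> l \<in> lists (UNIV \<times> S) \<Longrightarrow> quad_form K l \<in> \<real>\<^sub>\<ge>\<^sub>0"
  unfolding psd_kernel_def by blast

lemma psd_kernel_diagonal: "psd_kernel S K \<Longrightarrow> x \<in> S \<Longrightarrow> K x x \<in> \<real>\<^sub>\<ge>\<^sub>0"
  using psd_kernel_quad_form[of S K "[(1, x)]"] by (simp add: quad_form_def)

lemma psd_kernel_cauchy_schwarz: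
  assumes "psd_kernel S K" "x \<in> S" "y \<in> S"
  shows "(cmod (K x y))\<^sup>2 \<le> cmod (K x x) * cmod (K y y)"
proof (rule cauchy_schwarz_from_quadratic)
  fix z
  have "quad_form K [(1, x), (z, y)] \<in> \<real>\<^sub>\<ge>\<^sub>0"
    using assms by (intro psd_kernel_quad_form) auto
  then show "K x x + z * K x y + cnj z * cnj (K x y) + z * cnj z * K y y \<in> \<real>\<^sub>\<ge>\<^sub>0"
    using psd_kernel_commute[OF assms] by (simp add: quad_form_def algebra_simps)
qed (simp_all only: psd_kernel_diagonal[OF assms(1)] assms(2,3))

lemma sum_list_product:
  fixes f :: "'a \<Rightarrow> 'c::comm_semiring_0"
  shows "(\<Sum>p\<leftarrow>u. \<Sum>q\<leftarrow>v. f p * g q) = (\<Sum>p\<leftarrow>u. f p) * (\<Sum>q\<leftarrow>v. g q)"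
  by (simp add: sum_list_const_mult sum_list_mult_const)

lemma cnj_sum_list: "cnj (\<Sum>x\<leftarrow>l. f x) = (\<Sum>x\<leftarrow>l. cnj (f x))"
  by (induction l) auto

text \<open>
  Removing the component along \<open>a\<close>. The value of the new form at a combination \<open>l\<close> is the minimum of
  the old form over all \<open>z a + l\<close>.
\<close>

lemma psd_kernel_schur_complement:
  assumes psd: "psd_kernel S K" and a: "a \<in> S" and nz: "K a a \<noteq> 0"
  shows "psd_kernel S (\<lambda>x y. K x y - K x a * K a y / K a a)"
  unfolding psd_kernel_def
proof (intro conjI ballI)
  have real: "cnj (K a a) = K a a"
    using psd_kernel_commute[OF psd a a] by simp
  fix x y assume "x \<in> S" "y \<in> S"
  then show "K y x - K y a * K a x / K a a = cnj (K x y - K x a * K a y / K a a)"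
    using psd_kernel_commute[OF psd, of x y] psd_kernel_commute[OF psd, of x a]
      psd_kernel_commute[OF psd, of y a] a by (simp add: real)
next
  have real: "cnj (K a a) = K a a"
    using psd_kernel_commute[OF psd a a] by simp
  fix l :: "(complex \<times> 'a) list" assume l: "l \<in> lists (UNIV \<times> S)"
  define s where "s = (\<Sum>(d, y)\<leftarrow>l. d * K a y)"
  have s': "(\<Sum>(c, x)\<leftarrow>l. cnj c * K x a) = cnj s"
    unfolding s_def cnj_sum_list using l psd_kernel_commute[OF psd a]
    by (intro arg_cong[where f = sum_list] map_cong) auto
  \<comment> \<open>Adjoining \<open>a\<close> with the coefficient that minimises the form completes the square.\<close>
  define z where "z = - s / K a a"
  have "quad_form K ((z, a) # l) \<in> \<real>\<^sub>\<ge>\<^sub>0"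
    using l a by (intro psd_kernel_quad_form[OF psd]) auto
  also have "quad_form K ((z, a) # l)
      = cnj z * z * K a a + cnj z * s + z * cnj s + quad_form K l"
  proof -
    have "(\<Sum>(d, y)\<leftarrow>l. cnj z * d * K a y) = cnj z * s"
      unfolding s_def by (simp add: sum_list_const_mult[symmetric] split_def mult.assoc)
    moreover have "(\<Sum>(c, x)\<leftarrow>l. cnj c * z * K x a) = z * cnj s"
      unfolding s'[symmetric]
      by (simp add: sum_list_const_mult[symmetric] split_def mult.assoc mult.left_commute)
    ultimately show ?thesis
      by (simp add: quad_form_def sum_list_addf split_def algebra_simps)
  qed
  also have "\<dots> = quad_form K l - cnj s * s / K a a"
    using nz by (simp add: z_def real field_simps)
  also have "\<dots> = quad_form (\<lambda>x y. K x y - K x a * K a y / K a a) l"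
  proof -
    have "cnj s * s / K a a
        = (\<Sum>(c, x)\<leftarrow>l. \<Sum>(d, y)\<leftarrow>l. (cnj c * K x a) * (d * K a y)) / K a a"
      unfolding s'[symmetric] by (simp add: s_def split_def sum_list_product)
    also have "\<dots> = (\<Sum>(c, x)\<leftarrow>l. \<Sum>(d, y)\<leftarrow>l. cnj c * d * (K x a * K a y / K a a))"
      by (simp add: divide_inverse sum_list_const_mult[symmetric] split_def mult_ac)
    finally show ?thesis
      by (simp add: quad_form_def split_def right_diff_distrib sum_list_subtractf)
  qed
  finally show "quad_form (\<lambda>x y. K x y - K x a * K a y / K a a) l \<in> \<real>\<^sub>\<ge>\<^sub>0" .
qed

text \<open>
  Schur's product theorem with all coefficients \<open>1\<close>. A first entry \<open>(a, b)\<close> with \<open>K a a = 0\<close> contributes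
  nothing by Cauchy-Schwarz. Otherwise \<open>K\<close> splits into the rank one kernel
  \<open>K x a * K a y / K a a\<close>, whose product with \<open>L\<close> is a value of the quadratic form of \<open>L\<close>, and the
  Schur complement, which vanishes on \<open>a\<close> and is covered by the induction hypothesis.
\<close>

theorem schur_product:
  assumes "psd_kernel S K" and L: "psd_kernel T L" and "u \<in> lists (S \<times> T)"
  shows "(\<Sum>(x, y)\<leftarrow>u. \<Sum>(x', y')\<leftarrow>u. K x x' * L y y') \<in> \<real>\<^sub>\<ge>\<^sub>0"
  using assms(1,3)
proof (induction u arbitrary: K)
  case Nil
  then show ?case by simp
next
  case (Cons p u)
  obtain a b where p: "p = (a, b)" by fastforce
  have ab: "a \<in> S" "b \<in> T" and u: "u \<in> lists (S \<times> T)"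
    using Cons.prems(2) p by auto
  have drop_a: "(\<Sum>(x, y)\<leftarrow>p # u. \<Sum>(x', y')\<leftarrow>p # u. M x x' * L y y')
      = (\<Sum>(x, y)\<leftarrow>u. \<Sum>(x', y')\<leftarrow>u. M x x' * L y y')"
    if "\<And>x. x \<in> S \<Longrightarrow> M a x = 0" "\<And>x. x \<in> S \<Longrightarrow> M x a = 0" for M
  proof -
    have "(\<Sum>(x', y')\<leftarrow>p # u. M a x' * L b y') = 0"
    proof -
      have "(\<Sum>(x', y')\<leftarrow>p # u. M a x' * L b y') = (\<Sum>_\<leftarrow>p # u. 0)"
        using that(1) Cons.prems(2) by (intro sum_list_cong) (auto simp: p)
      then show ?thesis by simp
    qed
    moreover have "(\<Sum>(x, y)\<leftarrow>u. \<Sum>(x', y')\<leftarrow>p # u. M x x' * L y y')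
        = (\<Sum>(x, y)\<leftarrow>u. \<Sum>(x', y')\<leftarrow>u. M x x' * L y y')"
      using that(2) u by (intro sum_list_cong) (auto simp: p)
    ultimately show ?thesis
      by (simp add: p)
  qed
  show ?case
  proof (cases "K a a = 0")
    case True
    have "K a x = 0" "K x a = 0" if "x \<in> S" for x
      using psd_kernel_cauchy_schwarz[OF Cons.prems(1) ab(1) that]
        psd_kernel_commute[OF Cons.prems(1) ab(1) that] True by auto
    then show ?thesis
      using drop_a[of K] Cons.IH[OF Cons.prems(1) u] by simp
  next
    case False
    define K' where "K' = (\<lambda>x y. K x y - K x a * K a y / K a a)"
    have psd': "psd_kernel S K'"
      unfolding K'_def by (rule psd_kernel_schur_complement[OF Cons.prems(1) ab(1) False])
    define l where "l = map (\<lambda>(x, y). (K a x, y)) (p # u)"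
    have "quad_form L l \<in> \<real>\<^sub>\<ge>\<^sub>0"
      using Cons.prems(2) by (intro psd_kernel_quad_form[OF L]) (auto simp: l_def)
    moreover have "quad_form L l
        = (\<Sum>(x, y)\<leftarrow>p # u. \<Sum>(x', y')\<leftarrow>p # u. (K x a * K a x') * L y y')"
      unfolding quad_form_def l_def map_map o_def split_def fst_conv snd_conv
      using Cons.prems(2) psd_kernel_commute[OF Cons.prems(1) ab(1)]
      by (intro arg_cong[where f = sum_list] map_cong) auto
    moreover have "K a a \<in> \<real>\<^sub>\<ge>\<^sub>0"
      using psd_kernel_diagonal[OF Cons.prems(1) ab(1)] .
    ultimately have rank_one:
      "(\<Sum>(x, y)\<leftarrow>p # u. \<Sum>(x', y')\<leftarrow>p # u. (K x a * K a x') * L y y') / K a a \<in> \<real>\<^sub>\<ge>\<^sub>0"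
      by (metis nonneg_Reals_divide_I)
    have "K' a x = 0" "K' x a = 0" for x
      using False by (simp_all add: K'_def)
    then have "(\<Sum>(x, y)\<leftarrow>p # u. \<Sum>(x', y')\<leftarrow>p # u. K' x x' * L y y') \<in> \<real>\<^sub>\<ge>\<^sub>0"
      using drop_a[of K'] Cons.IH[OF psd' u] by simp
    moreover have "(\<Sum>(x, y)\<leftarrow>v. \<Sum>(x', y')\<leftarrow>v. K x x' * L y y')
        = (\<Sum>(x, y)\<leftarrow>v. \<Sum>(x', y')\<leftarrow>v. K' x x' * L y y')
          + (\<Sum>(x, y)\<leftarrow>v. \<Sum>(x', y')\<leftarrow>v. (K x a * K a x') * L y y') / K a a" for v
    proof -
      have "(\<Sum>(x, y)\<leftarrow>v. \<Sum>(x', y')\<leftarrow>v. K x x' * L y y')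
          = (\<Sum>(x, y)\<leftarrow>v. \<Sum>(x', y')\<leftarrow>v.
              K' x x' * L y y' + inverse (K a a) * ((K x a * K a x') * L y y'))"
        by (simp add: K'_def divide_inverse algebra_simps)
      then show ?thesis
        by (simp add: split_def sum_list_addf sum_list_const_mult divide_inverse mult.commute)
    qed
    ultimately show ?thesis
      using nonneg_Reals_add_I[OF _ rank_one] by metis
  qed
qed

section \<open>Semi-inner products with values in \<open>C\<^sub>0(X)\<close>\<close>

text \<open>
  Both a Hilbert module and the formal sums in two of them are of this kind. For formal sums the
  operations do not form a vector space (addition is concatenation of lists), so everything is
  expressed by the values of \<open>p\<close>.
\<close>

locale semi_inner_product =
  fixes X :: "'x topology" and S :: "'s set"
    and plus :: "'s \<Rightarrow> 's \<Rightarrow> 's" and scale :: "complex \<Rightarrow> 's \<Rightarrow> 's"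
    and p :: "'s \<Rightarrow> 's \<Rightarrow> 'x \<Rightarrow> complex"
  assumes plus_closed: "u \<in> S \<Longrightarrow> v \<in> S \<Longrightarrow> plus u v \<in> S"
    and scale_closed: "u \<in> S \<Longrightarrow> scale c u \<in> S"
    and p_C0: "u \<in> S \<Longrightarrow> v \<in> S \<Longrightarrow> p u v \<in> C0 X"
    and p_plus_right: "u \<in> S \<Longrightarrow> v \<in> S \<Longrightarrow> w \<in> S \<Longrightarrow> p u (plus v w) t = p u v t + p u w t"
    and p_scale_right: "u \<in> S \<Longrightarrow> v \<in> S \<Longrightarrow> p u (scale c v) t = c * p u v t"
    and p_commute: "u \<in> S \<Longrightarrow> v \<in> S \<Longrightarrow> p u v t = cnj (p v u t)"
    and p_nonneg: "u \<in> S \<Longrightarrow> p u u t \<in> \<real>\<^sub>\<ge>\<^sub>0"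
begin

definition nrm :: "'s \<Rightarrow> real" where "nrm u = sqrt (sup_norm X (p u u))"

definition minus :: "'s \<Rightarrow> 's \<Rightarrow> 's" where "minus u v = plus u (scale (-1) v)"

lemma minus_closed: "u \<in> S \<Longrightarrow> v \<in> S \<Longrightarrow> minus u v \<in> S"
  by (simp add: minus_def plus_closed scale_closed)

lemma p_plus_left:
  assumes "u \<in> S" "v \<in> S" "w \<in> S"
  shows "p (plus u v) w t = p u w t + p v w t"
  using p_plus_right[OF assms(3,1,2)] p_commute[OF _ assms(3)] assms plus_closed by simp

lemma p_scale_left:
  assumes "u \<in> S" "v \<in> S"
  shows "p (scale c u) v t = cnj c * p u v t"
  using p_scale_right[OF assms(2,1)] p_commute[OF _ assms(2)] assms scale_closed by simp

lemma p_minus_right: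
  "u \<in> S \<Longrightarrow> v \<in> S \<Longrightarrow> w \<in> S \<Longrightarrow> p u (minus v w) t = p u v t - p u w t"
  by (simp add: minus_def p_plus_right p_scale_right scale_closed)

lemma p_minus_left:
  "u \<in> S \<Longrightarrow> v \<in> S \<Longrightarrow> w \<in> S \<Longrightarrow> p (minus v w) u t = p v u t - p w u t"
  by (simp add: minus_def p_plus_left p_scale_left scale_closed)

lemmas p_simps = p_plus_left p_plus_right p_scale_left p_scale_right p_minus_left p_minus_right
  plus_closed scale_closed minus_closed

lemma cauchy_schwarz:
  assumes "u \<in> S" "v \<in> S"
  shows "(cmod (p u v t))\<^sup>2 \<le> cmod (p u u t) * cmod (p v v t)"
proof (rule cauchy_schwarz_from_quadratic)
  fix z
  have "p (plus u (scale z v)) (plus u (scale z v)) t \<in> \<real>\<^sub>\<ge>\<^sub>0"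
    using assms by (intro p_nonneg plus_closed scale_closed)
  then show "p u u t + z * p u v t + cnj z * cnj (p u v t) + z * cnj z * p v v t \<in> \<real>\<^sub>\<ge>\<^sub>0"
    using assms p_commute[OF assms(2,1), symmetric] by (simp add: p_simps algebra_simps)
qed (use assms p_nonneg in auto)

lemma nrm_nonneg: "u \<in> S \<Longrightarrow> 0 \<le> nrm u"
  by (simp add: nrm_def sup_norm_nonneg p_C0)

lemma nrm_upper: "u \<in> S \<Longrightarrow> cmod (p u u t) \<le> (nrm u)\<^sup>2"
  by (simp add: nrm_def sup_norm_nonneg p_C0 sup_norm_upper)

lemma nrm_least:
  assumes "B \<ge> 0" "\<And>t. cmod (p u u t) \<le> B\<^sup>2"
  shows "nrm u \<le> B"
  unfolding nrm_def using assms by (intro real_le_lsqrt sup_norm_least) auto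

lemma nrm_eq:
  assumes "\<And>t. p u u t = p v v t"
  shows "nrm u = nrm v"
  using assms by (simp add: nrm_def sup_norm_def)

lemma p_le_nrm:
  assumes "u \<in> S" "v \<in> S"
  shows "cmod (p u v t) \<le> nrm u * nrm v"
proof (rule power2_le_imp_le)
  have "(cmod (p u v t))\<^sup>2 \<le> cmod (p u u t) * cmod (p v v t)"
    by (rule cauchy_schwarz[OF assms])
  also have "\<dots> \<le> (nrm u)\<^sup>2 * (nrm v)\<^sup>2"
    using assms by (intro mult_mono nrm_upper) auto
  finally show "(cmod (p u v t))\<^sup>2 \<le> (nrm u * nrm v)\<^sup>2"
    by (simp add: power_mult_distrib)
  show "0 \<le> nrm u * nrm v" using assms by (simp add: nrm_nonneg)
qed

lemma nrm_plus_le: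
  assumes "u \<in> S" "v \<in> S"
  shows "nrm (plus u v) \<le> nrm u + nrm v"
proof (rule nrm_least)
  show "0 \<le> nrm u + nrm v" using assms by (simp add: nrm_nonneg)
  fix t
  have "cmod (p (plus u v) (plus u v) t) = cmod (p u u t + p v v t + (p u v t + p v u t))"
    using assms by (simp add: p_simps algebra_simps)
  also have "\<dots> \<le> cmod (p u u t) + cmod (p v v t) + (cmod (p u v t) + cmod (p v u t))"
    by (intro order_trans[OF norm_triangle_ineq] add_mono norm_triangle_ineq order_refl)
  also have "\<dots> \<le> (nrm u)\<^sup>2 + (nrm v)\<^sup>2 + (nrm u * nrm v + nrm v * nrm u)"
    using assms by (intro add_mono nrm_upper p_le_nrm)
  finally show "cmod (p (plus u v) (plus u v) t) \<le> (nrm u + nrm v)\<^sup>2"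
    by (simp add: power2_eq_square algebra_simps)
qed

lemma nrm_scale_le:
  assumes "u \<in> S"
  shows "nrm (scale c u) \<le> cmod c * nrm u"
proof (rule nrm_least)
  show "cmod (p (scale c u) (scale c u) t) \<le> (cmod c * nrm u)\<^sup>2" for t
    using mult_left_mono[OF nrm_upper[OF assms, of t], of "(cmod c)\<^sup>2"] assms
    by (simp add: p_simps norm_mult power_mult_distrib) (simp add: power2_eq_square mult.assoc)
qed (use assms nrm_nonneg in simp)

definition dst :: "'s \<Rightarrow> 's \<Rightarrow> real" where "dst u v = nrm (minus u v)"

lemma dst_nonneg: "u \<in> S \<Longrightarrow> v \<in> S \<Longrightarrow> 0 \<le> dst u v"
  by (simp add: dst_def nrm_nonneg minus_closed)

lemma dst_commute: "u \<in> S \<Longrightarrow> v \<in> S \<Longrightarrow> dst u v = dst v u"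
  unfolding dst_def by (rule nrm_eq) (simp add: p_simps)

lemma dst_triangle:
  assumes "u \<in> S" "v \<in> S" "w \<in> S"
  shows "dst u w \<le> dst u v + dst v w"
proof -
  have "nrm (minus u w) = nrm (plus (minus u v) (minus v w))"
    using assms by (intro nrm_eq) (simp add: p_simps)
  then show ?thesis
    unfolding dst_def using assms by (simp add: nrm_plus_le minus_closed)
qed

lemma nrm_le_dst:
  assumes "u \<in> S" "v \<in> S"
  shows "nrm u \<le> nrm v + dst u v"
proof -
  have "nrm u = nrm (plus v (minus u v))"
    using assms by (intro nrm_eq) (simp add: p_simps)
  then show ?thesis
    unfolding dst_def using assms by (simp add: nrm_plus_le minus_closed)
qed

text \<open>
  Formal sums that denote the same element of the algebraic tensor product are recognised by their
  inner products with all others.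
\<close>

lemma dst_null:
  assumes "u \<in> S" "v \<in> S" "\<And>w t. w \<in> S \<Longrightarrow> p w u t = p w v t"
  shows "dst u v = 0"
proof -
  have "nrm (minus u v) \<le> 0"
    using assms by (intro nrm_least) (simp_all add: p_minus_right minus_closed)
  then show ?thesis
    using dst_nonneg[OF assms(1,2)] by (simp add: dst_def)
qed

lemma p_diff_le:
  assumes "u \<in> S" "u' \<in> S" "v \<in> S" "v' \<in> S"
  shows "cmod (p u v t - p u' v' t) \<le> dst u u' * nrm v + nrm u' * dst v v'"
proof -
  have "p u v t - p u' v' t = p (minus u u') v t + p u' (minus v v') t"
    using assms by (simp add: p_simps)
  then have "cmod (p u v t - p u' v' t) \<le> cmod (p (minus u u') v t) + cmod (p u' (minus v v') t)"
    by (simp add: norm_triangle_ineq)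
  also have "\<dots> \<le> dst u u' * nrm v + nrm u' * dst v v'"
    unfolding dst_def using assms by (intro add_mono p_le_nrm minus_closed)
  finally show ?thesis .
qed

definition cauchy_seqs :: "(nat \<Rightarrow> 's) set" where
  "cauchy_seqs = {\<sigma>. (\<forall>n. \<sigma> n \<in> S) \<and> (\<forall>\<epsilon>>0. \<exists>N. \<forall>m\<ge>N. \<forall>n\<ge>N. dst (\<sigma> m) (\<sigma> n) < \<epsilon>)}"

definition equivalent :: "(nat \<Rightarrow> 's) \<Rightarrow> (nat \<Rightarrow> 's) \<Rightarrow> bool" where
  "equivalent \<sigma> \<tau> \<longleftrightarrow> (\<lambda>n. dst (\<sigma> n) (\<tau> n)) \<longlonglongrightarrow> 0"

lemma cauchy_seqs_closed: "\<sigma> \<in> cauchy_seqs \<Longrightarrow> \<sigma> n \<in> S"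
  by (simp add: cauchy_seqs_def)

lemma cauchy_seqs_dst:
  assumes "\<sigma> \<in> cauchy_seqs" "\<epsilon> > 0"
  obtains N where "\<And>m n. N \<le> m \<Longrightarrow> N \<le> n \<Longrightarrow> dst (\<sigma> m) (\<sigma> n) < \<epsilon>"
  using assms unfolding cauchy_seqs_def by blast

lemma cauchy_seqs_I:
  assumes "\<And>n. \<sigma> n \<in> S"
    and "\<And>\<epsilon>. \<epsilon> > 0 \<Longrightarrow> \<exists>N. \<forall>m\<ge>N. \<forall>n\<ge>N. dst (\<sigma> m) (\<sigma> n) < \<epsilon>"
  shows "\<sigma> \<in> cauchy_seqs"
  using assms by (simp add: cauchy_seqs_def)

lemma const_cauchy: "u \<in> S \<Longrightarrow> (\<lambda>n. u) \<in> cauchy_seqs"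
  by (rule cauchy_seqs_I) (simp_all add: dst_null)

lemma cauchy_seqs_bounded:
  assumes "\<sigma> \<in> cauchy_seqs"
  obtains M where "M > 0" "\<And>n. nrm (\<sigma> n) \<le> M"
proof -
  note S = cauchy_seqs_closed[OF assms]
  obtain N where N: "\<And>m n. N \<le> m \<Longrightarrow> N \<le> n \<Longrightarrow> dst (\<sigma> m) (\<sigma> n) < 1"
    using cauchy_seqs_dst[OF assms zero_less_one] by blast
  define M where "M = (\<Sum>n\<le>N. nrm (\<sigma> n)) + 1"
  have le: "nrm (\<sigma> n) \<le> (\<Sum>n\<le>N. nrm (\<sigma> n))" if "n \<le> N" for n
    using that S by (intro member_le_sum) (auto simp: nrm_nonneg)
  have "nrm (\<sigma> n) \<le> M" for n
  proof (cases "n \<le> N")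
    case True
    then show ?thesis using le by (simp add: M_def add_increasing2)
  next
    case False
    then have "nrm (\<sigma> n) \<le> nrm (\<sigma> N) + 1"
      using nrm_le_dst[OF S S, of n N] N[of n N] by simp
    then show ?thesis using le[of N] by (simp add: M_def)
  qed
  moreover have "M > 0"
    unfolding M_def using S by (intro add_nonneg_pos sum_nonneg) (auto simp: nrm_nonneg)
  ultimately show ?thesis using that by blast
qed

lemma equivalent_commute:
  "\<sigma> \<in> cauchy_seqs \<Longrightarrow> \<tau> \<in> cauchy_seqs \<Longrightarrow> equivalent \<sigma> \<tau> \<Longrightarrow> equivalent \<tau> \<sigma>"
  unfolding equivalent_def by (simp add: dst_commute cauchy_seqs_closed)

lemma equivalent_null:
  assumes "\<And>n. \<sigma> n \<in> S" "\<And>n. \<tau> n \<in> S" "\<And>n w t. w \<in> S \<Longrightarrow> p w (\<sigma> n) t = p w (\<tau> n) t"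
  shows "equivalent \<sigma> \<tau>"
  unfolding equivalent_def using assms by (simp add: dst_null)

lemma equivalent_refl: "\<sigma> \<in> cauchy_seqs \<Longrightarrow> equivalent \<sigma> \<sigma>"
  by (intro equivalent_null) (auto simp: cauchy_seqs_closed)

lemma equivalent_bound:
  assumes "\<And>n. \<sigma> n \<in> S" "\<And>n. \<tau> n \<in> S" "\<And>n. dst (\<sigma> n) (\<tau> n) \<le> g n" "g \<longlonglongrightarrow> 0"
  shows "equivalent \<sigma> \<tau>"
  unfolding equivalent_def
  by (rule tendsto_sandwich[OF _ _ tendsto_const assms(4)]) (use assms dst_nonneg in auto)

lemma equivalent_trans:
  assumes "\<sigma> \<in> cauchy_seqs" "\<tau> \<in> cauchy_seqs" "\<rho> \<in> cauchy_seqs"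
    and "equivalent \<sigma> \<tau>" "equivalent \<tau> \<rho>"
  shows "equivalent \<sigma> \<rho>"
proof (rule equivalent_bound)
  show "dst (\<sigma> n) (\<rho> n) \<le> dst (\<sigma> n) (\<tau> n) + dst (\<tau> n) (\<rho> n)" for n
    using assms by (intro dst_triangle cauchy_seqs_closed)
  show "(\<lambda>n. dst (\<sigma> n) (\<tau> n) + dst (\<tau> n) (\<rho> n)) \<longlonglongrightarrow> 0"
    using tendsto_add[OF assms(4,5)[unfolded equivalent_def]] by simp
qed (use assms cauchy_seqs_closed in auto)

lemma cauchy_seqs_null:
  assumes "\<sigma> \<in> cauchy_seqs" "\<And>n. \<tau> n \<in> S" "\<And>n w t. w \<in> S \<Longrightarrow> p w (\<sigma> n) t = p w (\<tau> n) t"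
  shows "\<tau> \<in> cauchy_seqs"
proof (rule cauchy_seqs_I)
  note S = cauchy_seqs_closed[OF assms(1)]
  have "dst (\<tau> m) (\<tau> n) \<le> dst (\<sigma> m) (\<sigma> n)" for m n
    using dst_triangle[OF assms(2)[of m] S[of m] assms(2)[of n]]
      dst_triangle[OF S[of m] S[of n] assms(2)[of n]]
      dst_null[OF assms(2)[of m] S[of m]] dst_null[OF S[of n] assms(2)[of n]] assms(3) by simp
  then show "\<exists>N. \<forall>m\<ge>N. \<forall>n\<ge>N. dst (\<tau> m) (\<tau> n) < \<epsilon>" if "\<epsilon> > 0" for \<epsilon>
    using cauchy_seqs_dst[OF assms(1) that] order_le_less_trans by metis
qed (rule assms(2))

lemma dst_plus_le:
  assumes "u \<in> S" "v \<in> S" "u' \<in> S" "v' \<in> S"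
  shows "dst (plus u v) (plus u' v') \<le> dst u u' + dst v v'"
proof -
  have "nrm (minus (plus u v) (plus u' v')) = nrm (plus (minus u u') (minus v v'))"
    using assms by (intro nrm_eq) (simp add: p_simps)
  then show ?thesis
    unfolding dst_def using assms by (simp add: nrm_plus_le minus_closed)
qed

lemma cauchy_plus:
  assumes "\<sigma> \<in> cauchy_seqs" "\<tau> \<in> cauchy_seqs"
  shows "(\<lambda>n. plus (\<sigma> n) (\<tau> n)) \<in> cauchy_seqs"
proof (rule cauchy_seqs_I)
  note S = cauchy_seqs_closed[OF assms(1)] cauchy_seqs_closed[OF assms(2)]
  show "plus (\<sigma> n) (\<tau> n) \<in> S" for n
    using S plus_closed by simp
  fix \<epsilon> :: real assume "\<epsilon> > 0"
  then have \<epsilon>: "\<epsilon> / 2 > 0" by simp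
  obtain N where N: "\<And>m n. N \<le> m \<Longrightarrow> N \<le> n \<Longrightarrow> dst (\<sigma> m) (\<sigma> n) < \<epsilon> / 2"
    using cauchy_seqs_dst[OF assms(1) \<epsilon>] by blast
  obtain N' where N': "\<And>m n. N' \<le> m \<Longrightarrow> N' \<le> n \<Longrightarrow> dst (\<tau> m) (\<tau> n) < \<epsilon> / 2"
    using cauchy_seqs_dst[OF assms(2) \<epsilon>] by blast
  show "\<exists>N. \<forall>m\<ge>N. \<forall>n\<ge>N. dst (plus (\<sigma> m) (\<tau> m)) (plus (\<sigma> n) (\<tau> n)) < \<epsilon>"
  proof (intro exI[of _ "max N N'"] allI impI)
    fix m n assume "max N N' \<le> m" "max N N' \<le> n"
    then show "dst (plus (\<sigma> m) (\<tau> m)) (plus (\<sigma> n) (\<tau> n)) < \<epsilon>"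
      using dst_plus_le[OF S(1)[of m] S(2)[of m] S(1)[of n] S(2)[of n]] N[of m n] N'[of m n] by simp
  qed
qed

lemma equivalent_plus:
  assumes "\<sigma> \<in> cauchy_seqs" "\<tau> \<in> cauchy_seqs" "\<sigma>' \<in> cauchy_seqs" "\<tau>' \<in> cauchy_seqs"
    and "equivalent \<sigma> \<sigma>'" "equivalent \<tau> \<tau>'"
  shows "equivalent (\<lambda>n. plus (\<sigma> n) (\<tau> n)) (\<lambda>n. plus (\<sigma>' n) (\<tau>' n))"
proof (rule equivalent_bound)
  show "dst (plus (\<sigma> n) (\<tau> n)) (plus (\<sigma>' n) (\<tau>' n)) \<le> dst (\<sigma> n) (\<sigma>' n) + dst (\<tau> n) (\<tau>' n)" for n
    using assms by (intro dst_plus_le cauchy_seqs_closed)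
  show "(\<lambda>n. dst (\<sigma> n) (\<sigma>' n) + dst (\<tau> n) (\<tau>' n)) \<longlonglongrightarrow> 0"
    using tendsto_add[OF assms(5,6)[unfolded equivalent_def]] by simp
qed (use assms cauchy_seqs_closed plus_closed in auto)

lemma p_uniformly_cauchy:
  assumes "\<sigma> \<in> cauchy_seqs" "\<tau> \<in> cauchy_seqs" "\<epsilon> > 0"
  shows "\<exists>N. \<forall>m\<ge>N. \<forall>n\<ge>N. \<forall>t. cmod (p (\<sigma> m) (\<tau> m) t - p (\<sigma> n) (\<tau> n) t) < \<epsilon>"
proof -
  note S = cauchy_seqs_closed[OF assms(1)] cauchy_seqs_closed[OF assms(2)]
  obtain A where A: "A > 0" "\<And>n. nrm (\<sigma> n) \<le> A"
    using cauchy_seqs_bounded[OF assms(1)] by blast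
  obtain B where B: "B > 0" "\<And>n. nrm (\<tau> n) \<le> B"
    using cauchy_seqs_bounded[OF assms(2)] by blast
  obtain N where N: "\<And>m n. N \<le> m \<Longrightarrow> N \<le> n \<Longrightarrow> dst (\<sigma> m) (\<sigma> n) < \<epsilon> / 2 / B"
    using cauchy_seqs_dst[OF assms(1), of "\<epsilon> / 2 / B"] assms(3) B(1) by auto
  obtain N' where N': "\<And>m n. N' \<le> m \<Longrightarrow> N' \<le> n \<Longrightarrow> dst (\<tau> m) (\<tau> n) < \<epsilon> / 2 / A"
    using cauchy_seqs_dst[OF assms(2), of "\<epsilon> / 2 / A"] assms(3) A(1) by auto
  have "cmod (p (\<sigma> m) (\<tau> m) t - p (\<sigma> n) (\<tau> n) t) < \<epsilon>" if "max N N' \<le> m" "max N N' \<le> n" for m n t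
  proof -
    have "cmod (p (\<sigma> m) (\<tau> m) t - p (\<sigma> n) (\<tau> n) t)
        \<le> dst (\<sigma> m) (\<sigma> n) * nrm (\<tau> m) + nrm (\<sigma> n) * dst (\<tau> m) (\<tau> n)"
      using S by (intro p_diff_le)
    also have "\<dots> \<le> dst (\<sigma> m) (\<sigma> n) * B + A * dst (\<tau> m) (\<tau> n)"
      using S A B by (intro add_mono mult_mono) (auto simp: dst_nonneg nrm_nonneg less_imp_le)
    also have "\<dots> < \<epsilon> / 2 / B * B + A * (\<epsilon> / 2 / A)"
      using that N[of m n] N'[of m n] A(1) B(1)
      by (intro add_strict_mono mult_strict_right_mono mult_strict_left_mono) auto
    also have "\<dots> = \<epsilon>" using A(1) B(1) by simp
    finally show ?thesis .
  qed
  then show ?thesis by blast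
qed

definition plim :: "(nat \<Rightarrow> 's) \<Rightarrow> (nat \<Rightarrow> 's) \<Rightarrow> 'x \<Rightarrow> complex" where
  "plim \<sigma> \<tau> t = lim (\<lambda>n. p (\<sigma> n) (\<tau> n) t)"

lemma
  assumes "\<sigma> \<in> cauchy_seqs" "\<tau> \<in> cauchy_seqs"
  shows plim_tendsto: "\<And>t. (\<lambda>n. p (\<sigma> n) (\<tau> n) t) \<longlonglongrightarrow> plim \<sigma> \<tau> t"
    and plim_uniform:
      "\<And>\<epsilon>. \<epsilon> > 0 \<Longrightarrow> \<exists>N. \<forall>n\<ge>N. \<forall>t. cmod (plim \<sigma> \<tau> t - p (\<sigma> n) (\<tau> n) t) < \<epsilon>"
    and plim_C0: "plim \<sigma> \<tau> \<in> C0 X"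
proof -
  have C0: "p (\<sigma> n) (\<tau> n) \<in> C0 X" for n
    using assms by (simp add: p_C0 cauchy_seqs_closed)
  note limit = C0_uniform_limit_of_sequence[OF C0 p_uniformly_cauchy[OF assms], folded plim_def]
  show "(\<lambda>n. p (\<sigma> n) (\<tau> n) t) \<longlonglongrightarrow> plim \<sigma> \<tau> t" for t
    by (rule limit(1))
  show "\<exists>N. \<forall>n\<ge>N. \<forall>t. cmod (plim \<sigma> \<tau> t - p (\<sigma> n) (\<tau> n) t) < \<epsilon>" if "\<epsilon> > 0" for \<epsilon>
    by (intro limit(2) that)
  show "plim \<sigma> \<tau> \<in> C0 X"
    by (rule limit(3))
qed

lemma plim_eqI:
  assumes "\<sigma> \<in> cauchy_seqs" "\<tau> \<in> cauchy_seqs" "(\<lambda>n. p (\<sigma> n) (\<tau> n) t) \<longlonglongrightarrow> z"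
  shows "plim \<sigma> \<tau> t = z"
  using LIMSEQ_unique[OF plim_tendsto[OF assms(1,2)] assms(3)] .

lemma plim_nonneg:
  assumes "\<sigma> \<in> cauchy_seqs"
  shows "plim \<sigma> \<sigma> t \<in> \<real>\<^sub>\<ge>\<^sub>0"
  by (rule closed_sequentially[OF closed_nonneg_Reals_complex _ plim_tendsto[OF assms assms]])
    (simp add: p_nonneg cauchy_seqs_closed[OF assms])

lemma plim_cong:
  assumes C: "\<sigma> \<in> cauchy_seqs" "\<tau> \<in> cauchy_seqs" "\<sigma>' \<in> cauchy_seqs" "\<tau>' \<in> cauchy_seqs"
    and E: "equivalent \<sigma> \<sigma>'" "equivalent \<tau> \<tau>'"
  shows "plim \<sigma> \<tau> t = plim \<sigma>' \<tau>' t"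
proof (rule plim_eqI[OF C(1,2)])
  obtain A where A: "A > 0" "\<And>n. nrm (\<sigma>' n) \<le> A"
    using cauchy_seqs_bounded[OF C(3)] by blast
  obtain B where B: "B > 0" "\<And>n. nrm (\<tau> n) \<le> B"
    using cauchy_seqs_bounded[OF C(2)] by blast
  have "(\<lambda>n. p (\<sigma> n) (\<tau> n) t - p (\<sigma>' n) (\<tau>' n) t) \<longlonglongrightarrow> 0"
  proof (rule Lim_null_comparison)
    have "cmod (p (\<sigma> n) (\<tau> n) t - p (\<sigma>' n) (\<tau>' n) t)
        \<le> dst (\<sigma> n) (\<sigma>' n) * B + A * dst (\<tau> n) (\<tau>' n)" for n
    proof -
      note S = C[THEN cauchy_seqs_closed, of n]
      have "cmod (p (\<sigma> n) (\<tau> n) t - p (\<sigma>' n) (\<tau>' n) t)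
          \<le> dst (\<sigma> n) (\<sigma>' n) * nrm (\<tau> n) + nrm (\<sigma>' n) * dst (\<tau> n) (\<tau>' n)"
        using S by (intro p_diff_le)
      also have "\<dots> \<le> dst (\<sigma> n) (\<sigma>' n) * B + A * dst (\<tau> n) (\<tau>' n)"
        using S A B by (intro add_mono mult_mono) (auto simp: dst_nonneg nrm_nonneg less_imp_le)
      finally show ?thesis .
    qed
    then show "\<forall>\<^sub>F n in sequentially. norm (p (\<sigma> n) (\<tau> n) t - p (\<sigma>' n) (\<tau>' n) t)
        \<le> dst (\<sigma> n) (\<sigma>' n) * B + A * dst (\<tau> n) (\<tau>' n)"
      by simp
    show "(\<lambda>n. dst (\<sigma> n) (\<sigma>' n) * B + A * dst (\<tau> n) (\<tau>' n)) \<longlonglongrightarrow> 0"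
      by (intro tendsto_add_zero tendsto_mult_left_zero tendsto_mult_right_zero
          E[unfolded equivalent_def])
  qed
  from tendsto_add[OF this plim_tendsto[OF C(3,4), of t]]
  show "(\<lambda>n. p (\<sigma> n) (\<tau> n) t) \<longlonglongrightarrow> plim \<sigma>' \<tau>' t"
    by simp
qed

end

text \<open>
  Operations on representatives that descend to the completion: scalars, the action of \<open>C\<^sub>0(X)\<close> and
  tensor products of maps.
\<close>

locale lipschitz_map = dom: semi_inner_product X S plus scale p
    + cod: semi_inner_product X S' plus' scale' p'
  for X :: "'x topology" and S :: "'s set" and plus scale p
    and S' :: "'r set" and plus' scale' p' +
  fixes \<Phi> :: "'s \<Rightarrow> 'r" and C :: real
  assumes closed: "u \<in> S \<Longrightarrow> \<Phi> u \<in> S'"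
    and lipschitz: "u \<in> S \<Longrightarrow> v \<in> S \<Longrightarrow> cod.dst (\<Phi> u) (\<Phi> v) \<le> C * dom.dst u v"
begin

lemma map_cauchy:
  assumes "\<sigma> \<in> dom.cauchy_seqs"
  shows "(\<lambda>n. \<Phi> (\<sigma> n)) \<in> cod.cauchy_seqs"
proof (rule cod.cauchy_seqs_I)
  note S = dom.cauchy_seqs_closed[OF assms]
  show "\<Phi> (\<sigma> n) \<in> S'" for n by (rule closed[OF S])
  fix \<epsilon> :: real assume "\<epsilon> > 0"
  then have "\<epsilon> / (\<bar>C\<bar> + 1) > 0"
    by simp
  then obtain N where N: "\<And>m n. N \<le> m \<Longrightarrow> N \<le> n \<Longrightarrow> dom.dst (\<sigma> m) (\<sigma> n) < \<epsilon> / (\<bar>C\<bar> + 1)"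
    using dom.cauchy_seqs_dst[OF assms] by metis
  show "\<exists>N. \<forall>m\<ge>N. \<forall>n\<ge>N. cod.dst (\<Phi> (\<sigma> m)) (\<Phi> (\<sigma> n)) < \<epsilon>"
  proof (intro exI[of _ N] allI impI)
    fix m n assume "N \<le> m" "N \<le> n"
    have "cod.dst (\<Phi> (\<sigma> m)) (\<Phi> (\<sigma> n)) \<le> C * dom.dst (\<sigma> m) (\<sigma> n)"
      by (rule lipschitz[OF S S])
    also have "\<dots> \<le> (\<bar>C\<bar> + 1) * dom.dst (\<sigma> m) (\<sigma> n)"
      by (intro mult_right_mono dom.dst_nonneg S) simp
    also have "\<dots> < \<epsilon>"
      using N[OF \<open>N \<le> m\<close> \<open>N \<le> n\<close>] by (simp add: pos_less_divide_eq mult.commute)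
    finally show "cod.dst (\<Phi> (\<sigma> m)) (\<Phi> (\<sigma> n)) < \<epsilon>" .
  qed
qed

lemma map_equivalent:
  assumes "\<sigma> \<in> dom.cauchy_seqs" "\<tau> \<in> dom.cauchy_seqs" "dom.equivalent \<sigma> \<tau>"
  shows "cod.equivalent (\<lambda>n. \<Phi> (\<sigma> n)) (\<lambda>n. \<Phi> (\<tau> n))"
proof (rule cod.equivalent_bound)
  show "cod.dst (\<Phi> (\<sigma> n)) (\<Phi> (\<tau> n)) \<le> C * dom.dst (\<sigma> n) (\<tau> n)" for n
    by (intro lipschitz dom.cauchy_seqs_closed assms)
  show "(\<lambda>n. C * dom.dst (\<sigma> n) (\<tau> n)) \<longlonglongrightarrow> 0"
    using assms(3) unfolding dom.equivalent_def by (rule tendsto_mult_right_zero)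
qed (auto intro: closed dom.cauchy_seqs_closed assms)

end

context semi_inner_product
begin

lemma scale_lipschitz:
  "lipschitz_map X S plus scale p S plus scale p (scale c) (cmod c)"
proof unfold_locales
  fix u v assume "u \<in> S" "v \<in> S"
  moreover from this have "nrm (minus (scale c u) (scale c v)) = nrm (scale c (minus u v))"
    by (intro nrm_eq) (simp add: p_simps algebra_simps)
  ultimately show "dst (scale c u) (scale c v) \<le> cmod c * dst u v"
    unfolding dst_def by (simp add: nrm_scale_le minus_closed)
qed (simp add: scale_closed)

lemma cauchy_scale: "\<sigma> \<in> cauchy_seqs \<Longrightarrow> (\<lambda>n. scale c (\<sigma> n)) \<in> cauchy_seqs"
  by (rule lipschitz_map.map_cauchy[OF scale_lipschitz])

lemma cauchy_minus:
  "\<sigma> \<in> cauchy_seqs \<Longrightarrow> \<tau> \<in> cauchy_seqs \<Longrightarrow> (\<lambda>n. minus (\<sigma> n) (\<tau> n)) \<in> cauchy_seqs"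
  unfolding minus_def by (intro cauchy_plus cauchy_scale)

lemma plim_commute:
  assumes "\<sigma> \<in> cauchy_seqs" "\<tau> \<in> cauchy_seqs"
  shows "plim \<sigma> \<tau> t = cnj (plim \<tau> \<sigma> t)"
proof (rule plim_eqI[OF assms])
  have "(\<lambda>n. cnj (p (\<tau> n) (\<sigma> n) t)) \<longlonglongrightarrow> cnj (plim \<tau> \<sigma> t)"
    by (intro tendsto_intros plim_tendsto assms)
  moreover have "cnj (p (\<tau> n) (\<sigma> n) t) = p (\<sigma> n) (\<tau> n) t" for n
    using p_commute[of "\<sigma> n" "\<tau> n" t] assms by (simp add: cauchy_seqs_closed)
  ultimately show "(\<lambda>n. p (\<sigma> n) (\<tau> n) t) \<longlonglongrightarrow> cnj (plim \<tau> \<sigma> t)"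
    by simp
qed

lemma plim_plus_right:
  assumes "\<sigma> \<in> cauchy_seqs" "\<tau> \<in> cauchy_seqs" "\<rho> \<in> cauchy_seqs"
  shows "plim \<sigma> (\<lambda>n. plus (\<tau> n) (\<rho> n)) t = plim \<sigma> \<tau> t + plim \<sigma> \<rho> t"
proof (rule plim_eqI)
  show "(\<lambda>n. p (\<sigma> n) (plus (\<tau> n) (\<rho> n)) t) \<longlonglongrightarrow> plim \<sigma> \<tau> t + plim \<sigma> \<rho> t"
    using tendsto_add[OF plim_tendsto[OF assms(1,2)] plim_tendsto[OF assms(1,3)]]
    by (simp add: p_plus_right cauchy_seqs_closed[OF assms(1)] cauchy_seqs_closed[OF assms(2)]
        cauchy_seqs_closed[OF assms(3)])
qed (use assms cauchy_plus in auto)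

text \<open>
  Stated for any sequence \<open>\<tau>'\<close> with the required inner products, so as to apply to the action of
  \<open>C\<^sub>0(X)\<close>, where the factor \<open>c\<close> depends on the point \<open>t\<close>.
\<close>

lemma plim_cmult_right:
  assumes "\<sigma> \<in> cauchy_seqs" "\<tau> \<in> cauchy_seqs" "\<tau>' \<in> cauchy_seqs"
    and "\<And>n. p (\<sigma> n) (\<tau>' n) t = c * p (\<sigma> n) (\<tau> n) t"
  shows "plim \<sigma> \<tau>' t = c * plim \<sigma> \<tau> t"
  using tendsto_mult_left[OF plim_tendsto[OF assms(1,2)], of c t]
  by (intro plim_eqI assms) (simp add: assms(4))

definition limit_nrm :: "(nat \<Rightarrow> 's) \<Rightarrow> real" where
  "limit_nrm \<rho> = sqrt (sup_norm X (plim \<rho> \<rho>))"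

lemma limit_nrm_nonneg: "\<rho> \<in> cauchy_seqs \<Longrightarrow> 0 \<le> limit_nrm \<rho>"
  by (simp add: limit_nrm_def sup_norm_nonneg plim_C0)

text \<open>
  The inner products converge uniformly on \<open>X\<close>, so their suprema converge as well.
\<close>

lemma limit_nrm_tendsto:
  assumes C: "\<rho> \<in> cauchy_seqs"
  shows "(\<lambda>n. nrm (\<rho> n)) \<longlonglongrightarrow> limit_nrm \<rho>"
  unfolding nrm_def limit_nrm_def
proof (intro tendsto_real_sqrt LIMSEQ_I)
  fix \<epsilon> :: real assume "\<epsilon> > 0"
  then obtain N where N: "\<forall>n\<ge>N. \<forall>t. cmod (plim \<rho> \<rho> t - p (\<rho> n) (\<rho> n) t) < \<epsilon> / 2"
    using plim_uniform[OF C C, of "\<epsilon> / 2"] by auto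
  have "norm (sup_norm X (p (\<rho> n) (\<rho> n)) - sup_norm X (plim \<rho> \<rho>)) < \<epsilon>" if "N \<le> n" for n
  proof -
    have "\<bar>sup_norm X (p (\<rho> n) (\<rho> n)) - sup_norm X (plim \<rho> \<rho>)\<bar> \<le> \<epsilon> / 2"
      using N that cauchy_seqs_closed[OF C]
      by (intro sup_norm_diff_le p_C0 plim_C0 C) (auto simp: norm_minus_commute less_imp_le)
    with \<open>\<epsilon> > 0\<close> show ?thesis by simp
  qed
  then show "\<exists>N. \<forall>n\<ge>N. norm (sup_norm X (p (\<rho> n) (\<rho> n)) - sup_norm X (plim \<rho> \<rho>)) < \<epsilon>"
    by blast
qed

text \<open>
  The norms of the differences tend to the norm of the limit, which is \<open>0\<close>.
\<close>

lemma equivalent_definite: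
  assumes C: "\<sigma> \<in> cauchy_seqs" "\<tau> \<in> cauchy_seqs"
    and zero: "plim (\<lambda>n. minus (\<sigma> n) (\<tau> n)) (\<lambda>n. minus (\<sigma> n) (\<tau> n)) = (\<lambda>t. 0)"
  shows "equivalent \<sigma> \<tau>"
  using limit_nrm_tendsto[OF cauchy_minus[OF C]]
  unfolding equivalent_def dst_def limit_nrm_def zero by simp

text \<open>
  Completeness of the completion. From each sequence \<open>\<sigma> k\<close> take a member beyond which it varies by
  less than \<open>1 / Suc k\<close>; these members form the limit.
\<close>

lemma diagonal_limit:
  assumes C: "\<And>k. \<sigma> k \<in> cauchy_seqs"
    and cauchy: "\<And>\<epsilon>. \<epsilon> > 0 \<Longrightarrow>
      \<exists>N. \<forall>k\<ge>N. \<forall>l\<ge>N. limit_nrm (\<lambda>n. minus (\<sigma> k n) (\<sigma> l n)) < \<epsilon>"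
  shows "\<exists>\<tau> \<in> cauchy_seqs. (\<lambda>k. limit_nrm (\<lambda>n. minus (\<sigma> k n) (\<tau> n))) \<longlonglongrightarrow> 0"
proof -
  note S = cauchy_seqs_closed[OF C]
  have "\<exists>m. \<forall>n\<ge>m. dst (\<sigma> k n) (\<sigma> k m) < 1 / Suc k" for k
  proof -
    obtain m where "\<And>n n'. m \<le> n \<Longrightarrow> m \<le> n' \<Longrightarrow> dst (\<sigma> k n) (\<sigma> k n') < 1 / Suc k"
      using cauchy_seqs_dst[OF C[of k], of "1 / Suc k"] by auto
    then show ?thesis by blast
  qed
  then obtain m where m: "\<And>k n. m k \<le> n \<Longrightarrow> dst (\<sigma> k n) (\<sigma> k (m k)) < 1 / Suc k"
    by metis
  define \<tau> where "\<tau> k = \<sigma> k (m k)" for k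
  have \<tau>S: "\<tau> k \<in> S" for k by (simp add: \<tau>_def S)
  have \<tau>: "\<tau> \<in> cauchy_seqs"
  proof (rule cauchy_seqs_I[OF \<tau>S])
    fix \<epsilon> :: real assume "\<epsilon> > 0"
    then obtain N where N: "\<forall>k\<ge>N. \<forall>l\<ge>N. limit_nrm (\<lambda>n. minus (\<sigma> k n) (\<sigma> l n)) < \<epsilon> / 3"
      using cauchy[of "\<epsilon> / 3"] by auto
    obtain M :: nat where M: "1 / Suc M < \<epsilon> / 3"
      using nat_approx_posE[of "\<epsilon> / 3"] \<open>\<epsilon> > 0\<close> by auto
    have small: "1 / Suc k < \<epsilon> / 3" if "M \<le> k" for k
    proof -
      have "1 / real (Suc k) \<le> 1 / real (Suc M)"
        using that by (intro divide_left_mono) auto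
      with M show ?thesis by simp
    qed
    show "\<exists>N. \<forall>k\<ge>N. \<forall>l\<ge>N. dst (\<tau> k) (\<tau> l) < \<epsilon>"
    proof (intro exI[of _ "max M N"] allI impI)
      fix k l assume k: "max M N \<le> k" and l: "max M N \<le> l"
      then have "limit_nrm (\<lambda>n. minus (\<sigma> k n) (\<sigma> l n)) < \<epsilon> / 3"
        using N by simp
      then obtain N' where N': "\<And>n. N' \<le> n \<Longrightarrow> dst (\<sigma> k n) (\<sigma> l n) < \<epsilon> / 3"
        using order_tendstoD(2)[OF limit_nrm_tendsto[OF cauchy_minus[OF C C]]]
        unfolding dst_def eventually_sequentially by blast
      \<comment> \<open>The chosen members are compared by way of members far out in both sequences.\<close>
      define n where "n = max N' (max (m k) (m l))"
      have "dst (\<tau> k) (\<tau> l) \<le> dst (\<tau> k) (\<sigma> k n) + dst (\<sigma> k n) (\<tau> l)"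
        using \<tau>S S by (intro dst_triangle)
      also have "dst (\<sigma> k n) (\<tau> l) \<le> dst (\<sigma> k n) (\<sigma> l n) + dst (\<sigma> l n) (\<tau> l)"
        using \<tau>S S by (intro dst_triangle)
      also have "dst (\<tau> k) (\<sigma> k n) < \<epsilon> / 3"
        unfolding dst_commute[OF \<tau>S[of k] S[of k n]] unfolding \<tau>_def
        by (rule less_trans[OF m small]) (use k in \<open>simp_all add: n_def\<close>)
      also have "dst (\<sigma> k n) (\<sigma> l n) < \<epsilon> / 3"
        using N' by (simp add: n_def)
      also have "dst (\<sigma> l n) (\<tau> l) < \<epsilon> / 3"
        unfolding \<tau>_def by (rule less_trans[OF m small]) (use l in \<open>simp_all add: n_def\<close>)
      finally show "dst (\<tau> k) (\<tau> l) < \<epsilon>" by simp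
    qed
  qed
  have "(\<lambda>k. limit_nrm (\<lambda>n. minus (\<sigma> k n) (\<tau> n))) \<longlonglongrightarrow> 0"
  proof (rule LIMSEQ_I)
    fix \<epsilon> :: real assume "\<epsilon> > 0"
    then obtain N where N: "\<And>k l. N \<le> k \<Longrightarrow> N \<le> l \<Longrightarrow> dst (\<tau> k) (\<tau> l) < \<epsilon> / 3"
      using cauchy_seqs_dst[OF \<tau>, of "\<epsilon> / 3"] by auto
    obtain M :: nat where M: "1 / Suc M < \<epsilon> / 3"
      using nat_approx_posE[of "\<epsilon> / 3"] \<open>\<epsilon> > 0\<close> by auto
    have "norm (limit_nrm (\<lambda>n. minus (\<sigma> k n) (\<tau> n)) - 0) < \<epsilon>" if k: "max M N \<le> k" for k
    proof -
      have "1 / real (Suc k) \<le> 1 / real (Suc M)"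
        using k by (intro divide_left_mono) auto
      with M have small: "1 / real (Suc k) < \<epsilon> / 3" by simp
      have "limit_nrm (\<lambda>n. minus (\<sigma> k n) (\<tau> n)) \<le> \<epsilon> / 3 + \<epsilon> / 3"
      proof (intro LIMSEQ_le_const2[OF limit_nrm_tendsto[OF cauchy_minus[OF C \<tau>]]]
          exI[of _ "max N (m k)"] allI impI)
        fix n assume n: "max N (m k) \<le> n"
        have "dst (\<sigma> k n) (\<tau> n) \<le> dst (\<sigma> k n) (\<tau> k) + dst (\<tau> k) (\<tau> n)"
          using \<tau>S S by (intro dst_triangle)
        also have "\<dots> \<le> \<epsilon> / 3 + \<epsilon> / 3"
          using m[of k n] n k small N[of k n] by (intro add_mono) (simp_all add: \<tau>_def)
        finally show "nrm (minus (\<sigma> k n) (\<tau> n)) \<le> \<epsilon> / 3 + \<epsilon> / 3"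
          by (simp add: dst_def)
      qed
      then show ?thesis
        using limit_nrm_nonneg[OF cauchy_minus[OF C[of k] \<tau>]] \<open>\<epsilon> > 0\<close> by simp
    qed
    then show "\<exists>N. \<forall>k\<ge>N. norm (limit_nrm (\<lambda>n. minus (\<sigma> k n) (\<tau> n)) - 0) < \<epsilon>"
      by blast
  qed
  with \<tau> show ?thesis by blast
qed

end


section \<open>Hilbert modules\<close>

lemma complex_ring_simps [simp]:
  "carrier complex_ring = UNIV" "a \<otimes>\<^bsub>complex_ring\<^esub> b = a * b" "\<one>\<^bsub>complex_ring\<^esub> = 1"
  "\<zero>\<^bsub>complex_ring\<^esub> = 0" "a \<oplus>\<^bsub>complex_ring\<^esub> b = a + b"
  by (simp_all add: complex_ring_def)

lemma cring_complex_ring: "cring complex_ring"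
proof (rule cringI)
  show "abelian_group complex_ring"
  proof (rule abelian_groupI)
    show "\<exists>y\<in>carrier complex_ring. y \<oplus>\<^bsub>complex_ring\<^esub> x = \<zero>\<^bsub>complex_ring\<^esub>" for x
      by (rule bexI[of _ "- x"]) simp_all
  qed (simp_all add: algebra_simps)
  show "comm_monoid complex_ring"
    by (rule comm_monoidI) (simp_all add: algebra_simps)
qed (simp add: algebra_simps)

text \<open>
  Multiplication by \<open>-1\<close> provides the negatives, so only closure and identities have to be checked.
\<close>

lemma complex_moduleI:
  fixes E (structure)
  assumes "\<And>x y. x \<in> carrier E \<Longrightarrow> y \<in> carrier E \<Longrightarrow> x \<oplus> y \<in> carrier E"
    and "\<And>c x. x \<in> carrier E \<Longrightarrow> c \<odot> x \<in> carrier E"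
    and "\<zero> \<in> carrier E"
    and "\<And>x y z. x \<in> carrier E \<Longrightarrow> y \<in> carrier E \<Longrightarrow> z \<in> carrier E \<Longrightarrow> (x \<oplus> y) \<oplus> z = x \<oplus> (y \<oplus> z)"
    and "\<And>x y. x \<in> carrier E \<Longrightarrow> y \<in> carrier E \<Longrightarrow> x \<oplus> y = y \<oplus> x"
    and "\<And>x. x \<in> carrier E \<Longrightarrow> \<zero> \<oplus> x = x"
    and "\<And>x. x \<in> carrier E \<Longrightarrow> (-1) \<odot> x \<oplus> x = \<zero>"
    and "\<And>a b x. x \<in> carrier E \<Longrightarrow> (a + b) \<odot> x = a \<odot> x \<oplus> b \<odot> x"
    and "\<And>c x y. x \<in> carrier E \<Longrightarrow> y \<in> carrier E \<Longrightarrow> c \<odot> (x \<oplus> y) = c \<odot> x \<oplus> c \<odot> y"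
    and "\<And>a b x. x \<in> carrier E \<Longrightarrow> (a * b) \<odot> x = a \<odot> (b \<odot> x)"
    and "\<And>x. x \<in> carrier E \<Longrightarrow> 1 \<odot> x = x"
  shows "module complex_ring E"
proof (rule moduleI[OF cring_complex_ring])
  show "abelian_group E"
  proof (rule abelian_groupI)
    show "\<exists>y\<in>carrier E. y \<oplus> x = \<zero>" if "x \<in> carrier E" for x
      using assms(2,7) that by blast
  qed (use assms in auto)
qed (use assms in simp_all)

context
  fixes E (structure)
  assumes M: "module complex_ring E"
begin

interpretation module complex_ring E by (rule M)

lemma complex_module_axioms:
  "x \<in> carrier E \<Longrightarrow> c \<odot> x \<in> carrier E"
  "x \<in> carrier E \<Longrightarrow> (a + b) \<odot> x = a \<odot> x \<oplus> b \<odot> x"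
  "x \<in> carrier E \<Longrightarrow> y \<in> carrier E \<Longrightarrow> c \<odot> (x \<oplus> y) = c \<odot> x \<oplus> c \<odot> y"
  "x \<in> carrier E \<Longrightarrow> (a * b) \<odot> x = a \<odot> (b \<odot> x)"
  "x \<in> carrier E \<Longrightarrow> 1 \<odot> x = x"
  using smult_closed[of c x] smult_l_distr[of a b x] smult_r_distr[of c x y]
    smult_assoc1[of a b x] smult_one[of x] by simp_all

lemma complex_module_scale_zero: "x \<in> carrier E \<Longrightarrow> 0 \<odot> x = \<zero>"
  using smult_l_null[of x] by simp

lemma complex_module_neg: "x \<in> carrier E \<Longrightarrow> \<ominus> x = (-1) \<odot> x"
proof -
  assume x: "x \<in> carrier E"
  have "(-1) \<odot> x \<oplus> x = ((-1) + 1) \<odot> x"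
    unfolding complex_module_axioms(2)[OF x] using x by (simp add: complex_module_axioms)
  also have "\<dots> = \<zero>"
    by (simp add: complex_module_scale_zero x)
  finally show ?thesis
    using x complex_module_axioms(1) by (intro M.minus_equality) auto
qed

lemma complex_module_minus: "y \<in> carrier E \<Longrightarrow> x \<ominus> y = x \<oplus> (-1) \<odot> y"
  by (simp add: a_minus_def complex_module_neg)

end

lemma (in hilbert_module) semi_inner: "semi_inner_product X (carrier E) (\<oplus>) (\<odot>) (ip E)"
proof
  show "ip E u v t = cnj (ip E v u t)" if "u \<in> carrier E" "v \<in> carrier E" for u v t
    using ip_commute[OF that] by metis
qed (simp_all add: ip_closed ip_add_right ip_scale_right ip_nonneg complex_module_axioms(1)[OF module_axioms])

sublocale hilbert_module \<subseteq> inner: semi_inner_product X "carrier E" "(\<oplus>)" "(\<odot>)" "ip E"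
  by (rule semi_inner)

context hilbert_module
begin

lemmas scale_axioms = complex_module_axioms[OF module_axioms]
lemmas scale_zero = complex_module_scale_zero[OF module_axioms]
lemmas neg_eq_scale = complex_module_neg[OF module_axioms]
lemmas minus_eq_scale = complex_module_minus[OF module_axioms]

lemma hnorm_eq: "hnorm X E x = inner.nrm x"
  by (simp add: hnorm_def inner.nrm_def)

lemma hnorm_minus: "y \<in> carrier E \<Longrightarrow> hnorm X E (x \<ominus> y) = inner.dst x y"
  by (simp add: hnorm_eq inner.dst_def inner.minus_def minus_eq_scale)

lemma ip_act_left:
  assumes "f \<in> C0 X" "x \<in> carrier E" "y \<in> carrier E"
  shows "ip E (act E f x) y t = cnj (f t) * ip E x y t"
proof -
  have "ip E (act E f x) y t = cnj (ip E y (act E f x) t)"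
    using assms by (intro inner.p_commute act_closed)
  also have "\<dots> = cnj (f t) * cnj (ip E y x t)"
    using assms by (simp add: ip_act_right)
  also have "cnj (ip E y x t) = ip E x y t"
    using assms inner.p_commute[of x y t] by simp
  finally show ?thesis .
qed

lemma ip_zero [simp]:
  assumes "x \<in> carrier E"
  shows "ip E x \<zero> t = 0" "ip E \<zero> x t = 0"
proof -
  have "\<zero> = 0 \<odot> x" using scale_zero[OF assms] by simp
  then show "ip E x \<zero> t = 0" "ip E \<zero> x t = 0"
    using assms by (simp_all add: inner.p_scale_right inner.p_scale_left)
qed

lemma dst_zeroD:
  assumes "x \<in> carrier E" "y \<in> carrier E" "inner.dst x y = 0"
  shows "x = y"
proof -
  have "x \<ominus> y \<in> carrier E" using assms by simp
  moreover have "ip E (x \<ominus> y) (x \<ominus> y) t = 0" for t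
    using inner.nrm_upper[OF \<open>x \<ominus> y \<in> carrier E\<close>, of t] assms hnorm_minus[of y x]
    by (simp add: hnorm_eq)
  ultimately have "x \<ominus> y = \<zero>"
    by (intro ip_definite) auto
  then show ?thesis
    using assms by (metis M.add.inv_closed M.minus_equality M.minus_minus a_minus_def)
qed

lemma zero_act: "f \<in> C0 X \<Longrightarrow> act E f \<zero> = \<zero>"
  using scale_zero[of "\<zero>"] act_scale_right[of f "\<zero>" 0] scale_zero[of "act E f \<zero>"] act_closed[of f "\<zero>"]
  by simp

fun lincomb :: "(complex \<times> 'e) list \<Rightarrow> 'e" where
  "lincomb [] = \<zero>"
| "lincomb ((c, x) # l) = c \<odot> x \<oplus> lincomb l"

lemma lincomb_closed: "l \<in> lists (UNIV \<times> carrier E) \<Longrightarrow> lincomb l \<in> carrier E"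
  by (induction l rule: lincomb.induct) (auto simp: scale_axioms)

lemma ip_lincomb_right:
  assumes "y \<in> carrier E" "l \<in> lists (UNIV \<times> carrier E)"
  shows "ip E y (lincomb l) t = (\<Sum>(c, x)\<leftarrow>l. c * ip E y x t)"
  using assms(2)
  by (induction l rule: lincomb.induct)
    (auto simp: assms(1) inner.p_simps lincomb_closed scale_axioms)

lemma ip_lincomb_left:
  assumes "y \<in> carrier E" "l \<in> lists (UNIV \<times> carrier E)"
  shows "ip E (lincomb l) y t = (\<Sum>(c, x)\<leftarrow>l. cnj c * ip E x y t)"
  using assms(2)
  by (induction l rule: lincomb.induct)
    (auto simp: assms(1) inner.p_simps lincomb_closed scale_axioms)

lemma ip_lincomb:
  assumes "l \<in> lists (UNIV \<times> carrier E)"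
  shows "ip E (lincomb l) (lincomb l) t = quad_form (\<lambda>x y. ip E x y t) l"
proof -
  have "ip E (lincomb l) (lincomb l) t = (\<Sum>(c, x)\<leftarrow>l. cnj c * ip E x (lincomb l) t)"
    using assms by (intro ip_lincomb_left lincomb_closed)
  also have "\<dots> = (\<Sum>(c, x)\<leftarrow>l. cnj c * (\<Sum>(d, y)\<leftarrow>l. d * ip E x y t))"
    using assms by (intro sum_list_cong) (auto simp: ip_lincomb_right[OF _ assms] dest: in_listsD)
  also have "\<dots> = quad_form (\<lambda>x y. ip E x y t) l"
    by (simp add: quad_form_def split_def sum_list_const_mult[symmetric] mult.assoc)
  finally show ?thesis .
qed

lemma psd_kernel_ip: "psd_kernel (carrier E) (\<lambda>x y. ip E x y t)"
  unfolding psd_kernel_def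
proof (intro conjI ballI)
  show "ip E y x t = cnj (ip E x y t)" if "x \<in> carrier E" "y \<in> carrier E" for x y
    using inner.p_commute[OF that(2,1)] .
  show "quad_form (\<lambda>x y. ip E x y t) l \<in> \<real>\<^sub>\<ge>\<^sub>0" if "l \<in> lists (UNIV \<times> carrier E)" for l
    unfolding ip_lincomb[OF that, symmetric] by (rule ip_nonneg[OF lincomb_closed[OF that]])
qed

end

text \<open>
  This provides the kernels of maps and the ideals of \<open>C\<^sub>0(X)\<close> as objects of the category.
\<close>

lemma hilbert_submodule:
  fixes E :: "('x, 'e) hmod" (structure)
  assumes "hilbert_module X E" and A: "A \<subseteq> carrier E" "\<zero> \<in> A"
    "\<And>x y. x \<in> A \<Longrightarrow> y \<in> A \<Longrightarrow> x \<oplus> y \<in> A"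
    "\<And>c x. x \<in> A \<Longrightarrow> c \<odot> x \<in> A"
    "\<And>f x. f \<in> C0 X \<Longrightarrow> x \<in> A \<Longrightarrow> act E f x \<in> A"
    and limit: "\<And>u x. (\<And>n. u n \<in> A) \<Longrightarrow> x \<in> carrier E \<Longrightarrow>
      (\<lambda>n. hnorm X E (u n \<ominus> x)) \<longlonglongrightarrow> 0 \<Longrightarrow> x \<in> A"
  shows "hilbert_module X (E\<lparr>carrier := A\<rparr>)"
proof -
  interpret hilbert_module X E by fact
  let ?A = "E\<lparr>carrier := A\<rparr>"
  have in_E: "x \<in> carrier E" if "x \<in> A" for x using A that by blast
  have module: "module complex_ring ?A"
  proof (rule complex_moduleI)
    show "x \<oplus>\<^bsub>?A\<^esub> y = y \<oplus>\<^bsub>?A\<^esub> x" if "x \<in> carrier ?A" "y \<in> carrier ?A" for x y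
      using that in_E M.a_comm[of x y] by simp
    show "(-1) \<odot>\<^bsub>?A\<^esub> x \<oplus>\<^bsub>?A\<^esub> x = \<zero>\<^bsub>?A\<^esub>" if "x \<in> carrier ?A" for x
      using that in_E M.l_neg[of x] neg_eq_scale[of x] by simp
  qed (use A in_E in \<open>simp_all add: scale_axioms M.a_assoc\<close>)
  have minus: "x \<ominus>\<^bsub>?A\<^esub> y = x \<ominus> y" if "y \<in> A" for x y
    using complex_module_minus[OF module, of y x] minus_eq_scale[of y x] in_E that by simp
  have hnorm: "hnorm X ?A = hnorm X E"
    by (simp add: hnorm_def fun_eq_iff)
  show ?thesis
  proof (intro hilbert_module.intro module hilbert_module_axioms.intro)
    fix u :: "nat \<Rightarrow> 'e" assume u: "\<And>n. u n \<in> carrier ?A"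
      and cauchy: "\<forall>\<epsilon>>0. \<exists>N. \<forall>m\<ge>N. \<forall>n\<ge>N. hnorm X ?A (u m \<ominus>\<^bsub>?A\<^esub> u n) < \<epsilon>"
    have u': "u n \<in> A" for n using u[of n] by simp
    have "\<forall>\<epsilon>>0. \<exists>N. \<forall>m\<ge>N. \<forall>n\<ge>N. hnorm X E (u m \<ominus> u n) < \<epsilon>"
      using cauchy u' by (simp add: minus hnorm)
    then obtain x where x: "x \<in> carrier E" "(\<lambda>n. hnorm X E (u n \<ominus> x)) \<longlonglongrightarrow> 0"
      using norm_complete[of u] u' in_E by blast
    then have "x \<in> A" using limit u' by blast
    with x(2) show "\<exists>x\<in>carrier ?A. (\<lambda>n. hnorm X ?A (u n \<ominus>\<^bsub>?A\<^esub> x)) \<longlonglongrightarrow> 0"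
      by (intro bexI[of _ x]) (simp_all add: minus hnorm)
  next
    show "ip ?A x y = (\<lambda>t. cnj (ip ?A y x t))" if "x \<in> carrier ?A" "y \<in> carrier ?A" for x y
    proof -
      have "x \<in> carrier E" "y \<in> carrier E" using that in_E by simp_all
      note ip_commute[OF this]
      moreover have "ip ?A = ip E" by simp
      ultimately show ?thesis by (simp only:)
    qed
  qed (use A in_E in \<open>simp_all add: act_add_right act_add_left act_mult act_scale_left act_scale_right
      ip_closed ip_add_right ip_scale_right ip_act_right ip_nonneg ip_definite\<close>)
qed

lemma unit_module_simps [simp]:
  "carrier (unit_module X) = Fun ` C0 X" "\<zero>\<^bsub>unit_module X\<^esub> = Fun (\<lambda>t. 0)"
  "a \<oplus>\<^bsub>unit_module X\<^esub> b = Fun (\<lambda>t. fun_of a t + fun_of b t)"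
  "c \<odot>\<^bsub>unit_module X\<^esub> a = Fun (\<lambda>t. c * fun_of a t)"
  "act (unit_module X) f a = Fun (\<lambda>t. f t * fun_of a t)"
  "ip (unit_module X) a b t = cnj (fun_of a t) * fun_of b t"
  by (simp_all add: unit_module_def)

lemma hnorm_unit_module:
  assumes "fun_of a \<in> C0 X"
  shows "hnorm X (unit_module X) a = sup_norm X (fun_of a)"
proof -
  let ?f = "fun_of a" and ?g = "\<lambda>t. cnj (fun_of a t) * fun_of a t"
  have g: "?g \<in> C0 X"
    using assms by (intro C0_mult C0_cnj)
  have "ip (unit_module X) a a = ?g" by (simp add: fun_eq_iff)
  then have "hnorm X (unit_module X) a = sqrt (sup_norm X ?g)"
    by (simp add: hnorm_def)
  also have "\<dots> = sup_norm X ?f"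
  proof (rule antisym)
    have "(cmod (?f t))\<^sup>2 \<le> (sup_norm X ?f)\<^sup>2" for t
      by (intro power_mono sup_norm_upper assms) simp
    then show "sqrt (sup_norm X ?g) \<le> sup_norm X ?f"
      using sup_norm_nonneg[OF assms]
      by (intro real_le_lsqrt sup_norm_least) (simp_all add: norm_mult power2_eq_square)
    have "cmod (?f t) \<le> sqrt (sup_norm X ?g)" for t
      using sup_norm_upper[OF g, of t]
      by (intro real_le_rsqrt) (simp add: norm_mult power2_eq_square)
    then show "sup_norm X ?f \<le> sqrt (sup_norm X ?g)"
      using sup_norm_nonneg[OF g] by (intro sup_norm_least) simp_all
  qed
  finally show ?thesis .
qed

lemma C0_complete:
  assumes f: "\<And>n. f n \<in> C0 X"
    and cauchy: "\<And>\<epsilon>. \<epsilon> > 0 \<Longrightarrow> \<exists>N. \<forall>m\<ge>N. \<forall>n\<ge>N. sup_norm X (\<lambda>t. f m t - f n t) < \<epsilon>"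
  shows "\<exists>g \<in> C0 X. (\<lambda>n. sup_norm X (\<lambda>t. f n t - g t)) \<longlonglongrightarrow> 0"
proof -
  have "\<exists>N. \<forall>m\<ge>N. \<forall>n\<ge>N. \<forall>t. cmod (f m t - f n t) < \<epsilon>" if "\<epsilon> > 0" for \<epsilon>
    using cauchy[OF that] sup_norm_upper[OF C0_diff[OF f f]] by (meson order_le_less_trans)
  note limit = C0_uniform_limit_of_sequence[OF f this]
  let ?g = "\<lambda>t. lim (\<lambda>n. f n t)"
  have g: "?g \<in> C0 X"
    by (rule limit(3))
  have "(\<lambda>n. sup_norm X (\<lambda>t. f n t - ?g t)) \<longlonglongrightarrow> 0"
  proof (rule LIMSEQ_I)
    fix \<epsilon> :: real assume "\<epsilon> > 0"
    then obtain N where N: "\<forall>n\<ge>N. \<forall>t. cmod (?g t - f n t) < \<epsilon> / 2"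
      using limit(2)[of "\<epsilon> / 2"] by auto
    have "norm (sup_norm X (\<lambda>t. f n t - ?g t) - 0) < \<epsilon>" if "N \<le> n" for n
    proof -
      have "sup_norm X (\<lambda>t. f n t - ?g t) \<le> \<epsilon> / 2"
        using N that \<open>\<epsilon> > 0\<close> by (intro sup_norm_least) (simp_all add: norm_minus_commute less_imp_le)
      then show ?thesis
        using sup_norm_nonneg[OF C0_diff[OF f g], of n] \<open>\<epsilon> > 0\<close> by simp
    qed
    then show "\<exists>no. \<forall>n\<ge>no. norm (sup_norm X (\<lambda>t. f n t - ?g t) - 0) < \<epsilon>"
      by blast
  qed
  then show ?thesis
    using g by (intro bexI[of _ ?g])
qed

lemma hilbert_module_unit: "hilbert_module X (unit_module X :: ('x, 'v) hmodule)"
proof -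
  let ?I = "unit_module X :: ('x, 'v) hmodule"
  have module: "module complex_ring ?I"
    by (rule complex_moduleI)
      (auto simp: algebra_simps intro!: imageI C0_add C0_cmult)
  have minus: "fun_of (a \<ominus>\<^bsub>?I\<^esub> b) = (\<lambda>t. fun_of a t - fun_of b t)" if "b \<in> carrier ?I" for a b
    using complex_module_minus[OF module that, of a] by simp
  show ?thesis
  proof (intro hilbert_module.intro module hilbert_module_axioms.intro)
    fix u :: "nat \<Rightarrow> ('x, 'v) elt" assume u: "\<And>n. u n \<in> carrier ?I"
      and cauchy: "\<forall>\<epsilon>>0. \<exists>N. \<forall>m\<ge>N. \<forall>n\<ge>N. hnorm X ?I (u m \<ominus>\<^bsub>?I\<^esub> u n) < \<epsilon>"
    have f: "fun_of (u n) \<in> C0 X" for n using u[of n] by auto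
    have norm: "hnorm X ?I (u n \<ominus>\<^bsub>?I\<^esub> b) = sup_norm X (\<lambda>t. fun_of (u n) t - fun_of b t)"
      if "b \<in> carrier ?I" for n b
      using that f minus[OF that] by (subst hnorm_unit_module) (auto intro: C0_diff)
    have "\<exists>g \<in> C0 X. (\<lambda>n. sup_norm X (\<lambda>t. fun_of (u n) t - g t)) \<longlonglongrightarrow> 0"
      using cauchy by (intro C0_complete f) (simp add: norm[OF u])
    then obtain g where "g \<in> C0 X" "(\<lambda>n. sup_norm X (\<lambda>t. fun_of (u n) t - g t)) \<longlonglongrightarrow> 0"
      by blast
    then show "\<exists>x\<in>carrier ?I. (\<lambda>n. hnorm X ?I (u n \<ominus>\<^bsub>?I\<^esub> x)) \<longlonglongrightarrow> 0"
      by (intro bexI[of _ "Fun g"]) (simp_all add: norm)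
  next
    fix x assume "x \<in> carrier ?I" "ip ?I x x = (\<lambda>t. 0)"
    then show "x = \<zero>\<^bsub>?I\<^esub>"
      by (auto simp: unit_module_def fun_eq_iff)
  next
    show "ip ?I x y \<in> C0 X" if "x \<in> carrier ?I" "y \<in> carrier ?I" for x y
      using that by (auto simp: unit_module_def intro!: C0_mult C0_cnj)
  next
    show "ip ?I x x t \<in> \<real>\<^sub>\<ge>\<^sub>0" for x t
      unfolding unit_module_simps cnj_mult_eq_cmod_power2 by simp
  qed (auto simp: fun_eq_iff algebra_simps intro!: imageI C0_mult)
qed

section \<open>Bounded module maps\<close>

locale hilbert_map = dom: hilbert_module X E + cod: hilbert_module X F
  for X :: "'x topology" and E :: "('x, 'e) hmod" and F :: "('x, 'f) hmod" +
  fixes h :: "'e \<Rightarrow> 'f"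
  assumes bounded_map: "bounded_module_map X E F h"
begin

lemma map_closed: "x \<in> carrier E \<Longrightarrow> h x \<in> carrier F"
  using bounded_map by (auto simp: bounded_module_map_def)

lemma map_add: "x \<in> carrier E \<Longrightarrow> y \<in> carrier E \<Longrightarrow> h (x \<oplus>\<^bsub>E\<^esub> y) = h x \<oplus>\<^bsub>F\<^esub> h y"
  using bounded_map by (simp add: bounded_module_map_def)

lemma map_scale: "x \<in> carrier E \<Longrightarrow> h (c \<odot>\<^bsub>E\<^esub> x) = c \<odot>\<^bsub>F\<^esub> h x"
  using bounded_map by (simp add: bounded_module_map_def)

lemma map_act: "f \<in> C0 X \<Longrightarrow> x \<in> carrier E \<Longrightarrow> h (act E f x) = act F f (h x)"
  using bounded_map by (simp add: bounded_module_map_def)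

lemma map_zero: "h \<zero>\<^bsub>E\<^esub> = \<zero>\<^bsub>F\<^esub>"
  using map_scale[of "\<zero>\<^bsub>E\<^esub>" 0] dom.scale_zero[of "\<zero>\<^bsub>E\<^esub>"] cod.scale_zero[of "h \<zero>\<^bsub>E\<^esub>"]
    map_closed[of "\<zero>\<^bsub>E\<^esub>"] by simp

lemma map_neg: "x \<in> carrier E \<Longrightarrow> h (\<ominus>\<^bsub>E\<^esub> x) = \<ominus>\<^bsub>F\<^esub> h x"
  by (simp add: dom.neg_eq_scale cod.neg_eq_scale map_scale map_closed)

lemma map_minus:
  assumes "x \<in> carrier E" "y \<in> carrier E"
  shows "h (x \<ominus>\<^bsub>E\<^esub> y) = h x \<ominus>\<^bsub>F\<^esub> h y"
  using assms by (simp add: a_minus_def map_add map_neg)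

lemma map_bounded:
  obtains B where "B \<ge> 0" "\<And>x. x \<in> carrier E \<Longrightarrow> hnorm X F (h x) \<le> B * hnorm X E x"
proof -
  obtain B where B: "\<And>x. x \<in> carrier E \<Longrightarrow> hnorm X F (h x) \<le> B * hnorm X E x"
    using bounded_map unfolding bounded_module_map_def by blast
  have "hnorm X F (h x) \<le> max B 0 * hnorm X E x" if "x \<in> carrier E" for x
    using B[OF that] dom.inner.nrm_nonneg[OF that]
    by (simp add: dom.hnorm_eq[symmetric]) (meson max.cobounded1 mult_right_mono order_trans)
  then show ?thesis using that[of "max B 0"] by simp
qed

lemma map_lincomb:
  "l \<in> lists (UNIV \<times> carrier E) \<Longrightarrow> h (dom.lincomb l) = cod.lincomb (map (apsnd h) l)"
  by (induction l rule: dom.lincomb.induct)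
    (auto simp: map_zero map_add map_scale dom.lincomb_closed dom.scale_axioms)

lemma inj_iff: "inj_on h (carrier E) \<longleftrightarrow> (\<forall>x\<in>carrier E. h x = \<zero>\<^bsub>F\<^esub> \<longrightarrow> x = \<zero>\<^bsub>E\<^esub>)"
proof
  assume "inj_on h (carrier E)"
  then show "\<forall>x\<in>carrier E. h x = \<zero>\<^bsub>F\<^esub> \<longrightarrow> x = \<zero>\<^bsub>E\<^esub>"
    using map_zero by (metis dom.M.zero_closed inj_onD)
next
  assume ker: "\<forall>x\<in>carrier E. h x = \<zero>\<^bsub>F\<^esub> \<longrightarrow> x = \<zero>\<^bsub>E\<^esub>"
  show "inj_on h (carrier E)"
  proof (rule inj_onI)
    fix x y assume xy: "x \<in> carrier E" "y \<in> carrier E" "h x = h y"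
    then have "h (x \<ominus>\<^bsub>E\<^esub> y) = \<zero>\<^bsub>F\<^esub>"
      using cod.M.r_neg[OF map_closed[OF xy(2)]] by (simp add: map_minus a_minus_def[of F])
    then have "x \<ominus>\<^bsub>E\<^esub> y = \<zero>\<^bsub>E\<^esub>"
      using ker xy by simp
    then show "x = y"
      using xy by (metis dom.M.add.inv_closed dom.M.minus_equality dom.M.minus_minus a_minus_def)
  qed
qed

text \<open>
  A bounded module map is bounded fibrewise: multiplying \<open>x\<close> by a bump function at \<open>t\<close> does not
  change values at \<open>t\<close>, and makes the norm of \<open>x\<close> as close to its size at \<open>t\<close> as desired.
\<close>

lemma map_pointwise_bounded:
  assumes top: "locally_compact_space X" "Hausdorff_space X"
    and B: "B \<ge> 0" "\<And>x. x \<in> carrier E \<Longrightarrow> hnorm X F (h x) \<le> B * hnorm X E x"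
    and x: "x \<in> carrier E"
  shows "cmod (ip F (h x) (h x) t) \<le> B\<^sup>2 * cmod (ip E x x t)"
proof (cases "t \<in> topspace X")
  case False
  then show ?thesis
    using C0_outside[OF cod.ip_closed[OF map_closed map_closed, OF x x]] by simp
next
  case True
  let ?c = "cmod (ip E x x t)"
  have near: "cmod (ip F (h x) (h x) t) \<le> B\<^sup>2 * (?c + e)" if "e > 0" for e
  proof -
    define V where "V = {s \<in> topspace X. ip E x x s \<in> {z. cmod z < ?c + e}}"
    have "openin X V"
      unfolding V_def
      by (rule openin_continuous_map_preimage[OF C0_continuous[OF dom.ip_closed[OF x x]]])
        (auto intro!: open_Collect_less continuous_intros)
    moreover have "t \<in> V" using True \<open>e > 0\<close> by (simp add: V_def)
    ultimately obtain g where g: "(\<lambda>t. of_real (g t)) \<in> C0 X" "g t = 1"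
        "\<And>s. 0 \<le> g s" "\<And>s. g s \<le> 1" "\<And>s. s \<notin> V \<Longrightarrow> g s = 0"
      using bump_function[OF top] by blast
    define y where "y = act E (\<lambda>t. of_real (g t)) x"
    have y: "y \<in> carrier E" using g(1) x by (simp add: y_def dom.act_closed)
    have ipy: "ip E y y s = (g s)\<^sup>2 * ip E x x s" for s
      using g(1) x by (simp add: y_def dom.ip_act_left dom.ip_act_right dom.act_closed power2_eq_square)
    have "cmod (ip E y y s) \<le> (sqrt (?c + e))\<^sup>2" for s
    proof (cases "s \<in> V")
      case True
      have "cmod (ip E y y s) = (g s)\<^sup>2 * cmod (ip E x x s)"
        unfolding ipy by (simp add: norm_mult norm_power)
      also have "\<dots> \<le> 1 * cmod (ip E x x s)"
        using g(3,4) by (intro mult_right_mono power_le_one) auto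
      also have "\<dots> \<le> ?c + e"
        using True by (simp add: V_def)
      finally show ?thesis using \<open>e > 0\<close> by simp
    next
      case False
      then show ?thesis using g(5) \<open>e > 0\<close> by (simp add: ipy)
    qed
    then have "dom.inner.nrm y \<le> sqrt (?c + e)"
      using \<open>e > 0\<close> by (intro dom.inner.nrm_least) auto
    then have "cod.inner.nrm (h y) \<le> B * sqrt (?c + e)"
      using B(2)[OF y] B(1) unfolding dom.hnorm_eq cod.hnorm_eq
      by (meson mult_left_mono order_trans)
    then have "(cod.inner.nrm (h y))\<^sup>2 \<le> (B * sqrt (?c + e))\<^sup>2"
      by (intro power_mono cod.inner.nrm_nonneg map_closed y)
    also have "\<dots> = B\<^sup>2 * (?c + e)"
      using \<open>e > 0\<close> by (simp add: power_mult_distrib)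
    finally have "cmod (ip F (h y) (h y) t) \<le> B\<^sup>2 * (?c + e)"
      using cod.inner.nrm_upper[OF map_closed[OF y], of t] by simp
    moreover have "ip F (h y) (h y) t = ip F (h x) (h x) t"
      using g(1,2) x
      by (simp add: y_def map_act cod.ip_act_left cod.ip_act_right cod.act_closed map_closed)
    ultimately show ?thesis by simp
  qed
  show ?thesis
  proof (rule field_le_epsilon)
    fix e :: real assume "e > 0"
    then have "B\<^sup>2 * (e / (B\<^sup>2 + 1)) \<le> e"
      by (simp add: divide_le_eq algebra_simps add_pos_nonneg)
    moreover have "e / (B\<^sup>2 + 1) > 0"
      using \<open>e > 0\<close> by (simp add: add_nonneg_pos)
    note near[OF this]
    ultimately show "cmod (ip F (h x) (h x) t) \<le> B\<^sup>2 * ?c + e"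
      unfolding distrib_left by linarith
  qed
qed

text \<open>
  Boundedness of a map at a point \<open>t\<close>, applied to all linear combinations, is positivity of a kernel.
\<close>

lemma psd_kernel_bound:
  assumes "\<And>x. x \<in> carrier E \<Longrightarrow> cmod (ip F (h x) (h x) t) \<le> C * cmod (ip E x x t)"
  shows "psd_kernel (carrier E) (\<lambda>x y. of_real C * ip E x y t - ip F (h x) (h y) t)"
  unfolding psd_kernel_def
proof (intro conjI ballI)
  fix x y assume "x \<in> carrier E" "y \<in> carrier E"
  then show "of_real C * ip E y x t - ip F (h y) (h x) t
      = cnj (of_real C * ip E x y t - ip F (h x) (h y) t)"
    using dom.inner.p_commute[of y x t] cod.inner.p_commute[of "h y" "h x" t]
    by (simp add: map_closed)
next
  fix l :: "(complex \<times> 'e) list" assume l: "l \<in> lists (UNIV \<times> carrier E)"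
  let ?x = "dom.lincomb l"
  have x: "?x \<in> carrier E" using l by (rule dom.lincomb_closed)
  have "quad_form (\<lambda>x y. of_real C * ip E x y t - ip F (h x) (h y) t) l
      = of_real C * quad_form (\<lambda>x y. ip E x y t) l
        - quad_form (\<lambda>x y. ip F x y t) (map (apsnd h) l)"
    by (simp add: quad_form_def split_def o_def right_diff_distrib sum_list_subtractf
        sum_list_const_mult[symmetric] mult_ac)
  also have "\<dots> = of_real C * ip E ?x ?x t - ip F (h ?x) (h ?x) t"
  proof -
    have "map (apsnd h) l \<in> lists (UNIV \<times> carrier F)"
      using l map_closed by (auto simp: in_lists_conv_set)
    then show ?thesis
      using l by (simp add: map_lincomb dom.ip_lincomb cod.ip_lincomb)
  qed
  also have "\<dots> = of_real (C * cmod (ip E ?x ?x t) - cmod (ip F (h ?x) (h ?x) t))"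
    using dom.ip_nonneg[OF x, of t] cod.ip_nonneg[OF map_closed[OF x], of t]
    by (simp add: nonneg_Reals_iff_cmod)
  also have "\<dots> \<in> \<real>\<^sub>\<ge>\<^sub>0"
    using assms[OF x] unfolding nonneg_Reals_of_real_iff by simp
  finally show "quad_form (\<lambda>x y. of_real C * ip E x y t - ip F (h x) (h y) t) l \<in> \<real>\<^sub>\<ge>\<^sub>0" .
qed

end

lemma hilbert_map_iff:
  "hilbert_map X E F h \<longleftrightarrow> hilbert_module X E \<and> hilbert_module X F \<and> bounded_module_map X E F h"
  by (auto simp: hilbert_map_def hilbert_map_axioms_def)

lemma hilbert_mapI:
  assumes "hilbert_module X E" "hilbert_module X F"
    and "\<And>x. x \<in> carrier E \<Longrightarrow> h x \<in> carrier F"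
    and "\<And>x y. x \<in> carrier E \<Longrightarrow> y \<in> carrier E \<Longrightarrow> h (x \<oplus>\<^bsub>E\<^esub> y) = h x \<oplus>\<^bsub>F\<^esub> h y"
    and "\<And>c x. x \<in> carrier E \<Longrightarrow> h (c \<odot>\<^bsub>E\<^esub> x) = c \<odot>\<^bsub>F\<^esub> h x"
    and "\<And>f x. f \<in> C0 X \<Longrightarrow> x \<in> carrier E \<Longrightarrow> h (act E f x) = act F f (h x)"
    and "\<And>x. x \<in> carrier E \<Longrightarrow> hnorm X F (h x) \<le> B * hnorm X E x"
  shows "hilbert_map X E F h"
  unfolding hilbert_map_iff bounded_module_map_def
  using assms by (intro conjI exI[of _ B] ballI allI funcsetI) simp_all

section \<open>Monomorphisms and isomorphisms of Hilbert modules\<close>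

lemma Hilb_simps [simp]:
  "obj (Hilb X) = {E. hilbert_module X E}"
  "src (Hilb X) (E, h, F) = E" "tgt (Hilb X) (E, h, F) = F"
  "ide (Hilb X) E = (E, \<lambda>x \<in> carrier E. x, E)"
  "cmp (Hilb X) (F', k, G) (E, h, F) = (E, compose (carrier E) k h, G)"
  "tensor_arr (Hilb X) (E, h, E') (F, k, F')
    = (tensor X E F, tensor_map X E F E' F' h k, tensor X E' F')"
  "unit_obj (Hilb X) = unit_module X"
  by (simp_all add: Hilb_def)

lemma Hilb_arr_iff:
  "(E, h, F) \<in> arr (Hilb X) \<longleftrightarrow> hilbert_map X E F h \<and> h \<in> extensional (carrier E)"
  by (auto simp: Hilb_def hilbert_map_iff)

lemma Hilb_hom_iff:
  "a \<in> hom_set (Hilb X) E F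
    \<longleftrightarrow> (\<exists>h. a = (E, h, F) \<and> hilbert_map X E F h \<and> h \<in> extensional (carrier E))"
  by (cases a) (auto simp: hom_set_def Hilb_arr_iff)

lemma (in hilbert_module) inclusion_map:
  assumes "hilbert_module X (E\<lparr>carrier := A\<rparr>)" "A \<subseteq> carrier E"
  shows "hilbert_map X (E\<lparr>carrier := A\<rparr>) E (\<lambda>x\<in>A. x)"
proof (rule hilbert_mapI[where B = 1])
  interpret A: hilbert_module X "E\<lparr>carrier := A\<rparr>" by fact
  show "(\<lambda>x\<in>A. x) (x \<oplus>\<^bsub>E\<lparr>carrier := A\<rparr>\<^esub> y) = (\<lambda>x\<in>A. x) x \<oplus> (\<lambda>x\<in>A. x) y"
    if "x \<in> carrier (E\<lparr>carrier := A\<rparr>)" "y \<in> carrier (E\<lparr>carrier := A\<rparr>)" for x y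
    using A.M.a_closed[OF that] that by simp
  show "(\<lambda>x\<in>A. x) (c \<odot>\<^bsub>E\<lparr>carrier := A\<rparr>\<^esub> x) = c \<odot> (\<lambda>x\<in>A. x) x"
    if "x \<in> carrier (E\<lparr>carrier := A\<rparr>)" for c x
    using A.scale_axioms(1)[OF that] that by simp
  show "(\<lambda>x\<in>A. x) (act (E\<lparr>carrier := A\<rparr>) f x) = act E f ((\<lambda>x\<in>A. x) x)"
    if "f \<in> C0 X" "x \<in> carrier (E\<lparr>carrier := A\<rparr>)" for f x
    using A.act_closed[OF that] that by simp
qed (use assms hilbert_module_axioms in \<open>auto simp: hnorm_def\<close>)

lemma zero_hilbert_map:
  assumes "hilbert_module X E" "hilbert_module X F"
  shows "hilbert_map X E F (\<lambda>x\<in>carrier E. \<zero>\<^bsub>F\<^esub>)"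
proof -
  interpret E: hilbert_module X E by fact
  interpret F: hilbert_module X F by fact
  have "hnorm X F \<zero>\<^bsub>F\<^esub> = 0"
    unfolding hnorm_def by (simp add: F.ip_zero(1)[OF F.M.zero_closed, abs_def])
  moreover have "0 \<le> hnorm X E x" if "x \<in> carrier E" for x
    using E.inner.nrm_nonneg[OF that] by (simp add: E.hnorm_eq)
  moreover have "c \<odot>\<^bsub>F\<^esub> \<zero>\<^bsub>F\<^esub> = \<zero>\<^bsub>F\<^esub>" for c
    using F.smult_r_null[of c] by simp
  ultimately show ?thesis
    using assms by (intro hilbert_mapI[where B = 1]) (simp_all add: F.zero_act E.act_closed E.scale_axioms)
qed

lemma (in hilbert_map) kernel_hilbert_module:
  "hilbert_module X (E\<lparr>carrier := {x \<in> carrier E. h x = \<zero>\<^bsub>F\<^esub>}\<rparr>)"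
proof (rule hilbert_submodule)
  show "c \<odot>\<^bsub>E\<^esub> x \<in> {x \<in> carrier E. h x = \<zero>\<^bsub>F\<^esub>}" if "x \<in> {x \<in> carrier E. h x = \<zero>\<^bsub>F\<^esub>}" for c x
    using that cod.smult_r_null[of c] by (simp add: map_scale dom.scale_axioms)
  fix u :: "nat \<Rightarrow> 'e" and x
  assume u: "\<And>n. u n \<in> {x \<in> carrier E. h x = \<zero>\<^bsub>F\<^esub>}" and x: "x \<in> carrier E"
    and lim: "(\<lambda>n. hnorm X E (u n \<ominus>\<^bsub>E\<^esub> x)) \<longlonglongrightarrow> 0"
  obtain B where B: "B \<ge> 0" "\<And>x. x \<in> carrier E \<Longrightarrow> hnorm X F (h x) \<le> B * hnorm X E x"
    using map_bounded by blast
  have "cod.inner.dst \<zero>\<^bsub>F\<^esub> (h x) \<le> B * hnorm X E (u n \<ominus>\<^bsub>E\<^esub> x)" for n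
    using B(2)[of "u n \<ominus>\<^bsub>E\<^esub> x"] u[of n] x map_minus[of "u n" x]
    by (simp add: cod.hnorm_minus map_closed)
  moreover have "(\<lambda>n. B * hnorm X E (u n \<ominus>\<^bsub>E\<^esub> x)) \<longlonglongrightarrow> 0"
    using lim by (rule tendsto_mult_right_zero)
  ultimately have "cod.inner.dst \<zero>\<^bsub>F\<^esub> (h x) \<le> 0"
    by (intro tendsto_lowerbound[of _ 0 sequentially]) auto
  then have "\<zero>\<^bsub>F\<^esub> = h x"
    using cod.dst_zeroD[of "\<zero>\<^bsub>F\<^esub>" "h x"] cod.inner.dst_nonneg[of "\<zero>\<^bsub>F\<^esub>" "h x"] map_closed[OF x] by simp
  then show "x \<in> {x \<in> carrier E. h x = \<zero>\<^bsub>F\<^esub>}"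
    using x by simp
qed (auto simp: map_zero map_add map_act dom.act_closed cod.zero_act dom.hilbert_module_axioms)

lemma Hilb_monic_iff:
  assumes "(E, h, F) \<in> arr (Hilb X :: (('x, 'v) hmodule, ('x, 'v) harrow) tensor_cat)"
  shows "monic (Hilb X) (E, h, F) \<longleftrightarrow> inj_on h (carrier E)"
proof -
  interpret hilbert_map X E F h
    using assms by (simp add: Hilb_arr_iff)
  show ?thesis
  proof
    assume inj: "inj_on h (carrier E)"
    show "monic (Hilb X) (E, h, F)"
      unfolding monic_def
    proof (intro conjI ballI impI)
      fix A a b
      assume "a \<in> hom_set (Hilb X) A (src (Hilb X) (E, h, F))"
        and "b \<in> hom_set (Hilb X) A (src (Hilb X) (E, h, F))"
        and eq: "cmp (Hilb X) (E, h, F) a = cmp (Hilb X) (E, h, F) b"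
      then obtain f g where a: "a = (A, f, E)" "hilbert_map X A E f" "f \<in> extensional (carrier A)"
        and b: "b = (A, g, E)" "hilbert_map X A E g" "g \<in> extensional (carrier A)"
        by (auto simp: Hilb_hom_iff)
      have "f x = g x" if x: "x \<in> carrier A" for x
      proof (rule inj_onD[OF inj])
        show "h (f x) = h (g x)"
          using eq x by (simp add: a(1) b(1) compose_def fun_eq_iff) (metis restrict_apply)
        show "f x \<in> carrier E" "g x \<in> carrier E"
          using hilbert_map.map_closed[OF a(2) x] hilbert_map.map_closed[OF b(2) x] .
      qed
      then have "f = g"
        using a(3) b(3) extensionalityI by blast
      then show "a = b"
        by (simp add: a(1) b(1))
    qed (rule assms)
  next
    assume monic: "monic (Hilb X) (E, h, F)"
    \<comment> \<open>The inclusion of the kernel and the zero map have the same composite with \<open>h\<close>.\<close>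
    define N where "N = {x \<in> carrier E. h x = \<zero>\<^bsub>F\<^esub>}"
    let ?K = "E\<lparr>carrier := N\<rparr>"
    have K: "hilbert_module X ?K"
      unfolding N_def by (rule kernel_hilbert_module)
    have i: "(?K, \<lambda>x\<in>N. x, E) \<in> hom_set (Hilb X) ?K E"
      using dom.inclusion_map[OF K] by (auto simp: Hilb_hom_iff N_def)
    have z: "(?K, \<lambda>x\<in>N. \<zero>\<^bsub>E\<^esub>, E) \<in> hom_set (Hilb X) ?K E"
      using zero_hilbert_map[OF K dom.hilbert_module_axioms] by (auto simp: Hilb_hom_iff)
    have eq: "cmp (Hilb X) (E, h, F) (?K, \<lambda>x\<in>N. x, E) = cmp (Hilb X) (E, h, F) (?K, \<lambda>x\<in>N. \<zero>\<^bsub>E\<^esub>, E)"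
      by (auto simp: compose_def fun_eq_iff map_zero N_def)
    have "(?K, \<lambda>x\<in>N. x, E) = (?K, \<lambda>x\<in>N. \<zero>\<^bsub>E\<^esub>, E)"
      by (rule conjunct2[OF monic[unfolded monic_def], rule_format, of ?K])
        (use K i z eq in \<open>simp_all only: Hilb_simps mem_Collect_eq\<close>)
    then have "x = \<zero>\<^bsub>E\<^esub>" if "x \<in> N" for x
    proof -
      have "(\<lambda>x\<in>N. x) x = (\<lambda>x\<in>N. \<zero>\<^bsub>E\<^esub>) x"
        using \<open>(?K, \<lambda>x\<in>N. x, E) = (?K, \<lambda>x\<in>N. \<zero>\<^bsub>E\<^esub>, E)\<close> by (simp only: prod.inject)
      with that show ?thesis by simp
    qed
    then show "inj_on h (carrier E)"
      unfolding inj_iff by (simp add: N_def)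
  qed
qed

text \<open>
  The codomain is cut down to the image, so that inverses of embeddings are covered as well.
\<close>

lemma (in hilbert_map) inverse_hilbert_map:
  assumes bij: "bij_betw h (carrier E) A" and A: "hilbert_module X (F\<lparr>carrier := A\<rparr>)"
    and below: "\<And>x. x \<in> carrier E \<Longrightarrow> hnorm X E x \<le> C * hnorm X F (h x)"
  shows "hilbert_map X (F\<lparr>carrier := A\<rparr>) E (\<lambda>y\<in>A. inv_into (carrier E) h y)"
proof (rule hilbert_mapI[where B = C])
  let ?g = "\<lambda>y\<in>A. inv_into (carrier E) h y"
  interpret A: hilbert_module X "F\<lparr>carrier := A\<rparr>" by (rule A)
  have inj: "inj_on h (carrier E)" and img: "h ` carrier E = A"
    using bij by (auto simp: bij_betw_def)
  have g: "?g y \<in> carrier E" "h (?g y) = y" if "y \<in> A" for y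
    using that img by (auto simp: inv_into_into f_inv_into_f)
  have g_eq: "?g y = x" if "x \<in> carrier E" "h x = y" "y \<in> A" for x y
    using that inj by (auto simp: inv_into_f_f)
  show "?g x \<in> carrier E" if "x \<in> carrier (F\<lparr>carrier := A\<rparr>)" for x
    using that g by simp
  show "?g (x \<oplus>\<^bsub>F\<lparr>carrier := A\<rparr>\<^esub> y) = ?g x \<oplus>\<^bsub>E\<^esub> ?g y"
    if "x \<in> carrier (F\<lparr>carrier := A\<rparr>)" "y \<in> carrier (F\<lparr>carrier := A\<rparr>)" for x y
    using A.M.a_closed[OF that] that g by (intro g_eq) (simp_all add: map_add)
  show "?g (c \<odot>\<^bsub>F\<lparr>carrier := A\<rparr>\<^esub> x) = c \<odot>\<^bsub>E\<^esub> ?g x"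
    if "x \<in> carrier (F\<lparr>carrier := A\<rparr>)" for c x
    using A.scale_axioms(1)[OF that] that g by (intro g_eq) (simp_all add: map_scale dom.scale_axioms)
  show "?g (act (F\<lparr>carrier := A\<rparr>) f x) = act E f (?g x)"
    if "f \<in> C0 X" "x \<in> carrier (F\<lparr>carrier := A\<rparr>)" for f x
    using A.act_closed[OF that] that g by (intro g_eq) (simp_all add: map_act dom.act_closed)
  show "hnorm X E (?g x) \<le> C * hnorm X (F\<lparr>carrier := A\<rparr>) x"
    if "x \<in> carrier (F\<lparr>carrier := A\<rparr>)" for x
    using below[of "?g x"] g[of x] that by (simp add: hnorm_def)
qed (use A dom.hilbert_module_axioms in auto)

lemma Hilb_isoI:
  assumes arr: "(E, h, F) \<in> arr (Hilb X :: (('x, 'v) hmodule, ('x, 'v) harrow) tensor_cat)"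
    and bij: "bij_betw h (carrier E) (carrier F)"
    and below: "\<And>x. x \<in> carrier E \<Longrightarrow> hnorm X E x \<le> C * hnorm X F (h x)"
  shows "is_iso (Hilb X) (E, h, F)"
proof -
  interpret hilbert_map X E F h
    using arr by (simp add: Hilb_arr_iff)
  define g where "g = (\<lambda>y\<in>carrier F. inv_into (carrier E) h y)"
  have "hilbert_map X F E g"
    using inverse_hilbert_map[OF bij _ below] cod.hilbert_module_axioms by (simp add: g_def)
  then have "(F, g, E) \<in> hom_set (Hilb X) F E"
    by (simp add: Hilb_hom_iff g_def)
  moreover have "compose (carrier E) g h = (\<lambda>x\<in>carrier E. x)"
    using bij by (auto simp: compose_def g_def fun_eq_iff map_closed bij_betw_def)
  moreover have "compose (carrier F) h g = (\<lambda>x\<in>carrier F. x)"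
    using bij by (auto simp: compose_def g_def fun_eq_iff bij_betw_def f_inv_into_f)
  ultimately show ?thesis
    using arr unfolding is_iso_def by (intro conjI bexI[of _ "(F, g, E)"]) simp_all
qed

section \<open>The tensor product of Hilbert modules\<close>

lemma C0_sum_list: "(\<And>x. x \<in> set l \<Longrightarrow> f x \<in> C0 X) \<Longrightarrow> (\<lambda>t. \<Sum>x\<leftarrow>l. f x t) \<in> C0 X"
  by (induction l) (simp_all add: C0_add)

lemma sum_list_swap:
  fixes f :: "'a \<Rightarrow> 'b \<Rightarrow> 'c::comm_monoid_add"
  shows "(\<Sum>x\<leftarrow>u. \<Sum>y\<leftarrow>v. f x y) = (\<Sum>y\<leftarrow>v. \<Sum>x\<leftarrow>u. f x y)"
  by (induction u) (simp_all add: sum_list_addf)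

definition fs_scale :: "('x, 'e) hmod \<Rightarrow> complex \<Rightarrow> ('e \<times> 'f) list \<Rightarrow> ('e \<times> 'f) list" where
  "fs_scale E c = map (\<lambda>(x, y). (c \<odot>\<^bsub>E\<^esub> x, y))"

definition fs_act :: "('x, 'e) hmod \<Rightarrow> ('x \<Rightarrow> complex) \<Rightarrow> ('e \<times> 'f) list \<Rightarrow> ('e \<times> 'f) list" where
  "fs_act E f = map (\<lambda>(x, y). (act E f x, y))"

lemma formal_sums_mem:
  "u \<in> formal_sums E F \<Longrightarrow> q \<in> set u \<Longrightarrow> fst q \<in> carrier E"
  "u \<in> formal_sums E F \<Longrightarrow> q \<in> set u \<Longrightarrow> snd q \<in> carrier F"
  by (auto simp: formal_sums_def)

lemma fs_ip_map_right:
  assumes "u \<in> formal_sums E F" "v \<in> formal_sums E F"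
    and "\<And>x x' y y'. x \<in> carrier E \<Longrightarrow> y \<in> carrier F \<Longrightarrow> x' \<in> carrier E \<Longrightarrow> y' \<in> carrier F \<Longrightarrow>
      ip E x (g x') t * ip F y y' t = a * (ip E x x' t * ip F y y' t)"
  shows "fs_ip E F u (map (\<lambda>(x, y). (g x, y)) v) t = a * fs_ip E F u v t"
proof -
  have "fs_ip E F u (map (\<lambda>(x, y). (g x, y)) v) t
      = (\<Sum>(x, y)\<leftarrow>u. \<Sum>(x', y')\<leftarrow>v. a * (ip E x x' t * ip F y y' t))"
    unfolding fs_ip_def map_map o_def split_def fst_conv snd_conv
    by (intro sum_list_cong assms(3) formal_sums_mem[OF assms(1)] formal_sums_mem[OF assms(2)])
  also have "\<dots> = a * fs_ip E F u v t"
    by (simp add: fs_ip_def split_def sum_list_const_mult)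
  finally show ?thesis .
qed

locale hilbert_pair = E: hilbert_module X E + F: hilbert_module X F
  for X :: "'x topology" and E :: "('x, 'e) hmod" and F :: "('x, 'f) hmod"
begin

lemma append_formal_sums:
  "u \<in> formal_sums E F \<Longrightarrow> v \<in> formal_sums E F \<Longrightarrow> u @ v \<in> formal_sums E F"
  by (simp add: formal_sums_def)

lemma fs_scale_closed: "u \<in> formal_sums E F \<Longrightarrow> fs_scale E c u \<in> formal_sums E F"
  by (induction u) (auto simp: formal_sums_def fs_scale_def E.scale_axioms)

lemma fs_act_closed: "f \<in> C0 X \<Longrightarrow> u \<in> formal_sums E F \<Longrightarrow> fs_act E f u \<in> formal_sums E F"
  by (induction u) (auto simp: formal_sums_def fs_act_def E.act_closed)

lemma fs_ip_scale_right:
  "u \<in> formal_sums E F \<Longrightarrow> v \<in> formal_sums E F \<Longrightarrow>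
    fs_ip E F u (fs_scale E c v) t = c * fs_ip E F u v t"
  unfolding fs_scale_def by (rule fs_ip_map_right) (simp_all add: E.inner.p_scale_right)

lemma fs_ip_act_right:
  "f \<in> C0 X \<Longrightarrow> u \<in> formal_sums E F \<Longrightarrow> v \<in> formal_sums E F \<Longrightarrow>
    fs_ip E F u (fs_act E f v) t = f t * fs_ip E F u v t"
  unfolding fs_act_def by (rule fs_ip_map_right) (simp_all add: E.ip_act_right)

lemma fs_ip_C0:
  assumes "u \<in> formal_sums E F" "v \<in> formal_sums E F"
  shows "fs_ip E F u v \<in> C0 X"
proof -
  have "(\<lambda>t. \<Sum>p\<leftarrow>u. \<Sum>q\<leftarrow>v. ip E (fst p) (fst q) t * ip F (snd p) (snd q) t) \<in> C0 X"
    by (intro C0_sum_list C0_mult E.ip_closed F.ip_closed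
        formal_sums_mem[OF assms(1)] formal_sums_mem[OF assms(2)])
  then show ?thesis
    by (simp add: fs_ip_def[abs_def] split_def)
qed

lemma fs_ip_commute:
  assumes "u \<in> formal_sums E F" "v \<in> formal_sums E F"
  shows "fs_ip E F u v t = cnj (fs_ip E F v u t)"
proof -
  have "cnj (fs_ip E F v u t)
      = (\<Sum>q\<leftarrow>v. \<Sum>p\<leftarrow>u. cnj (ip E (fst q) (fst p) t * ip F (snd q) (snd p) t))"
    by (simp add: fs_ip_def split_def cnj_sum_list)
  also have "\<dots> = (\<Sum>q\<leftarrow>v. \<Sum>p\<leftarrow>u. ip E (fst p) (fst q) t * ip F (snd p) (snd q) t)"
  proof (intro sum_list_cong)
    fix p q assume "p \<in> set u" "q \<in> set v"
    then have "fst p \<in> carrier E" "fst q \<in> carrier E" "snd p \<in> carrier F" "snd q \<in> carrier F"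
      using formal_sums_mem[OF assms(1)] formal_sums_mem[OF assms(2)] by blast+
    then show "cnj (ip E (fst q) (fst p) t * ip F (snd q) (snd p) t)
        = ip E (fst p) (fst q) t * ip F (snd p) (snd q) t"
      using E.inner.p_commute[of "fst p" "fst q" t] F.inner.p_commute[of "snd p" "snd q" t]
      by simp
  qed
  also have "\<dots> = fs_ip E F u v t"
    by (subst sum_list_swap) (simp add: fs_ip_def split_def)
  finally show ?thesis by simp
qed

lemma fs_ip_nonneg: "u \<in> formal_sums E F \<Longrightarrow> fs_ip E F u u t \<in> \<real>\<^sub>\<ge>\<^sub>0"
  unfolding fs_ip_def formal_sums_def
  by (rule schur_product[OF E.psd_kernel_ip F.psd_kernel_ip])

sublocale fs: semi_inner_product X "formal_sums E F" "(@)" "fs_scale E" "fs_ip E F"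
  by unfold_locales
    (simp_all add: append_formal_sums fs_scale_closed fs_ip_C0 fs_ip_append fs_ip_scale_right
      fs_ip_nonneg fs_ip_commute[symmetric])

lemma fs_dist_eq:
  assumes "v \<in> formal_sums E F"
  shows "fs_dist X E F u v = fs.dst u v"
proof -
  have "map (\<lambda>(x, y). (\<ominus>\<^bsub>E\<^esub> x, y)) v = fs_scale E (-1) v"
    unfolding fs_scale_def using formal_sums_mem[OF assms] by (force simp: E.neg_eq_scale)
  then show ?thesis
    by (simp add: fs_dist_def fs.dst_def fs.nrm_def fs.minus_def Let_def)
qed

lemma cauchy_sums_eq: "cauchy_sums X E F = fs.cauchy_seqs"
  unfolding cauchy_sums_def fs.cauchy_seqs_def by (auto simp: fs_dist_eq)

lemma nil_formal_sums: "[] \<in> formal_sums E F"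
  by (simp add: formal_sums_def)

lemma fs_ip_nil [simp]: "fs_ip E F u [] t = 0" "fs_ip E F [] u t = 0"
  by (simp_all add: fs_ip_def split_def)

lemma fs_ip_act_left:
  assumes "f \<in> C0 X" "u \<in> formal_sums E F" "v \<in> formal_sums E F"
  shows "fs_ip E F (fs_act E f u) v t = cnj (f t) * fs_ip E F u v t"
  using fs_ip_act_right[OF assms(1,3,2)] fs_ip_commute[OF _ assms(3)] assms fs_act_closed by simp

lemma fs_act_lipschitz:
  assumes "f \<in> C0 X"
  shows "lipschitz_map X (formal_sums E F) (@) (fs_scale E) (fs_ip E F)
    (formal_sums E F) (@) (fs_scale E) (fs_ip E F) (fs_act E f) (sup_norm X f)"
proof unfold_locales
  show "fs_act E f u \<in> formal_sums E F" if "u \<in> formal_sums E F" for u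
    using assms that by (rule fs_act_closed)
  fix u v assume uv: "u \<in> formal_sums E F" "v \<in> formal_sums E F"
  let ?w = "fs.minus (fs_act E f u) (fs_act E f v)"
  show "fs.dst (fs_act E f u) (fs_act E f v) \<le> sup_norm X f * fs.dst u v"
    unfolding fs.dst_def
  proof (rule fs.nrm_least)
    show "0 \<le> sup_norm X f * fs.nrm (fs.minus u v)"
      using uv by (intro mult_nonneg_nonneg sup_norm_nonneg assms fs.nrm_nonneg fs.minus_closed)
    fix t
    have "fs_ip E F ?w ?w t = (cnj (f t) * f t) * fs_ip E F (fs.minus u v) (fs.minus u v) t"
      using uv assms
      by (simp add: fs.p_simps fs_act_closed fs_ip_act_left fs_ip_act_right algebra_simps)
    then have "cmod (fs_ip E F ?w ?w t)
        = (cmod (f t))\<^sup>2 * cmod (fs_ip E F (fs.minus u v) (fs.minus u v) t)"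
      by (simp add: norm_mult power2_eq_square)
    also have "\<dots> \<le> (sup_norm X f)\<^sup>2 * (fs.nrm (fs.minus u v))\<^sup>2"
      using uv by (intro mult_mono power_mono fs.nrm_upper fs.minus_closed sup_norm_upper assms) auto
    finally show "cmod (fs_ip E F ?w ?w t) \<le> (sup_norm X f * fs.nrm (fs.minus u v))\<^sup>2"
      by (simp add: power_mult_distrib)
  qed
qed

end

locale tensor_product = hilbert_pair X E F
  for X :: "'x topology" and E :: "('x, 'v) hmodule" and F :: "('x, 'v) hmodule"
begin

abbreviation "C \<equiv> fs.cauchy_seqs"
abbreviation "limit \<equiv> lim_elt X E F"
abbreviation "T \<equiv> tensor X E F"

lemma
  assumes "\<sigma> \<in> C"
  shows seq_of_limit: "seq_of (limit \<sigma>) \<in> C"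
    and seq_of_limit_equivalent: "fs.equivalent \<sigma> (seq_of (limit \<sigma>))"
proof -
  have eq: "(\<lambda>n. fs_dist X E F (\<sigma> n) (\<tau> n)) \<longlonglongrightarrow> 0 \<longleftrightarrow> fs.equivalent \<sigma> \<tau>" if "\<tau> \<in> C" for \<tau>
    using that by (simp add: fs.equivalent_def fs_dist_eq fs.cauchy_seqs_closed)
  have "\<exists>\<tau>. \<tau> \<in> cauchy_sums X E F \<and> (\<lambda>n. fs_dist X E F (\<sigma> n) (\<tau> n)) \<longlonglongrightarrow> 0"
    using assms eq fs.equivalent_refl by (auto simp: cauchy_sums_eq)
  from someI_ex[OF this]
  have *: "seq_of (limit \<sigma>) \<in> C \<and> (\<lambda>n. fs_dist X E F (\<sigma> n) (seq_of (limit \<sigma>) n)) \<longlonglongrightarrow> 0"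
    by (simp add: lim_elt_def cauchy_sums_eq)
  then show "seq_of (limit \<sigma>) \<in> C" ..
  with * show "fs.equivalent \<sigma> (seq_of (limit \<sigma>))"
    using eq by blast
qed

lemma limit_eq_iff:
  assumes "\<sigma> \<in> C" "\<tau> \<in> C"
  shows "limit \<sigma> = limit \<tau> \<longleftrightarrow> fs.equivalent \<sigma> \<tau>"
proof
  assume "limit \<sigma> = limit \<tau>"
  then show "fs.equivalent \<sigma> \<tau>"
    using assms seq_of_limit seq_of_limit_equivalent fs.equivalent_commute fs.equivalent_trans
    by metis
next
  assume eq: "fs.equivalent \<sigma> \<tau>"
  have "fs.equivalent \<sigma> \<rho> \<longleftrightarrow> fs.equivalent \<tau> \<rho>" if "\<rho> \<in> C" for \<rho>
    using fs.equivalent_trans[OF assms(1,2) that eq]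
      fs.equivalent_trans[OF assms(2,1) that fs.equivalent_commute[OF assms eq]] by blast
  then have "(\<lambda>\<rho>. \<rho> \<in> cauchy_sums X E F \<and> (\<lambda>n. fs_dist X E F (\<sigma> n) (\<rho> n)) \<longlonglongrightarrow> 0)
      = (\<lambda>\<rho>. \<rho> \<in> cauchy_sums X E F \<and> (\<lambda>n. fs_dist X E F (\<tau> n) (\<rho> n)) \<longlonglongrightarrow> 0)"
    by (auto simp: fun_eq_iff cauchy_sums_eq fs_dist_eq fs.cauchy_seqs_closed fs.equivalent_def)
  then show "limit \<sigma> = limit \<tau>"
    by (simp add: lim_elt_def)
qed

text \<open>
  The tool for proving identities in the completion: it suffices to compare inner products of
  formal sums term by term.
\<close>

lemma limit_eqI:
  assumes "\<sigma> \<in> C" "\<tau> \<in> C"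
    and "\<And>n w t. w \<in> formal_sums E F \<Longrightarrow> fs_ip E F w (\<sigma> n) t = fs_ip E F w (\<tau> n) t"
  shows "limit \<sigma> = limit \<tau>"
  using assms by (simp add: limit_eq_iff fs.equivalent_null fs.cauchy_seqs_closed)

lemma limit_seq_of:
  assumes "z \<in> carrier T"
  shows "seq_of z \<in> C" "z = limit (seq_of z)"
proof -
  obtain \<sigma> where \<sigma>: "\<sigma> \<in> C" "z = limit \<sigma>"
    using assms by (auto simp: tensor_def cauchy_sums_eq)
  then show "seq_of z \<in> C" "z = limit (seq_of z)"
    using seq_of_limit[OF \<sigma>(1)] seq_of_limit_equivalent[OF \<sigma>(1)] by (auto simp: limit_eq_iff)
qed

lemma tensor_cases:
  assumes "z \<in> carrier T"
  obtains \<sigma> where "\<sigma> \<in> C" "z = limit \<sigma>"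
  using limit_seq_of[OF assms] by blast

lemma limit_closed: "\<sigma> \<in> C \<Longrightarrow> limit \<sigma> \<in> carrier T"
  by (simp add: tensor_def cauchy_sums_eq)

text \<open>
  Operations of the tensor product act on chosen representatives; this replaces the chosen
  representative of a limit by the given sequence.
\<close>

lemma limit_lipschitz:
  assumes "lipschitz_map X (formal_sums E F) (@) (fs_scale E) (fs_ip E F)
      (formal_sums E F) (@) (fs_scale E) (fs_ip E F) \<Phi> B" and \<sigma>: "\<sigma> \<in> C"
  shows "limit (\<lambda>n. \<Phi> (seq_of (limit \<sigma>) n)) = limit (\<lambda>n. \<Phi> (\<sigma> n))" "(\<lambda>n. \<Phi> (\<sigma> n)) \<in> C"
proof -
  interpret lipschitz_map X "formal_sums E F" "(@)" "fs_scale E" "fs_ip E F"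
      "formal_sums E F" "(@)" "fs_scale E" "fs_ip E F" \<Phi> B by fact
  show "(\<lambda>n. \<Phi> (\<sigma> n)) \<in> C"
    by (rule map_cauchy[OF \<sigma>])
  have "fs.equivalent (\<lambda>n. \<Phi> (\<sigma> n)) (\<lambda>n. \<Phi> (seq_of (limit \<sigma>) n))"
    by (intro map_equivalent \<sigma> seq_of_limit seq_of_limit_equivalent)
  then show "limit (\<lambda>n. \<Phi> (seq_of (limit \<sigma>) n)) = limit (\<lambda>n. \<Phi> (\<sigma> n))"
    using map_cauchy[OF \<sigma>] map_cauchy[OF seq_of_limit[OF \<sigma>]] limit_eq_iff by metis
qed

lemma append_cauchy: "\<sigma> \<in> C \<Longrightarrow> \<tau> \<in> C \<Longrightarrow> (\<lambda>n. \<sigma> n @ \<tau> n) \<in> C"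
  by (rule fs.cauchy_plus)

lemma nil_cauchy: "(\<lambda>n. []) \<in> C"
  by (rule fs.const_cauchy[OF nil_formal_sums])

lemma fs_scale_cauchy: "\<sigma> \<in> C \<Longrightarrow> (\<lambda>n. fs_scale E c (\<sigma> n)) \<in> C"
  by (rule limit_lipschitz(2)[OF fs.scale_lipschitz])

lemma fs_act_cauchy: "f \<in> C0 X \<Longrightarrow> \<sigma> \<in> C \<Longrightarrow> (\<lambda>n. fs_act E f (\<sigma> n)) \<in> C"
  by (rule limit_lipschitz(2)[OF fs_act_lipschitz])

lemma tensor_zero: "\<zero>\<^bsub>T\<^esub> = limit (\<lambda>n. [])"
  by (simp add: tensor_def)

lemma tensor_add:
  assumes "\<sigma> \<in> C" "\<tau> \<in> C"
  shows "limit \<sigma> \<oplus>\<^bsub>T\<^esub> limit \<tau> = limit (\<lambda>n. \<sigma> n @ \<tau> n)"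
proof -
  note S = seq_of_limit[OF assms(1)] seq_of_limit[OF assms(2)]
  have "fs.equivalent (\<lambda>n. \<sigma> n @ \<tau> n) (\<lambda>n. seq_of (limit \<sigma>) n @ seq_of (limit \<tau>) n)"
    by (intro fs.equivalent_plus assms S seq_of_limit_equivalent)
  then have "limit (\<lambda>n. \<sigma> n @ \<tau> n) = limit (\<lambda>n. seq_of (limit \<sigma>) n @ seq_of (limit \<tau>) n)"
    using assms S by (simp add: limit_eq_iff append_cauchy)
  then show ?thesis
    by (simp add: tensor_def)
qed

lemma tensor_scale: "\<sigma> \<in> C \<Longrightarrow> c \<odot>\<^bsub>T\<^esub> limit \<sigma> = limit (\<lambda>n. fs_scale E c (\<sigma> n))"
  using limit_lipschitz(1)[OF fs.scale_lipschitz] by (simp add: tensor_def fs_scale_def)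

lemma tensor_act: "f \<in> C0 X \<Longrightarrow> \<sigma> \<in> C \<Longrightarrow> act T f (limit \<sigma>) = limit (\<lambda>n. fs_act E f (\<sigma> n))"
  using limit_lipschitz(1)[OF fs_act_lipschitz] by (simp add: tensor_def fs_act_def)

lemma tensor_ip:
  assumes "\<sigma> \<in> C" "\<tau> \<in> C"
  shows "ip T (limit \<sigma>) (limit \<tau>) = fs.plim \<sigma> \<tau>"
proof
  fix t
  have "fs.plim \<sigma> \<tau> t = fs.plim (seq_of (limit \<sigma>)) (seq_of (limit \<tau>)) t"
    by (intro fs.plim_cong assms seq_of_limit seq_of_limit_equivalent)
  then show "ip T (limit \<sigma>) (limit \<tau>) t = fs.plim \<sigma> \<tau> t"
    by (simp add: tensor_def fs.plim_def)
qed

lemma hnorm_limit: "\<sigma> \<in> C \<Longrightarrow> hnorm X T (limit \<sigma>) = fs.limit_nrm \<sigma>"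
  by (simp add: hnorm_def fs.limit_nrm_def tensor_ip)

lemmas tensor_simps = tensor_zero tensor_add tensor_scale tensor_act tensor_ip hnorm_limit
  limit_closed nil_cauchy append_cauchy fs_scale_cauchy fs_act_cauchy

lemmas fs_simps = fs.p_simps fs_ip_act_right fs_ip_act_left fs_act_closed fs_ip_append
  nil_formal_sums

lemma tensor_module: "module complex_ring T"
proof (rule complex_moduleI)
  note [elim!] = tensor_cases
  show "\<zero>\<^bsub>T\<^esub> \<in> carrier T"
    by (simp add: tensor_simps)
  fix x assume "x \<in> carrier T"
  then obtain \<sigma> where x: "\<sigma> \<in> C" "x = limit \<sigma>" by blast
  note \<sigma> = fs.cauchy_seqs_closed[OF x(1)]
  show "c \<odot>\<^bsub>T\<^esub> x \<in> carrier T" for c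
    using x by (simp add: tensor_simps)
  show "\<zero>\<^bsub>T\<^esub> \<oplus>\<^bsub>T\<^esub> x = x"
    using x by (simp add: tensor_simps)
  show "(-1) \<odot>\<^bsub>T\<^esub> x \<oplus>\<^bsub>T\<^esub> x = \<zero>\<^bsub>T\<^esub>"
    using x \<sigma> by (simp add: tensor_simps) (intro limit_eqI; simp add: tensor_simps fs_simps)
  show "(a + b) \<odot>\<^bsub>T\<^esub> x = a \<odot>\<^bsub>T\<^esub> x \<oplus>\<^bsub>T\<^esub> b \<odot>\<^bsub>T\<^esub> x" for a b
    using x \<sigma> by (simp add: tensor_simps) (intro limit_eqI; simp add: tensor_simps fs_simps algebra_simps)
  show "(a * b) \<odot>\<^bsub>T\<^esub> x = a \<odot>\<^bsub>T\<^esub> (b \<odot>\<^bsub>T\<^esub> x)" for a b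
    using x \<sigma> by (simp add: tensor_simps) (intro limit_eqI; simp add: tensor_simps fs_simps algebra_simps)
  show "1 \<odot>\<^bsub>T\<^esub> x = x"
    using x \<sigma> by (simp add: tensor_simps) (intro limit_eqI; simp add: tensor_simps fs_simps)
  fix y assume "y \<in> carrier T"
  then obtain \<tau> where y: "\<tau> \<in> C" "y = limit \<tau>" by blast
  note \<tau> = fs.cauchy_seqs_closed[OF y(1)]
  show "x \<oplus>\<^bsub>T\<^esub> y \<in> carrier T"
    using x y by (simp add: tensor_simps)
  show "x \<oplus>\<^bsub>T\<^esub> y = y \<oplus>\<^bsub>T\<^esub> x"
    using x y \<sigma> \<tau> by (simp add: tensor_simps) (intro limit_eqI; simp add: tensor_simps fs_simps)
  show "c \<odot>\<^bsub>T\<^esub> (x \<oplus>\<^bsub>T\<^esub> y) = c \<odot>\<^bsub>T\<^esub> x \<oplus>\<^bsub>T\<^esub> c \<odot>\<^bsub>T\<^esub> y" for c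
    using x y \<sigma> \<tau> by (simp add: tensor_simps)
      (intro limit_eqI; simp add: tensor_simps fs_simps algebra_simps)
  fix z assume "z \<in> carrier T"
  then obtain \<rho> where z: "\<rho> \<in> C" "z = limit \<rho>" by blast
  show "x \<oplus>\<^bsub>T\<^esub> y \<oplus>\<^bsub>T\<^esub> z = x \<oplus>\<^bsub>T\<^esub> (y \<oplus>\<^bsub>T\<^esub> z)"
    using x y z by (simp add: tensor_simps)
qed

lemma tensor_minus:
  assumes "\<sigma> \<in> C" "\<tau> \<in> C"
  shows "limit \<sigma> \<ominus>\<^bsub>T\<^esub> limit \<tau> = limit (\<lambda>n. fs.minus (\<sigma> n) (\<tau> n))"
  using assms complex_module_minus[OF tensor_module, of "limit \<tau>" "limit \<sigma>"]
  by (simp add: tensor_simps fs.minus_def)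

lemma tensor_complete:
  assumes u: "\<And>n. u n \<in> carrier T"
    and cauchy: "\<forall>\<epsilon>>0. \<exists>N. \<forall>m\<ge>N. \<forall>n\<ge>N. hnorm X T (u m \<ominus>\<^bsub>T\<^esub> u n) < \<epsilon>"
  shows "\<exists>x \<in> carrier T. (\<lambda>n. hnorm X T (u n \<ominus>\<^bsub>T\<^esub> x)) \<longlonglongrightarrow> 0"
proof -
  define \<sigma> where "\<sigma> n = seq_of (u n)" for n
  have \<sigma>: "\<sigma> n \<in> C" "u n = limit (\<sigma> n)" for n
    using limit_seq_of[OF u] by (simp_all add: \<sigma>_def)
  have norm: "hnorm X T (u n \<ominus>\<^bsub>T\<^esub> limit \<tau>) = fs.limit_nrm (\<lambda>k. fs.minus (\<sigma> n k) (\<tau> k))"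
    if "\<tau> \<in> C" for n \<tau>
    using \<sigma> that by (simp add: tensor_minus hnorm_limit fs.cauchy_minus)
  have "\<exists>\<tau> \<in> C. (\<lambda>n. fs.limit_nrm (\<lambda>k. fs.minus (\<sigma> n k) (\<tau> k))) \<longlonglongrightarrow> 0"
  proof (rule fs.diagonal_limit[OF \<sigma>(1)])
    fix \<epsilon> :: real assume "\<epsilon> > 0"
    then show "\<exists>N. \<forall>m\<ge>N. \<forall>n\<ge>N. fs.limit_nrm (\<lambda>k. fs.minus (\<sigma> m k) (\<sigma> n k)) < \<epsilon>"
      using cauchy norm[OF \<sigma>(1), folded \<sigma>(2)] by simp
  qed
  then obtain \<tau> where "\<tau> \<in> C" "(\<lambda>n. fs.limit_nrm (\<lambda>k. fs.minus (\<sigma> n k) (\<tau> k))) \<longlonglongrightarrow> 0"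
    by blast
  then show ?thesis
    by (intro bexI[of _ "limit \<tau>"]) (simp_all add: norm limit_closed)
qed

lemma tensor_definite:
  assumes "x \<in> carrier T" "ip T x x = (\<lambda>t. 0)"
  shows "x = \<zero>\<^bsub>T\<^esub>"
proof -
  obtain \<sigma> where x: "\<sigma> \<in> C" "x = limit \<sigma>"
    using assms(1) by (rule tensor_cases)
  have "fs.minus (\<sigma> n) [] = \<sigma> n" for n
    by (simp add: fs.minus_def fs_scale_def)
  moreover have "fs.plim \<sigma> \<sigma> = (\<lambda>t. 0)"
    using assms(2) x by (simp add: tensor_ip)
  ultimately have "fs.equivalent \<sigma> (\<lambda>n. [])"
    by (intro fs.equivalent_definite x nil_cauchy) simp
  then show ?thesis
    using x by (simp add: tensor_zero limit_eq_iff nil_cauchy)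
qed

theorem tensor_hilbert_module: "hilbert_module X T"
proof (intro hilbert_module.intro tensor_module hilbert_module_axioms.intro tensor_complete
    tensor_definite)
  fix x assume "x \<in> carrier T"
  then obtain \<sigma> where x: "\<sigma> \<in> C" "x = limit \<sigma>" by (rule tensor_cases)
  note \<sigma> = fs.cauchy_seqs_closed[OF x(1)]
  show "ip T x x t \<in> \<real>\<^sub>\<ge>\<^sub>0" for t
    using x by (simp add: tensor_ip fs.plim_nonneg)
  {
    fix f assume f: "f \<in> C0 X"
    show "act T f x \<in> carrier T"
      using x f by (simp add: tensor_simps)
    show "act T (\<lambda>t. c * f t) x = c \<odot>\<^bsub>T\<^esub> act T f x" for c
      using x \<sigma> f C0_cmult[OF f, of c] by (simp add: tensor_simps)
        (intro limit_eqI; simp add: tensor_simps fs_simps)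
    show "act T f (c \<odot>\<^bsub>T\<^esub> x) = c \<odot>\<^bsub>T\<^esub> act T f x" for c
      using x \<sigma> f by (simp add: tensor_simps)
        (intro limit_eqI; simp add: tensor_simps fs_simps)
    fix g assume g: "g \<in> C0 X"
    show "act T (\<lambda>t. f t + g t) x = act T f x \<oplus>\<^bsub>T\<^esub> act T g x"
      using x \<sigma> f g C0_add[OF f g] by (simp add: tensor_simps)
        (intro limit_eqI; simp add: tensor_simps fs_simps algebra_simps)
    show "act T (\<lambda>t. f t * g t) x = act T f (act T g x)"
      using x \<sigma> f g C0_mult[OF f g] by (simp add: tensor_simps)
        (intro limit_eqI; simp add: tensor_simps fs_simps)
  }
  fix y assume "y \<in> carrier T"
  then obtain \<tau> where y: "\<tau> \<in> C" "y = limit \<tau>" by (rule tensor_cases)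
  note \<tau> = fs.cauchy_seqs_closed[OF y(1)]
  show "ip T x y \<in> C0 X"
    using x y by (simp add: tensor_ip fs.plim_C0)
  show "ip T x y = (\<lambda>t. cnj (ip T y x t))"
    using x y by (simp add: tensor_ip fun_eq_iff fs.plim_commute[OF x(1) y(1)])
  show "ip T x (c \<odot>\<^bsub>T\<^esub> y) = (\<lambda>t. c * ip T x y t)" for c
    using x y \<sigma> \<tau> by (intro ext) (simp add: tensor_simps; intro fs.plim_cmult_right; simp add: tensor_simps fs_simps)
  {
    fix f assume f: "f \<in> C0 X"
    show "act T f (x \<oplus>\<^bsub>T\<^esub> y) = act T f x \<oplus>\<^bsub>T\<^esub> act T f y"
      using x y \<sigma> \<tau> f by (simp add: tensor_simps)
        (intro limit_eqI; simp add: tensor_simps fs_simps algebra_simps)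
    show "ip T x (act T f y) = (\<lambda>t. f t * ip T x y t)"
      using x y \<sigma> \<tau> f
      by (intro ext) (simp add: tensor_simps; intro fs.plim_cmult_right; simp add: tensor_simps fs_simps)
  }
  fix z assume "z \<in> carrier T"
  then obtain \<rho> where z: "\<rho> \<in> C" "z = limit \<rho>" by (rule tensor_cases)
  show "ip T x (y \<oplus>\<^bsub>T\<^esub> z) = (\<lambda>t. ip T x y t + ip T x z t)"
    using x y z by (intro ext) (simp add: tensor_simps fs.plim_plus_right)
qed

end

section \<open>The tensor product of bounded module maps\<close>

lemma quad_form_pullback:
  "quad_form K (map (apsnd h) l) = quad_form (\<lambda>x y. K (h x) (h y)) l"
  by (simp add: quad_form_def split_def o_def)

lemma psd_kernel_pullback:
  assumes "psd_kernel T K" "\<And>x. x \<in> S \<Longrightarrow> h x \<in> T"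
  shows "psd_kernel S (\<lambda>x y. K (h x) (h y))"
  unfolding psd_kernel_def
proof (intro conjI ballI)
  show "K (h y) (h x) = cnj (K (h x) (h y))" if "x \<in> S" "y \<in> S" for x y
    using psd_kernel_commute[OF assms(1)] assms(2) that by blast
  fix l assume "l \<in> lists ((UNIV :: complex set) \<times> S)"
  then have "map (apsnd h) l \<in> lists (UNIV \<times> T)"
    using assms(2) by (auto simp: in_lists_conv_set)
  then show "quad_form (\<lambda>x y. K (h x) (h y)) l \<in> \<real>\<^sub>\<ge>\<^sub>0"
    using psd_kernel_quad_form[OF assms(1)] quad_form_pullback by metis
qed

lemma psd_kernel_cmult:
  assumes "psd_kernel S K" "C \<ge> 0"
  shows "psd_kernel S (\<lambda>x y. of_real C * K x y)"
  unfolding psd_kernel_def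
proof (intro conjI ballI)
  show "of_real C * K y x = cnj (of_real C * K x y)" if "x \<in> S" "y \<in> S" for x y
    unfolding psd_kernel_commute[OF assms(1) that] by simp
  fix l assume "l \<in> lists ((UNIV :: complex set) \<times> S)"
  then have "of_real C * quad_form K l \<in> \<real>\<^sub>\<ge>\<^sub>0"
    using assms by (intro nonneg_Reals_mult_I psd_kernel_quad_form) simp_all
  then show "quad_form (\<lambda>x y. of_real C * K x y) l \<in> \<real>\<^sub>\<ge>\<^sub>0"
    by (simp add: quad_form_def split_def sum_list_const_mult[symmetric] mult.left_commute)
qed

locale tensor_maps = h: hilbert_map X E E' h + k: hilbert_map X F F' k
  for X :: "'x topology" and E E' F F' :: "('x, 'v) hmodule" and h k +
  assumes locally_compact: "locally_compact_space X" and Hausdorff: "Hausdorff_space X"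
begin

sublocale dom: tensor_product X E F ..
sublocale cod: tensor_product X E' F' ..

abbreviation "fs_map \<equiv> map (map_prod h k)"
abbreviation "M \<equiv> tensor_map X E F E' F' h k"

lemma fs_map_closed: "u \<in> formal_sums E F \<Longrightarrow> fs_map u \<in> formal_sums E' F'"
  by (induction u) (auto simp: formal_sums_def h.map_closed k.map_closed)

lemma fs_map_scale: "u \<in> formal_sums E F \<Longrightarrow> fs_map (fs_scale E c u) = fs_scale E' c (fs_map u)"
  by (induction u) (auto simp: formal_sums_def fs_scale_def h.map_scale)

lemma fs_map_act:
  "f \<in> C0 X \<Longrightarrow> u \<in> formal_sums E F \<Longrightarrow> fs_map (fs_act E f u) = fs_act E' f (fs_map u)"
  by (induction u) (auto simp: formal_sums_def fs_act_def h.map_act)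

lemma fs_map_minus:
  "v \<in> formal_sums E F \<Longrightarrow> fs_map (dom.fs.minus u v) = cod.fs.minus (fs_map u) (fs_map v)"
  by (simp add: dom.fs.minus_def cod.fs.minus_def fs_map_scale)

text \<open>
  With \<open>K, L\<close> the kernels of \<open>E, F\<close> at \<open>t\<close> and \<open>K', L'\<close> those pulled back along \<open>h, k\<close>, the difference
  \<open>B\<^sup>2 K D\<^sup>2 L - K' L'\<close> is \<open>(B\<^sup>2 K - K') D\<^sup>2 L + K' (D\<^sup>2 L - L')\<close>: a sum of two products of positive
  semidefinite kernels.
\<close>

lemma fs_map_bounded:
  obtains B where "B \<ge> 0" "\<And>u t. u \<in> formal_sums E F \<Longrightarrow>
    cmod (fs_ip E' F' (fs_map u) (fs_map u) t) \<le> B\<^sup>2 * cmod (fs_ip E F u u t)"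
proof -
  obtain B where B: "B \<ge> 0" "\<And>x. x \<in> carrier E \<Longrightarrow> hnorm X E' (h x) \<le> B * hnorm X E x"
    using h.map_bounded by blast
  obtain D where D: "D \<ge> 0" "\<And>y. y \<in> carrier F \<Longrightarrow> hnorm X F' (k y) \<le> D * hnorm X F y"
    using k.map_bounded by blast
  have "cmod (fs_ip E' F' (fs_map u) (fs_map u) t) \<le> (B * D)\<^sup>2 * cmod (fs_ip E F u u t)"
    if u: "u \<in> formal_sums E F" for u t
  proof -
    have u': "u \<in> lists (carrier E \<times> carrier F)"
      using u by (simp add: formal_sums_def)
    let ?K = "\<lambda>x y. ip E x y t" and ?K' = "\<lambda>x y. ip E' (h x) (h y) t"
    let ?L = "\<lambda>x y. ip F x y t" and ?L' = "\<lambda>x y. ip F' (k x) (k y) t"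
    have hB: "psd_kernel (carrier E) (\<lambda>x y. of_real (B\<^sup>2) * ?K x y - ?K' x y)"
      by (intro h.psd_kernel_bound h.map_pointwise_bounded locally_compact Hausdorff B)
    have kD: "psd_kernel (carrier F) (\<lambda>x y. of_real (D\<^sup>2) * ?L x y - ?L' x y)"
      by (intro k.psd_kernel_bound k.map_pointwise_bounded locally_compact Hausdorff D)
    have K': "psd_kernel (carrier E) ?K'"
      by (rule psd_kernel_pullback[OF h.cod.psd_kernel_ip h.map_closed])
    have L: "psd_kernel (carrier F) (\<lambda>x y. of_real (D\<^sup>2) * ?L x y)"
      by (rule psd_kernel_cmult[OF k.dom.psd_kernel_ip]) simp
    have "(\<Sum>(x, y)\<leftarrow>u. \<Sum>(x', y')\<leftarrow>u. (of_real (B\<^sup>2) * ?K x x' - ?K' x x') * (of_real (D\<^sup>2) * ?L y y'))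
        + (\<Sum>(x, y)\<leftarrow>u. \<Sum>(x', y')\<leftarrow>u. ?K' x x' * (of_real (D\<^sup>2) * ?L y y' - ?L' y y')) \<in> \<real>\<^sub>\<ge>\<^sub>0"
      by (intro nonneg_Reals_add_I schur_product[OF hB L u'] schur_product[OF K' kD u'])
    also have "(\<Sum>(x, y)\<leftarrow>u. \<Sum>(x', y')\<leftarrow>u. (of_real (B\<^sup>2) * ?K x x' - ?K' x x') * (of_real (D\<^sup>2) * ?L y y'))
        + (\<Sum>(x, y)\<leftarrow>u. \<Sum>(x', y')\<leftarrow>u. ?K' x x' * (of_real (D\<^sup>2) * ?L y y' - ?L' y y'))
        = (\<Sum>(x, y)\<leftarrow>u. \<Sum>(x', y')\<leftarrow>u. of_real ((B * D)\<^sup>2) * (?K x x' * ?L y y') - ?K' x x' * ?L' y y')"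
      by (simp add: split_def sum_list_addf[symmetric] algebra_simps power_mult_distrib
          del: sum_list_addf)
    also have "\<dots> = of_real ((B * D)\<^sup>2) * fs_ip E F u u t - fs_ip E' F' (fs_map u) (fs_map u) t"
      by (simp add: fs_ip_def split_def o_def sum_list_subtractf sum_list_const_mult)
    finally have difference: "of_real ((B * D)\<^sup>2) * fs_ip E F u u t - fs_ip E' F' (fs_map u) (fs_map u) t \<in> \<real>\<^sub>\<ge>\<^sub>0" .
    have dom: "of_real (cmod (fs_ip E F u u t)) = fs_ip E F u u t"
      using dom.fs_ip_nonneg[OF u] nonneg_Reals_iff_cmod by metis
    have cod: "of_real (cmod (fs_ip E' F' (fs_map u) (fs_map u) t)) = fs_ip E' F' (fs_map u) (fs_map u) t"
      using cod.fs_ip_nonneg[OF fs_map_closed[OF u]] nonneg_Reals_iff_cmod by metis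
    have "of_real ((B * D)\<^sup>2 * cmod (fs_ip E F u u t)
        - cmod (fs_ip E' F' (fs_map u) (fs_map u) t)) \<in> (\<real>\<^sub>\<ge>\<^sub>0 :: complex set)"
      unfolding of_real_diff of_real_mult dom cod by (rule difference)
    then show ?thesis
      unfolding nonneg_Reals_of_real_iff by simp
  qed
  then show ?thesis
    by (intro that[of "B * D"] mult_nonneg_nonneg B(1) D(1))
qed

lemma fs_map_nrm:
  assumes "B \<ge> 0" "\<And>u t. u \<in> formal_sums E F \<Longrightarrow>
      cmod (fs_ip E' F' (fs_map u) (fs_map u) t) \<le> B\<^sup>2 * cmod (fs_ip E F u u t)"
    and u: "u \<in> formal_sums E F"
  shows "cod.fs.nrm (fs_map u) \<le> B * dom.fs.nrm u"
proof (rule cod.fs.nrm_least)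
  show "0 \<le> B * dom.fs.nrm u"
    using assms(1) dom.fs.nrm_nonneg[OF u] by simp
  show "cmod (fs_ip E' F' (fs_map u) (fs_map u) t) \<le> (B * dom.fs.nrm u)\<^sup>2" for t
    using assms(2)[OF u, of t] mult_left_mono[OF dom.fs.nrm_upper[OF u, of t], of "B\<^sup>2"]
    by (simp add: power_mult_distrib)
qed

lemma fs_map_lipschitz:
  "\<exists>B. lipschitz_map X (formal_sums E F) (@) (fs_scale E) (fs_ip E F)
    (formal_sums E' F') (@) (fs_scale E') (fs_ip E' F') fs_map B"
proof -
  obtain B where B: "B \<ge> 0" "\<And>u t. u \<in> formal_sums E F \<Longrightarrow>
    cmod (fs_ip E' F' (fs_map u) (fs_map u) t) \<le> B\<^sup>2 * cmod (fs_ip E F u u t)"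
    using fs_map_bounded by blast
  have "lipschitz_map X (formal_sums E F) (@) (fs_scale E) (fs_ip E F)
      (formal_sums E' F') (@) (fs_scale E') (fs_ip E' F') fs_map B"
  proof unfold_locales
    fix u v assume uv: "u \<in> formal_sums E F" "v \<in> formal_sums E F"
    show "cod.fs.dst (fs_map u) (fs_map v) \<le> B * dom.fs.dst u v"
      unfolding dom.fs.dst_def cod.fs.dst_def fs_map_minus[OF uv(2), symmetric]
      by (intro fs_map_nrm[OF B] dom.fs.minus_closed uv)
  qed (rule fs_map_closed)
  then show ?thesis ..
qed

lemma fs_map_cauchy:
  assumes "\<sigma> \<in> dom.C"
  shows "(\<lambda>n. fs_map (\<sigma> n)) \<in> cod.C"
proof -
  obtain B where L: "lipschitz_map X (formal_sums E F) (@) (fs_scale E) (fs_ip E F)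
      (formal_sums E' F') (@) (fs_scale E') (fs_ip E' F') fs_map B"
    using fs_map_lipschitz by blast
  show ?thesis
    by (rule lipschitz_map.map_cauchy[OF L assms])
qed

lemma tensor_map_limit:
  assumes "\<sigma> \<in> dom.C"
  shows "M (dom.limit \<sigma>) = cod.limit (\<lambda>n. fs_map (\<sigma> n))"
proof -
  obtain B where L: "lipschitz_map X (formal_sums E F) (@) (fs_scale E) (fs_ip E F)
      (formal_sums E' F') (@) (fs_scale E') (fs_ip E' F') fs_map B"
    using fs_map_lipschitz by blast
  have "cod.fs.equivalent (\<lambda>n. fs_map (\<sigma> n)) (\<lambda>n. fs_map (seq_of (dom.limit \<sigma>) n))"
    by (intro lipschitz_map.map_equivalent[OF L] assms dom.seq_of_limit dom.seq_of_limit_equivalent)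
  then have "cod.limit (\<lambda>n. fs_map (\<sigma> n)) = cod.limit (\<lambda>n. fs_map (seq_of (dom.limit \<sigma>) n))"
    using fs_map_cauchy[OF assms] fs_map_cauchy[OF dom.seq_of_limit[OF assms]]
    by (simp add: cod.limit_eq_iff)
  then show ?thesis
    using dom.limit_closed[OF assms] by (simp add: tensor_map_def)
qed

theorem tensor_hilbert_map: "hilbert_map X dom.T cod.T M"
proof -
  obtain B where B: "B \<ge> 0" "\<And>u t. u \<in> formal_sums E F \<Longrightarrow>
    cmod (fs_ip E' F' (fs_map u) (fs_map u) t) \<le> B\<^sup>2 * cmod (fs_ip E F u u t)"
    using fs_map_bounded by blast
  show ?thesis
  proof (rule hilbert_mapI[where B = B])
    fix x assume "x \<in> carrier dom.T"
    then obtain \<sigma> where x: "\<sigma> \<in> dom.C" "x = dom.limit \<sigma>" by (rule dom.tensor_cases)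
    note \<sigma> = dom.fs.cauchy_seqs_closed[OF x(1)]
    note simps = tensor_map_limit fs_map_cauchy dom.tensor_simps cod.tensor_simps
    show "M x \<in> carrier cod.T"
      using x by (simp add: simps)
    show "M (c \<odot>\<^bsub>dom.T\<^esub> x) = c \<odot>\<^bsub>cod.T\<^esub> M x" for c
      using x \<sigma> by (simp add: simps fs_map_scale)
    show "M (act dom.T f x) = act cod.T f (M x)" if "f \<in> C0 X" for f
      using x \<sigma> that by (simp add: simps fs_map_act)
    show "hnorm X cod.T (M x) \<le> B * hnorm X dom.T x"
    proof -
      have "cod.fs.nrm (fs_map (\<sigma> n)) \<le> B * dom.fs.nrm (\<sigma> n)" for n
        by (rule fs_map_nrm[OF B \<sigma>])
      then have "cod.fs.limit_nrm (\<lambda>n. fs_map (\<sigma> n)) \<le> B * dom.fs.limit_nrm \<sigma>"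
        using cod.fs.limit_nrm_tendsto[OF fs_map_cauchy[OF x(1)]]
          tendsto_mult_left[OF dom.fs.limit_nrm_tendsto[OF x(1)], of B]
        by (intro LIMSEQ_le) auto
      then show ?thesis
        using x by (simp add: simps)
    qed
    fix y assume "y \<in> carrier dom.T"
    then obtain \<tau> where y: "\<tau> \<in> dom.C" "y = dom.limit \<tau>" by (rule dom.tensor_cases)
    show "M (x \<oplus>\<^bsub>dom.T\<^esub> y) = M x \<oplus>\<^bsub>cod.T\<^esub> M y"
      using x y by (simp add: simps)
  qed (rule dom.tensor_hilbert_module cod.tensor_hilbert_module)+
qed

lemma tensor_map_arr: "(dom.T, M, cod.T) \<in> arr (Hilb X)"
  using tensor_hilbert_map by (simp add: Hilb_arr_iff tensor_map_def)

end

section \<open>Firmness\<close>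

lemma hilbert_map_restrict_id:
  assumes "hilbert_module X E"
  shows "hilbert_map X E E (\<lambda>x\<in>carrier E. x)"
proof -
  interpret hilbert_module X E by fact
  show ?thesis
    using assms by (intro hilbert_mapI[where B = 1]) (simp_all add: scale_axioms act_closed)
qed

text \<open>
  If \<open>s\<close> embeds \<open>S\<close> into the tensor unit, then \<open>s(a) x = s(x) a\<close> for all \<open>a, x \<in> S\<close>, because both
  sides have the same image. So the fibre of \<open>S\<close> is at most one-dimensional at every point where
  some \<open>s(a)\<close> does not vanish.
\<close>

locale subunit = hilbert_map X S "unit_module X" s
  for X :: "'x topology" and S :: "('x, 'v) hmodule" and s :: "('x, 'v) elt \<Rightarrow> ('x, 'v) elt" +
  assumes inj: "inj_on s (carrier S)"
begin

abbreviation fn :: "('x, 'v) elt \<Rightarrow> 'x \<Rightarrow> complex" where "fn x \<equiv> fun_of (s x)"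

lemma fn_C0: "x \<in> carrier S \<Longrightarrow> fn x \<in> C0 X"
  using map_closed by fastforce

lemma map_eq_Fun: "x \<in> carrier S \<Longrightarrow> s x = Fun (fn x)"
  using map_closed by fastforce

lemma act_swap:
  assumes "a \<in> carrier S" "x \<in> carrier S"
  shows "act S (fn a) x = act S (fn x) a"
proof (rule inj_onD[OF inj])
  show "s (act S (fn a) x) = s (act S (fn x) a)"
    using map_act[OF fn_C0[OF assms(1)] assms(2)] map_act[OF fn_C0[OF assms(2)] assms(1)]
    by (simp add: mult.commute)
qed (intro dom.act_closed fn_C0 assms)+

lemma ip_rank_one:
  assumes "a \<in> carrier S" "x \<in> carrier S" "y \<in> carrier S"
  shows "(cnj (fn a t) * fn a t) * ip S x y t = ip S a a t * (cnj (fn x t) * fn y t)"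
proof -
  have "(cnj (fn a t) * fn a t) * ip S x y t = ip S (act S (fn a) x) (act S (fn a) y) t"
    using assms fn_C0 by (simp add: dom.ip_act_left dom.ip_act_right dom.act_closed)
  also have "\<dots> = ip S (act S (fn x) a) (act S (fn y) a) t"
    by (simp only: act_swap[OF assms(1,2)] act_swap[OF assms(1,3)])
  also have "\<dots> = ip S a a t * (cnj (fn x t) * fn y t)"
    using assms fn_C0 by (simp add: dom.ip_act_left dom.ip_act_right dom.act_closed)
  finally show ?thesis .
qed

end

locale subunit_tensor = subunit X S s + F: hilbert_module X F
  for X :: "'x topology" and S F :: "('x, 'v) hmodule" and s +
  assumes locally_compact: "locally_compact_space X" and Hausdorff: "Hausdorff_space X"
begin

sublocale tensor_maps X S "unit_module X" F F s "\<lambda>y\<in>carrier F. y"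
  using hilbert_map_axioms hilbert_map_restrict_id[OF F.hilbert_module_axioms]
    locally_compact Hausdorff by (simp add: tensor_maps_def tensor_maps_axioms_def)

sublocale tens: hilbert_map X dom.T cod.T M
  by (rule tensor_hilbert_map)

lemma fs_ip_map:
  assumes "a \<in> carrier S" "u \<in> formal_sums S F"
  shows "(cnj (fn a t) * fn a t) * fs_ip S F u u t
    = ip S a a t * fs_ip (unit_module X) F (fs_map u) (fs_map u) t"
proof -
  note mem = formal_sums_mem[OF assms(2)]
  have "(cnj (fn a t) * fn a t) * fs_ip S F u u t
      = (\<Sum>p\<leftarrow>u. \<Sum>q\<leftarrow>u. ((cnj (fn a t) * fn a t) * ip S (fst p) (fst q) t) * ip F (snd p) (snd q) t)"
    by (simp add: fs_ip_def split_def sum_list_const_mult[symmetric] mult.assoc)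
  also have "\<dots> = (\<Sum>p\<leftarrow>u. \<Sum>q\<leftarrow>u.
      (ip S a a t * (cnj (fn (fst p) t) * fn (fst q) t)) * ip F (snd p) (snd q) t)"
    by (intro sum_list_cong) (simp only: ip_rank_one[OF assms(1) mem(1) mem(1)])
  also have "\<dots> = ip S a a t * fs_ip (unit_module X) F (fs_map u) (fs_map u) t"
    unfolding fs_ip_def split_def map_map o_def fst_map_prod snd_map_prod sum_list_const_mult[symmetric]
    by (intro sum_list_cong) (simp add: mem)
  finally show ?thesis .
qed

lemma ip_map:
  assumes "a \<in> carrier S" "z \<in> carrier dom.T"
  shows "(cnj (fn a t) * fn a t) * ip dom.T z z t = ip S a a t * ip cod.T (M z) (M z) t"
proof -
  obtain \<sigma> where z: "\<sigma> \<in> dom.C" "z = dom.limit \<sigma>"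
    using assms(2) by (rule dom.tensor_cases)
  note \<tau> = fs_map_cauchy[OF z(1)]
  have "(\<lambda>n. (cnj (fn a t) * fn a t) * fs_ip S F (\<sigma> n) (\<sigma> n) t)
      \<longlonglongrightarrow> (cnj (fn a t) * fn a t) * dom.fs.plim \<sigma> \<sigma> t"
    by (intro tendsto_intros dom.fs.plim_tendsto z)
  moreover have "(\<lambda>n. (cnj (fn a t) * fn a t) * fs_ip S F (\<sigma> n) (\<sigma> n) t)
      \<longlonglongrightarrow> ip S a a t * cod.fs.plim (\<lambda>n. fs_map (\<sigma> n)) (\<lambda>n. fs_map (\<sigma> n)) t"
    unfolding fs_ip_map[OF assms(1) dom.fs.cauchy_seqs_closed[OF z(1)]]
    by (intro tendsto_intros cod.fs.plim_tendsto \<tau>)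
  ultimately show ?thesis
    using LIMSEQ_unique z \<tau> by (simp add: dom.tensor_ip cod.tensor_ip tensor_map_limit)
qed

text \<open>
  Where \<open>\<langle>z | z\<rangle>\<close> does not vanish, \<open>ip_map\<close> shows that \<open>s\<close> vanishes. As the
  former is an open condition, the fibres of \<open>S\<close>, hence those of \<open>S \<otimes> F\<close>, are zero there.
\<close>

lemma tensor_map_kernel:
  assumes z: "z \<in> carrier dom.T" and Mz: "M z = \<zero>\<^bsub>cod.T\<^esub>"
  shows "z = \<zero>\<^bsub>dom.T\<^esub>"
proof (rule dom.tensor_definite[OF z])
  have zero: "fn a t = 0 \<or> ip dom.T z z t = 0" if "a \<in> carrier S" for a t
    using ip_map[OF that z, of t] Mz tens.cod.ip_zero[OF tens.cod.M.zero_closed] by auto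
  show "ip dom.T z z = (\<lambda>t. 0)"
  proof (rule ext, rule ccontr)
    fix t0 assume t0: "ip dom.T z z t0 \<noteq> 0"
    have zz: "ip dom.T z z \<in> C0 X"
      using z by (rule tens.dom.ip_closed[OF _ z])
    define N where "N = {t \<in> topspace X. ip dom.T z z t \<in> - {0}}"
    have "openin X N"
      unfolding N_def by (rule openin_continuous_map_preimage[OF C0_continuous[OF zz]]) auto
    moreover have "t0 \<in> N"
      using t0 C0_outside[OF zz] by (auto simp: N_def)
    ultimately obtain g where g: "(\<lambda>t. of_real (g t)) \<in> C0 X" "g t0 = 1"
        "\<And>t. t \<notin> N \<Longrightarrow> g t = 0"
      using bump_function[OF locally_compact Hausdorff, of N t0] by metis
    let ?g = "\<lambda>t. complex_of_real (g t)"
    \<comment> \<open>Over \<open>N\<close> the map \<open>s\<close> vanishes, so injectivity forces the fibres of \<open>S\<close> over \<open>N\<close> to vanish.\<close>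
    have diag: "ip S a a t0 = 0" if a: "a \<in> carrier S" for a
    proof -
      have "(\<lambda>t. ?g t * fn a t) = (\<lambda>t. 0)"
      proof
        fix t
        show "?g t * fn a t = 0"
          using g(3)[of t] zero[OF a, of t] by (auto simp: N_def)
      qed
      then have "s (act S ?g a) = \<zero>\<^bsub>unit_module X\<^esub>"
        using g(1) a by (simp add: map_act)
      then have "act S ?g a = \<zero>\<^bsub>S\<^esub>"
        using inj g(1) a by (simp add: inj_iff dom.act_closed)
      moreover have "ip S (act S ?g a) (act S ?g a) t0 = ip S a a t0"
        using g(1,2) a by (simp add: dom.ip_act_left dom.ip_act_right dom.act_closed)
      ultimately show ?thesis by (metis dom.M.zero_closed dom.ip_zero(1))
    qed
    have vanish: "ip S a b t0 = 0" if "a \<in> carrier S" "b \<in> carrier S" for a b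
      using dom.inner.cauchy_schwarz[OF that, of t0] diag that by simp
    obtain \<sigma> where \<sigma>: "\<sigma> \<in> dom.C" "z = dom.limit \<sigma>"
      using z by (rule dom.tensor_cases)
    have "fs_ip S F (\<sigma> n) (\<sigma> n) t0 = 0" for n
    proof -
      note mem = formal_sums_mem[OF dom.fs.cauchy_seqs_closed[OF \<sigma>(1)]]
      have "fs_ip S F (\<sigma> n) (\<sigma> n) t0 = (\<Sum>p\<leftarrow>\<sigma> n. \<Sum>q\<leftarrow>\<sigma> n. 0)"
        unfolding fs_ip_def split_def by (intro sum_list_cong) (simp add: vanish[OF mem(1) mem(1)])
      then show ?thesis by simp
    qed
    then have "dom.fs.plim \<sigma> \<sigma> t0 = 0"
      by (intro dom.fs.plim_eqI \<sigma>) simp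
    with t0 show False
      using \<sigma> by (simp add: dom.tensor_ip)
  qed
qed

lemma tensor_map_inj: "inj_on M (carrier dom.T)"
  unfolding tens.inj_iff using tensor_map_kernel by blast

end

lemma subobject_members:
  assumes "\<Sigma> \<in> subobjects C A" "s \<in> \<Sigma>"
  shows "s \<in> monos_into C A"
  using assms by (auto simp: subobjects_def quotient_def sub_rel_def)

lemma subunit_iff_monos_into:
  "a \<in> monos_into (Hilb X :: (('x, 'v) hmodule, ('x, 'v) harrow) tensor_cat) (unit_module X) \<longleftrightarrow>
    (\<exists>S s. a = (S, s, unit_module X) \<and> subunit X S s \<and> s \<in> extensional (carrier S))"
proof -
  have "monic (Hilb X) (S, s, unit_module X) \<longleftrightarrow> subunit X S s \<and> s \<in> extensional (carrier S)"
    for S :: "('x, 'v) hmodule" and s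
  proof (cases "(S, s, unit_module X) \<in> arr (Hilb X :: (('x, 'v) hmodule, ('x, 'v) harrow) tensor_cat)")
    case True
    then show ?thesis
      using Hilb_monic_iff[OF True] by (auto simp: Hilb_arr_iff subunit_def subunit_axioms_def)
  next
    case False
    then show ?thesis
      by (auto simp: monic_def Hilb_arr_iff subunit_def)
  qed
  then show ?thesis
    by (cases a) (auto simp: monos_into_def)
qed

theorem firm_Hilb:
  fixes X :: "'x topology"
  assumes "locally_compact_space X" "Hausdorff_space X"
  shows "firm (Hilb X :: (('x, 'v) hmodule, ('x, 'v) harrow) tensor_cat)"
  unfolding firm_def
proof (intro ballI)
  fix \<Sigma> \<Theta> and s t :: "('x, 'v) harrow"
  assume \<Sigma>: "\<Sigma> \<in> subunits (Hilb X)" "s \<in> \<Sigma>" and \<Theta>: "\<Theta> \<in> subunits (Hilb X)" "t \<in> \<Theta>"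
  obtain S h where s: "s = (S, h, unit_module X)" "subunit X S h"
    using subobject_members[OF \<Sigma>] unfolding Hilb_simps subunit_iff_monos_into by blast
  obtain T k where t: "t = (T, k, unit_module X)" "subunit X T k"
    using subobject_members[OF \<Theta>] unfolding Hilb_simps subunit_iff_monos_into by blast
  interpret S: subunit X S h by (rule s)
  interpret T: subunit X T k by (rule t)
  interpret subunit_tensor X T S k by unfold_locales (rule assms)+
  show "monic (Hilb X) (tensor_arr (Hilb X) t (ide (Hilb X) (src (Hilb X) s)))"
    using Hilb_monic_iff[OF tensor_map_arr] tensor_map_inj by (simp add: s(1) t(1))
qed

section \<open>Idempotent subunits from open sets\<close>

lemma C0_ideal_hilbert_module:
  "hilbert_module X ((unit_module X :: ('x, 'v) hmodule)\<lparr>carrier := Fun ` C0_ideal X U\<rparr>)"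
proof -
  interpret I: hilbert_module X "unit_module X :: ('x, 'v) hmodule"
    by (rule hilbert_module_unit)
  show ?thesis
  proof (rule hilbert_submodule[OF hilbert_module_unit])
    fix u :: "nat \<Rightarrow> ('x, 'v) elt" and x
    assume u: "\<And>n. u n \<in> Fun ` C0_ideal X U" and x: "x \<in> carrier (unit_module X)"
      and lim: "(\<lambda>n. hnorm X (unit_module X) (u n \<ominus>\<^bsub>unit_module X\<^esub> x)) \<longlonglongrightarrow> 0"
    have "fun_of x t = 0" if t: "t \<in> topspace X - U" for t
    proof -
      have "cmod (fun_of x t) \<le> hnorm X (unit_module X) (u n \<ominus>\<^bsub>unit_module X\<^esub> x)" for n
      proof -
        have un: "u n \<in> carrier (unit_module X)" "fun_of (u n) t = 0"
          using u[of n] t by (auto simp: C0_ideal_def)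
        have "fun_of (u n \<ominus>\<^bsub>unit_module X\<^esub> x) t = - fun_of x t"
          using un(2) I.minus_eq_scale[OF x, of "u n"] by simp
        moreover have c: "fun_of (u n \<ominus>\<^bsub>unit_module X\<^esub> x) \<in> C0 X"
          using I.M.minus_closed[OF un(1) x] by auto
        ultimately show ?thesis
          using sup_norm_upper[OF c, of t] by (simp add: hnorm_unit_module[OF c])
      qed
      then have "cmod (fun_of x t) \<le> 0"
        by (intro tendsto_lowerbound[OF lim]) auto
      then show ?thesis by simp
    qed
    with x show "x \<in> Fun ` C0_ideal X U"
      by (auto simp: C0_ideal_def)
  qed (auto simp: C0_ideal_def intro!: imageI C0_add C0_cmult C0_mult)
qed

text \<open>
  At \<open>z = 0\<close> the quotient has the value \<open>0\<close>, and its absolute value is \<open>sqrt (cmod z)\<close> everywhere.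
\<close>

lemma continuous_on_divide_sqrt_cmod:
  "continuous_on UNIV (\<lambda>z. z / complex_of_real (sqrt (cmod z)))"
  unfolding continuous_on_eq_continuous_at[OF open_UNIV]
proof
  fix a :: complex
  show "isCont (\<lambda>z. z / complex_of_real (sqrt (cmod z))) a"
  proof (cases "a = 0")
    case False
    then show ?thesis
      by (intro continuous_intros) auto
  next
    case True
    have "((\<lambda>z. z / complex_of_real (sqrt (cmod z))) \<longlongrightarrow> 0) (at 0)"
    proof (rule Lim_null_comparison)
      have "norm (z / complex_of_real (sqrt (cmod z))) \<le> sqrt (cmod z)" for z
        by (simp add: norm_divide real_div_sqrt)
      then show "\<forall>\<^sub>F z in at 0. norm (z / complex_of_real (sqrt (cmod z))) \<le> sqrt (cmod z)"
        by simp
      show "((\<lambda>z::complex. sqrt (cmod z)) \<longlongrightarrow> 0) (at 0)"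
        by (rule tendsto_eq_intros refl | simp)+
    qed
    with True show ?thesis
      by (simp add: isCont_def)
  qed
qed

text \<open>
  The additional parameter fixes the type \<open>'v\<close> of atoms, which neither \<open>X\<close> nor \<open>U\<close> mentions.
\<close>

locale ideal_subunit =
  fixes X :: "'x topology" and U :: "'x set" and type :: "'v itself"
  assumes locally_compact: "locally_compact_space X" and Hausdorff: "Hausdorff_space X"
begin

abbreviation I :: "('x, 'v) hmodule" where "I \<equiv> unit_module X"
abbreviation S :: "('x, 'v) hmodule" where "S \<equiv> I\<lparr>carrier := Fun ` C0_ideal X U\<rparr>"
abbreviation \<iota> :: "('x, 'v) elt \<Rightarrow> ('x, 'v) elt" where "\<iota> \<equiv> \<lambda>x\<in>Fun ` C0_ideal X U. x"

lemma inclusion_eq: "ideal_inclusion X U = (S, \<iota>, I)"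
  by (simp add: ideal_inclusion_def)

sublocale unit: hilbert_module X I by (rule hilbert_module_unit)

sublocale ideal: hilbert_module X S by (rule C0_ideal_hilbert_module)

sublocale subunit X S \<iota>
  using unit.inclusion_map[OF C0_ideal_hilbert_module, of U]
  by (auto simp: subunit_def subunit_axioms_def C0_ideal_def intro!: inj_onI)

sublocale subunit_tensor X S S \<iota>
  by unfold_locales (rule locally_compact Hausdorff)+

lemma fs_map_mem: "p \<in> set u \<Longrightarrow> u \<in> formal_sums S S \<Longrightarrow> map_prod \<iota> (\<lambda>y\<in>carrier S. y) p = p"
  using formal_sums_mem[of u S S p] by (cases p) auto

lemma fs_map_ideal: "u \<in> formal_sums S S \<Longrightarrow> fs_map u = u"
  using fs_map_mem by (simp add: map_idI)

lemma fs_ip_ideal: "fs_ip I S u v t = fs_ip S S u v t"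
  by (simp add: fs_ip_def)

lemma hnorm_tensor_map:
  assumes "z \<in> carrier dom.T"
  shows "hnorm X cod.T (M z) = hnorm X dom.T z"
proof -
  obtain \<sigma> where \<sigma>: "\<sigma> \<in> dom.C" "z = dom.limit \<sigma>"
    using assms by (rule dom.tensor_cases)
  have "(\<lambda>n. fs_map (\<sigma> n)) = \<sigma>"
    using fs_map_ideal dom.fs.cauchy_seqs_closed[OF \<sigma>(1)] by auto
  then have "M z = cod.limit \<sigma>" "\<sigma> \<in> cod.C"
    using \<sigma> tensor_map_limit fs_map_cauchy[OF \<sigma>(1)] by auto
  then show ?thesis
    using \<sigma> by (simp add: dom.hnorm_limit cod.hnorm_limit dom.fs.limit_nrm_def cod.fs.limit_nrm_def
        dom.fs.plim_def[abs_def] cod.fs.plim_def[abs_def] fs_ip_ideal)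
qed

definition split_sqrt :: "('x, 'v) elt \<times> ('x, 'v) elt \<Rightarrow> ('x, 'v) elt \<times> ('x, 'v) elt" where
  "split_sqrt = (\<lambda>(f, g). (Fun (\<lambda>t. fun_of f t * of_real (sqrt (cmod (fun_of g t)))),
     Fun (\<lambda>t. fun_of g t / of_real (sqrt (cmod (fun_of g t))))))"

lemma split_sqrt_closed:
  assumes "u \<in> formal_sums I S"
  shows "map split_sqrt u \<in> formal_sums S S"
proof -
  have "split_sqrt (Fun f, Fun g) \<in> carrier S \<times> carrier S" if f: "f \<in> C0 X" and g: "g \<in> C0_ideal X U" for f g
  proof -
    have g': "g \<in> C0 X" using g by (simp add: C0_ideal_def)
    have "(\<lambda>t. complex_of_real (sqrt (cmod (g t)))) \<in> C0 X"
      by (rule C0_compose[OF g']) (auto intro!: continuous_intros)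
    moreover have "(\<lambda>t. g t / complex_of_real (sqrt (cmod (g t)))) \<in> C0 X"
      by (rule C0_compose[OF g' continuous_on_divide_sqrt_cmod]) simp
    ultimately show ?thesis
      using f g by (auto simp: split_sqrt_def C0_ideal_def intro!: imageI C0_mult)
  qed
  then show ?thesis
    using assms by (fastforce simp: formal_sums_def in_lists_conv_set)
qed

lemma split_sqrt_null:
  assumes "u \<in> formal_sums I S"
  shows "fs_ip I S w (map split_sqrt u) t = fs_ip I S w u t"
proof -
  have eq: "ip I x (fst (split_sqrt q)) t * ip S y (snd (split_sqrt q)) t
      = ip I x (fst q) t * ip S y (snd q) t" for x y q
    by (cases q) (simp add: split_sqrt_def)
  show ?thesis
    unfolding fs_ip_def split_def map_map o_def by (simp only: eq)
qed

text \<open>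
  Splitting \<open>g\<close> as \<open>sqrt |g| * (g / sqrt |g|)\<close> and moving the first factor to the left turns every formal
  sum over \<open>C\<^sub>0(X)\<close> and the ideal into one over the ideal alone, without changing its class.
\<close>

lemma tensor_map_surj:
  assumes "w \<in> carrier cod.T"
  shows "\<exists>z \<in> carrier dom.T. M z = w"
proof -
  obtain \<sigma> where \<sigma>: "\<sigma> \<in> cod.C" "w = cod.limit \<sigma>"
    using assms by (rule cod.tensor_cases)
  define \<tau> where "\<tau> n = map split_sqrt (\<sigma> n)" for n
  have S: "\<tau> n \<in> formal_sums S S" for n
    unfolding \<tau>_def by (rule split_sqrt_closed[OF cod.fs.cauchy_seqs_closed[OF \<sigma>(1)]])
  have null: "fs_ip I S v (\<sigma> n) t = fs_ip I S v (\<tau> n) t" for v n t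
    unfolding \<tau>_def by (rule split_sqrt_null[OF cod.fs.cauchy_seqs_closed[OF \<sigma>(1)], symmetric])
  have "\<tau> n \<in> formal_sums I S" for n
    using fs_map_closed[OF S] fs_map_ideal[OF S] by simp
  then have cod_\<tau>: "\<tau> \<in> cod.C"
    using null by (intro cod.fs.cauchy_seqs_null[OF \<sigma>(1)]) auto
  have "fs_ip I S = fs_ip S S"
    and "fs_scale I = (fs_scale S :: complex \<Rightarrow> (('x, 'v) elt \<times> ('x, 'v) elt) list \<Rightarrow> _)"
    by (simp_all add: fun_eq_iff fs_ip_ideal fs_scale_def)
  then have "cod.fs.dst = dom.fs.dst"
    by simp
  then have "\<tau> \<in> dom.C"
    using cod_\<tau> S by (simp add: dom.fs.cauchy_seqs_def cod.fs.cauchy_seqs_def)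
  moreover have "M (dom.limit \<tau>) = w"
  proof -
    have "M (dom.limit \<tau>) = cod.limit \<tau>"
      using tensor_map_limit[OF \<open>\<tau> \<in> dom.C\<close>] unfolding fs_map_ideal[OF S] .
    also have "\<dots> = cod.limit \<sigma>"
      by (intro cod.limit_eqI cod_\<tau> \<sigma>(1) null[symmetric])
    finally show ?thesis using \<sigma>(2) by simp
  qed
  ultimately show ?thesis
    using dom.limit_closed by blast
qed

lemma idempotent: "is_iso (Hilb X) (tensor_arr (Hilb X) (S, \<iota>, I) (ide (Hilb X) S))"
proof -
  have "bij_betw M (carrier dom.T) (carrier cod.T)"
    unfolding bij_betw_def using tensor_map_inj tensor_map_surj tens.map_closed by blast
  moreover have "hnorm X dom.T z \<le> 1 * hnorm X cod.T (M z)" if "z \<in> carrier dom.T" for z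
    unfolding hnorm_tensor_map[OF that] by simp
  ultimately have "is_iso (Hilb X) (dom.T, M, cod.T)"
    by (rule Hilb_isoI[OF tensor_map_arr])
  then show ?thesis by simp
qed

end

section \<open>Open sets from idempotent subunits\<close>

text \<open>
  The set \<open>J\<close> is an ideal of \<open>C\<^sub>0(X)\<close>. On the compact set where \<open>f\<close> is not small, finitely many
  members of \<open>J\<close> have no common zero; the sum \<open>q \<in> J\<close> of their squared absolute values is positive
  there, and \<open>q / (\<eta> + q)\<close> is an approximate unit for \<open>f\<close>.
\<close>

lemma C0_ideal_approximation:
  fixes f :: "'x \<Rightarrow> complex"
  assumes J: "J \<subseteq> C0 X" "(\<lambda>t. 0) \<in> J" "\<And>g h. g \<in> J \<Longrightarrow> h \<in> J \<Longrightarrow> (\<lambda>t. g t + h t) \<in> J"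
      "\<And>g h. g \<in> C0 X \<Longrightarrow> h \<in> J \<Longrightarrow> (\<lambda>t. g t * h t) \<in> J"
    and f: "f \<in> C0 X" "\<And>t. t \<in> topspace X \<Longrightarrow> f t \<noteq> 0 \<Longrightarrow> \<exists>j\<in>J. j t \<noteq> 0"
    and \<epsilon>: "\<epsilon> > 0"
  shows "\<exists>g\<in>J. \<forall>t. cmod (f t - g t) \<le> \<epsilon>"
proof -
  define K where "K = {t \<in> topspace X. f t \<in> {z. \<epsilon> \<le> cmod z}}"
  have K: "compactin X K"
  proof -
    obtain L where L: "compactin X L" "\<And>t. t \<notin> L \<Longrightarrow> cmod (f t) < \<epsilon>"
      using C0_compact_support[OF f(1) \<epsilon>] by blast
    have "closedin X K"
      unfolding K_def
      by (rule closedin_continuous_map_preimage[OF C0_continuous[OF f(1)]])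
        (auto intro!: closed_Collect_le continuous_intros)
    moreover have "K \<subseteq> L"
      using L(2) by (fastforce simp: K_def)
    ultimately show ?thesis
      using L(1) closed_compactin by blast
  qed
  let ?V = "\<lambda>j::'x \<Rightarrow> complex. {t \<in> topspace X. j t \<in> - {0}}"
  have "openin X (?V j)" if "j \<in> J" for j
    using that J(1) by (intro openin_continuous_map_preimage[OF C0_continuous]) auto
  moreover have "K \<subseteq> \<Union> (?V ` J)"
    using f(2) \<epsilon> by (fastforce simp: K_def)
  ultimately have "\<exists>\<F>. finite \<F> \<and> \<F> \<subseteq> ?V ` J \<and> K \<subseteq> \<Union> \<F>"
    using K unfolding compactin_def by (elim conjE allE[of _ "?V ` J"]) blast
  then obtain \<F> where \<F>: "finite \<F>" "\<F> \<subseteq> ?V ` J" "K \<subseteq> \<Union> \<F>"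
    by blast
  obtain J0 where J0: "finite J0" "J0 \<subseteq> J" "K \<subseteq> \<Union> (?V ` J0)"
    using finite_subset_image[OF \<F>(1,2)] \<F>(3) by blast
  define q where "q t = (\<Sum>j\<in>J0. (cmod (j t))\<^sup>2)" for t
  have q_nonneg: "q t \<ge> 0" for t
    by (simp add: q_def sum_nonneg)
  have q_pos: "q t > 0" if t: "t \<in> K" for t
  proof -
    obtain j where "j \<in> J0" "j t \<noteq> 0"
      using J0(3) t by auto
    then have "0 < (cmod (j t))\<^sup>2" "(cmod (j t))\<^sup>2 \<le> q t"
      unfolding q_def using J0(1) by (auto intro: member_le_sum)
    then show ?thesis by linarith
  qed
  have qJ: "(\<lambda>t. complex_of_real (q t)) \<in> J"
  proof -
    have "(\<lambda>t. \<Sum>j\<in>J0. cnj (j t) * j t) \<in> J"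
      using J0(1,2)
    proof (induction rule: finite_induct)
      case (insert j A)
      then have "(\<lambda>t. cnj (j t) * j t) \<in> J"
        using J(1) by (intro J(4) C0_cnj) auto
      with insert show ?case
        by (simp add: J(3))
    qed (simp add: J(2))
    then show ?thesis
      by (simp add: q_def cnj_mult_eq_cmod_power2)
  qed
  then have qC0: "(\<lambda>t. complex_of_real (q t)) \<in> C0 X"
    using J(1) by blast
  obtain \<delta> where \<delta>: "\<delta> > 0" "\<And>t. t \<in> K \<Longrightarrow> \<delta> \<le> q t"
  proof (cases "K = {}")
    case True
    then show ?thesis using that[of 1] by simp
  next
    case False
    have "continuous_map X euclideanreal (\<lambda>t. cmod (complex_of_real (q t)))"
      by (rule continuous_map_complex_compose[OF C0_continuous[OF qC0]]) (intro continuous_intros)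
    then have "continuous_map X euclideanreal q"
      using q_nonneg by simp
    then have "compact (q ` K)"
      using image_compactin[OF K] by fastforce
    then obtain t0 where "t0 \<in> K" "\<And>t. t \<in> K \<Longrightarrow> q t0 \<le> q t"
      using compact_attains_inf[of "q ` K"] False by auto
    then show ?thesis
      using that[of "q t0"] q_pos by blast
  qed
  obtain B where B: "B \<ge> 0" "\<And>t. cmod (f t) \<le> B"
    using C0_bounded[OF f(1)] by blast
  \<comment> \<open>The element \<open>f q / (\<eta> + q)\<close> of the ideal is close to \<open>f\<close>: where \<open>f\<close> is not small,
      \<open>q\<close> is bounded below by \<open>\<delta>\<close>, and \<open>\<eta> B / \<delta> \<le> \<epsilon>\<close>; elsewhere the error is at most \<open>|f|\<close>.\<close>
  define \<eta> where "\<eta> = \<epsilon> * \<delta> / (B + 1)"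
  have \<eta>: "\<eta> > 0"
    using \<epsilon> \<delta>(1) B(1) by (simp add: \<eta>_def)
  let ?r = "\<lambda>t. complex_of_real (1 / (\<eta> + q t))"
  have "(\<lambda>t. ?r t * f t) \<in> C0 X"
  proof (rule C0_mult_continuous[OF _ f(1)])
    have "continuous_map X euclidean (\<lambda>t. complex_of_real (1 / (\<eta> + cmod (complex_of_real (q t)))))"
      by (rule continuous_map_complex_compose[OF C0_continuous[OF qC0]])
        (intro continuous_intros, smt (verit) \<eta> norm_ge_zero)
    then show "continuous_map X euclidean ?r"
      using q_nonneg by simp
    show "cmod (?r t) \<le> 1 / \<eta>" for t
      unfolding norm_of_real using \<eta> q_nonneg[of t] by (simp add: frac_le)
  qed
  then have "(\<lambda>t. (?r t * f t) * of_real (q t)) \<in> J"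
    using qJ by (rule J(4))
  moreover have "cmod (f t - (?r t * f t) * of_real (q t)) \<le> \<epsilon>" for t
  proof -
    have "\<eta> + q t > 0" using \<eta> q_nonneg[of t] by linarith
    then have "1 - q t / (\<eta> + q t) = \<eta> / (\<eta> + q t)"
      by (simp add: field_simps)
    moreover have "f t - (?r t * f t) * of_real (q t) = of_real (1 - q t / (\<eta> + q t)) * f t"
      by (simp add: algebra_simps)
    ultimately have eq: "cmod (f t - (?r t * f t) * of_real (q t)) = \<eta> / (\<eta> + q t) * cmod (f t)"
      using \<eta> \<open>\<eta> + q t > 0\<close> by (simp only: norm_mult norm_of_real) simp
    show ?thesis
    proof (cases "t \<in> K")
      case True
      have "\<eta> / (\<eta> + q t) * cmod (f t) \<le> \<eta> / \<delta> * B"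
        using \<eta> \<delta>(1) \<delta>(2)[OF True] B
        by (intro mult_mono divide_left_mono) auto
      also have "\<dots> = \<epsilon> * (B / (B + 1))"
        using \<delta>(1) by (simp add: \<eta>_def)
      also have "\<dots> \<le> \<epsilon> * 1"
        using \<epsilon> B(1) by (intro mult_left_mono) auto
      finally show ?thesis using eq by simp
    next
      case False
      then have "cmod (f t) \<le> \<epsilon>"
        using C0_outside[OF f(1), of t] \<epsilon> by (cases "t \<in> topspace X") (auto simp: K_def)
      moreover have "\<eta> / (\<eta> + q t) \<le> 1"
        using \<eta> q_nonneg[of t] by simp
      ultimately have "\<eta> / (\<eta> + q t) * cmod (f t) \<le> 1 * \<epsilon>"
        using \<epsilon> by (intro mult_mono) auto
      then show ?thesis using eq by simp
    qed
  qed
  ultimately show ?thesis by (intro bexI allI)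
qed

lemma (in hilbert_map) compose_hilbert_map:
  assumes "hilbert_map X F G k"
  shows "hilbert_map X E G (compose (carrier E) k h)"
proof -
  interpret k: hilbert_map X F G k by fact
  obtain B where B: "B \<ge> 0" "\<And>x. x \<in> carrier E \<Longrightarrow> hnorm X F (h x) \<le> B * hnorm X E x"
    using map_bounded by blast
  obtain D where D: "D \<ge> 0" "\<And>y. y \<in> carrier F \<Longrightarrow> hnorm X G (k y) \<le> D * hnorm X F y"
    using k.map_bounded by blast
  show ?thesis
  proof (rule hilbert_mapI[where B = "D * B"])
    fix x assume x: "x \<in> carrier E"
    have "hnorm X G (k (h x)) \<le> D * (B * hnorm X E x)"
      using D(2)[OF map_closed[OF x]] mult_left_mono[OF B(2)[OF x] D(1)] by linarith
    then show "hnorm X G (compose (carrier E) k h x) \<le> D * B * hnorm X E x"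
      using x by (simp add: compose_def mult.assoc)
  qed (simp_all add: compose_def map_closed map_add map_scale map_act k.map_closed k.map_add
      k.map_scale k.map_act dom.scale_axioms dom.act_closed dom.hilbert_module_axioms
      k.cod.hilbert_module_axioms)
qed

lemma factors_through_Hilb:
  "factors_through (Hilb X) (S, s, I) (T, t, I') \<longleftrightarrow>
    (\<exists>m. hilbert_map X S T m \<and> m \<in> extensional (carrier S) \<and> (S, s, I) = (S, compose (carrier S) t m, I'))"
proof
  assume "factors_through (Hilb X) (S, s, I) (T, t, I')"
  then show "\<exists>m. hilbert_map X S T m \<and> m \<in> extensional (carrier S)
      \<and> (S, s, I) = (S, compose (carrier S) t m, I')"
    by (auto simp: factors_through_def Hilb_hom_iff)
next
  assume "\<exists>m. hilbert_map X S T m \<and> m \<in> extensional (carrier S)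
      \<and> (S, s, I) = (S, compose (carrier S) t m, I')"
  then obtain m where "hilbert_map X S T m" "m \<in> extensional (carrier S)"
      "(S, s, I) = (S, compose (carrier S) t m, I')"
    by blast
  then show "factors_through (Hilb X) (S, s, I) (T, t, I')"
    unfolding factors_through_def by (intro bexI[of _ "(S, m, T)"]) (simp_all add: Hilb_hom_iff)
qed

lemma equiv_sub_rel:
  "equiv (monos_into (Hilb X :: (('x, 'v) hmodule, ('x, 'v) harrow) tensor_cat) (unit_module X))
    (sub_rel (Hilb X) (unit_module X))"
proof (rule equivI)
  let ?C = "Hilb X :: (('x, 'v) hmodule, ('x, 'v) harrow) tensor_cat"
  let ?I = "unit_module X :: ('x, 'v) hmodule"
  show "sub_rel ?C ?I \<subseteq> monos_into ?C ?I \<times> monos_into ?C ?I"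
    by (auto simp: sub_rel_def)
  show "sym (sub_rel ?C ?I)"
    by (auto simp: sub_rel_def sym_def)
  show "refl_on (monos_into ?C ?I) (sub_rel ?C ?I)"
  proof (rule refl_onI)
    fix a assume a: "a \<in> monos_into ?C ?I"
    then obtain S s where S: "a = (S, s, ?I)" "subunit X S s" "s \<in> extensional (carrier S)"
      unfolding subunit_iff_monos_into by blast
    interpret subunit X S s by (rule S)
    have "s = compose (carrier S) s (\<lambda>x\<in>carrier S. x)"
      using S(3) by (auto simp: compose_def fun_eq_iff extensional_def)
    then have "factors_through ?C a a"
      unfolding S(1) factors_through_Hilb
      using hilbert_map_restrict_id[OF dom.hilbert_module_axioms] by auto
    with a show "(a, a) \<in> sub_rel ?C ?I"
      by (simp add: sub_rel_def)
  qed
  have trans: "factors_through ?C a c"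
    if subunits: "a \<in> monos_into ?C ?I" "b \<in> monos_into ?C ?I" "c \<in> monos_into ?C ?I"
      and ab: "factors_through ?C a b" and bc: "factors_through ?C b c" for a b c
  proof -
    obtain S s T t R r where a: "a = (S, s, ?I)" and b: "b = (T, t, ?I)" and c: "c = (R, r, ?I)"
      using subunits unfolding subunit_iff_monos_into by blast
    obtain m where m: "hilbert_map X S T m" "s = compose (carrier S) t m"
      using ab unfolding a b factors_through_Hilb by blast
    obtain n where n: "hilbert_map X T R n" "t = compose (carrier T) r n"
      using bc unfolding b c factors_through_Hilb by blast
    have "s = compose (carrier S) r (compose (carrier S) n m)"
      unfolding m(2) n(2) using hilbert_map.map_closed[OF m(1)] by (auto simp: compose_def fun_eq_iff)
    moreover have "hilbert_map X S R (compose (carrier S) n m)"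
      by (rule hilbert_map.compose_hilbert_map[OF m(1) n(1)])
    ultimately show ?thesis
      unfolding a c factors_through_Hilb by auto
  qed
  show "trans (sub_rel ?C ?I)"
  proof (rule transI)
    fix a b c assume ab: "(a, b) \<in> sub_rel ?C ?I" and bc: "(b, c) \<in> sub_rel ?C ?I"
    then have "factors_through ?C a c" "factors_through ?C c a"
      by (auto simp: sub_rel_def intro: trans[of a b c] trans[of c b a])
    with ab bc show "(a, c) \<in> sub_rel ?C ?I"
      by (simp add: sub_rel_def)
  qed
qed

locale idempotent_subunit = subunit_tensor X S S s
  for X :: "'x topology" and S :: "('x, 'v) hmodule" and s +
  assumes ext: "s \<in> extensional (carrier S)"
    and iso: "is_iso (Hilb X) (tensor_arr (Hilb X) (S, s, unit_module X) (ide (Hilb X) S))"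
begin

lemma fn_minus: "x \<in> carrier S \<Longrightarrow> y \<in> carrier S \<Longrightarrow> fn (x \<ominus>\<^bsub>S\<^esub> y) t = fn x t - fn y t"
  using cod.minus_eq_scale[OF map_closed, of y "s x"] by (simp add: map_minus)

lemma bounded_below:
  obtains C where "C \<ge> 0" "\<And>x. x \<in> carrier S \<Longrightarrow> hnorm X S x \<le> C * sup_norm X (fn x)"
proof -
  obtain g where "g \<in> hom_set (Hilb X) cod.T dom.T"
      and left_inverse: "cmp (Hilb X) g (dom.T, M, cod.T) = ide (Hilb X) dom.T"
    using iso unfolding is_iso_def by auto
  then obtain h where g: "g = (cod.T, h, dom.T)" and h: "hilbert_map X cod.T dom.T h"
    unfolding Hilb_hom_iff by blast
  interpret h: hilbert_map X cod.T dom.T h by (rule h)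
  obtain C where C: "C \<ge> 0" "\<And>x. x \<in> carrier cod.T \<Longrightarrow> hnorm X dom.T (h x) \<le> C * hnorm X cod.T x"
    using h.map_bounded by blast
  have inverse: "h (M z) = z" if "z \<in> carrier dom.T" for z
    using left_inverse that by (auto simp: g compose_def fun_eq_iff split: if_splits)
  have pointwise: "cmod (ip S x x t) \<le> C\<^sup>2 * (cmod (fn x t))\<^sup>2" if x: "x \<in> carrier S" for x t
  proof (cases "ip S x x t = 0")
    case False
    \<comment> \<open>Apply the bound of the inverse to \<open>x \<otimes> x\<close> and cancel one factor.\<close>
    let ?z = "dom.limit (\<lambda>n. [(x, x)])"
    have fs: "[(x, x)] \<in> formal_sums S S" "[(s x, x)] \<in> formal_sums (unit_module X) S"
      using x map_closed[OF x] by (simp_all add: formal_sums_def)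
    note const = dom.fs.const_cauchy[OF fs(1)] cod.fs.const_cauchy[OF fs(2)]
    have z: "?z \<in> carrier dom.T"
      by (rule dom.limit_closed[OF const(1)])
    have Mz: "M ?z = cod.limit (\<lambda>n. [(s x, x)])"
      using x by (simp add: tensor_map_limit[OF const(1)])
    have "ip dom.T ?z ?z t = ip S x x t * ip S x x t"
      unfolding dom.tensor_ip[OF const(1) const(1)]
      by (rule dom.fs.plim_eqI[OF const(1) const(1)]) (simp add: fs_ip_def)
    moreover have "ip cod.T (M ?z) (M ?z) t = (cnj (fn x t) * fn x t) * ip S x x t"
      unfolding Mz cod.tensor_ip[OF const(2) const(2)]
      by (rule cod.fs.plim_eqI[OF const(2) const(2)]) (simp add: fs_ip_def)
    moreover have "cmod (ip dom.T (h (M ?z)) (h (M ?z)) t) \<le> C\<^sup>2 * cmod (ip cod.T (M ?z) (M ?z) t)"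
      by (intro h.map_pointwise_bounded locally_compact Hausdorff C tens.map_closed z)
    ultimately have "cmod (ip S x x t) * cmod (ip S x x t)
        \<le> (C\<^sup>2 * (cmod (fn x t))\<^sup>2) * cmod (ip S x x t)"
      unfolding inverse[OF z] by (simp add: norm_mult power2_eq_square mult.assoc)
    then show ?thesis
      using False by simp
  qed simp
  have "hnorm X S x \<le> C * sup_norm X (fn x)" if x: "x \<in> carrier S" for x
    unfolding dom.hnorm_eq
  proof (rule dom.inner.nrm_least)
    show "0 \<le> C * sup_norm X (fn x)"
      by (intro mult_nonneg_nonneg C sup_norm_nonneg fn_C0 x)
    show "cmod (ip S x x t) \<le> (C * sup_norm X (fn x))\<^sup>2" for t
      unfolding power_mult_distrib
      by (intro order_trans[OF pointwise[OF x]] mult_left_mono power_mono sup_norm_upper fn_C0 x) auto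
  qed
  then show ?thesis using that C(1) by blast
qed

definition support :: "'x set" where "support = {t \<in> topspace X. \<exists>x\<in>carrier S. fn x t \<noteq> 0}"

lemma openin_support: "openin X support"
proof -
  have "support = (\<Union>x\<in>carrier S. {t \<in> topspace X. fn x t \<in> - {0}})"
    by (auto simp: support_def)
  moreover have "openin X {t \<in> topspace X. fn x t \<in> - {0}}" if "x \<in> carrier S" for x
    by (rule openin_continuous_map_preimage[OF C0_continuous[OF fn_C0[OF that]]]) auto
  ultimately show ?thesis
    by (simp add: openin_clauses(3) openin_Union image_iff)
qed

text \<open>
  A function that vanishes outside the support is a limit of values of \<open>s\<close>. As \<open>s\<close> is bounded below,
  arguments for these values form a Cauchy sequence, and \<open>s\<close> maps its limit to the given function.
\<close>

lemma image_eq: "s ` carrier S = Fun ` C0_ideal X support"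
proof (intro equalityI subsetI)
  fix a assume "a \<in> s ` carrier S"
  then obtain x where x: "x \<in> carrier S" "a = s x" by blast
  then have "fn x \<in> C0_ideal X support"
    using fn_C0 by (auto simp: C0_ideal_def support_def)
  then show "a \<in> Fun ` C0_ideal X support"
    using x map_eq_Fun by blast
next
  fix a :: "('x, 'v) elt" assume "a \<in> Fun ` C0_ideal X support"
  then obtain f where f: "f \<in> C0 X" "\<And>t. t \<in> topspace X - support \<Longrightarrow> f t = 0" and a: "a = Fun f"
    by (auto simp: C0_ideal_def)
  obtain C where C: "C \<ge> 0" "\<And>x. x \<in> carrier S \<Longrightarrow> hnorm X S x \<le> C * sup_norm X (fn x)"
    using bounded_below by blast
  have fn_add: "fn (x \<oplus>\<^bsub>S\<^esub> y) = (\<lambda>t. fn x t + fn y t)" if "x \<in> carrier S" "y \<in> carrier S" for x y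
    using that by (simp add: map_add)
  have fn_act: "fn (act S g x) = (\<lambda>t. g t * fn x t)" if "g \<in> C0 X" "x \<in> carrier S" for g x
    using that by (simp add: map_act)
  have "\<exists>g\<in>fn ` carrier S. \<forall>t. cmod (f t - g t) \<le> 1 / Suc n" for n
  proof (rule C0_ideal_approximation[OF _ _ _ _ f(1)])
    show "fn ` carrier S \<subseteq> C0 X" using fn_C0 by blast
    show "(\<lambda>t. 0) \<in> fn ` carrier S"
      by (rule image_eqI[of _ _ "\<zero>\<^bsub>S\<^esub>"]) (simp_all add: map_zero)
    show "(\<lambda>t. g t + h t) \<in> fn ` carrier S" if gh: "g \<in> fn ` carrier S" "h \<in> fn ` carrier S" for g h
    proof -
      obtain x y where xy: "x \<in> carrier S" "g = fn x" "y \<in> carrier S" "h = fn y"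
        using gh by blast
      then show ?thesis
        by (intro image_eqI[of _ _ "x \<oplus>\<^bsub>S\<^esub> y"]) (simp_all add: fn_add)
    qed
    show "(\<lambda>t. g t * h t) \<in> fn ` carrier S" if g: "g \<in> C0 X" and h: "h \<in> fn ` carrier S" for g h
    proof -
      obtain x where x: "x \<in> carrier S" "h = fn x"
        using h by blast
      with g show ?thesis
        by (intro image_eqI[of _ _ "act S g x"]) (simp_all add: fn_act dom.act_closed)
    qed
    show "\<exists>j\<in>fn ` carrier S. j t \<noteq> 0" if "t \<in> topspace X" "f t \<noteq> 0" for t
      using f(2)[of t] that by (auto simp: support_def)
  qed simp
  then have "\<forall>n. \<exists>x\<in>carrier S. \<forall>t. cmod (f t - fn x t) \<le> 1 / Suc n"
    by auto
  then obtain u where u: "\<And>n. u n \<in> carrier S" "\<And>n t. cmod (f t - fn (u n) t) \<le> 1 / Suc n"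
    by metis
  have "\<exists>N. \<forall>m\<ge>N. \<forall>n\<ge>N. hnorm X S (u m \<ominus>\<^bsub>S\<^esub> u n) < \<epsilon>" if "\<epsilon> > 0" for \<epsilon>
  proof -
    obtain N :: nat where N: "1 / Suc N < \<epsilon> / (2 * (C + 1))"
      using nat_approx_posE[of "\<epsilon> / (2 * (C + 1))"] \<open>\<epsilon> > 0\<close> C(1) by auto
    have "hnorm X S (u m \<ominus>\<^bsub>S\<^esub> u n) < \<epsilon>" if "N \<le> m" "N \<le> n" for m n
    proof -
      have "cmod (fn (u m \<ominus>\<^bsub>S\<^esub> u n) t) \<le> 2 * (1 / Suc N)" for t
      proof -
        have "cmod (fn (u m \<ominus>\<^bsub>S\<^esub> u n) t) = cmod ((f t - fn (u n) t) - (f t - fn (u m) t))"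
          by (simp add: fn_minus u)
        also have "\<dots> \<le> 1 / Suc n + 1 / Suc m"
          by (intro order_trans[OF norm_triangle_ineq4] add_mono u)
        also have "\<dots> \<le> 1 / Suc N + 1 / Suc N"
          using that by (intro add_mono divide_left_mono) auto
        finally show ?thesis by simp
      qed
      then have "sup_norm X (fn (u m \<ominus>\<^bsub>S\<^esub> u n)) \<le> 2 * (1 / Suc N)"
        by (intro sup_norm_least) auto
      then have "hnorm X S (u m \<ominus>\<^bsub>S\<^esub> u n) \<le> C * (2 * (1 / Suc N))"
        using C(2)[OF dom.M.minus_closed[OF u(1)[of m] u(1)[of n]]] mult_left_mono[OF _ C(1)]
        by (meson order_trans)
      also have "\<dots> \<le> (C + 1) * (2 * (1 / Suc N))"
        by (intro mult_right_mono) auto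
      also have "\<dots> < \<epsilon>"
        using N C(1) by (simp add: field_simps)
      finally show ?thesis .
    qed
    then show ?thesis by blast
  qed
  then obtain x where x: "x \<in> carrier S" and lim: "(\<lambda>n. hnorm X S (u n \<ominus>\<^bsub>S\<^esub> x)) \<longlonglongrightarrow> 0"
    using dom.norm_complete[of u] u(1) by blast
  obtain B where B: "B \<ge> 0" "\<And>x. x \<in> carrier S \<Longrightarrow> hnorm X (unit_module X) (s x) \<le> B * hnorm X S x"
    using map_bounded by blast
  have "fn x = f"
  proof
    fix t
    have "cmod (f t - fn x t) \<le> 1 / Suc n + B * hnorm X S (u n \<ominus>\<^bsub>S\<^esub> x)" for n
    proof -
      have ux: "u n \<ominus>\<^bsub>S\<^esub> x \<in> carrier S" by (simp add: u x)
      have "f t - fn x t = (f t - fn (u n) t) + fn (u n \<ominus>\<^bsub>S\<^esub> x) t"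
        by (simp add: fn_minus u x)
      then have "cmod (f t - fn x t) \<le> cmod (f t - fn (u n) t) + cmod (fn (u n \<ominus>\<^bsub>S\<^esub> x) t)"
        by (metis norm_triangle_ineq)
      also have "cmod (fn (u n \<ominus>\<^bsub>S\<^esub> x) t) \<le> B * hnorm X S (u n \<ominus>\<^bsub>S\<^esub> x)"
        using sup_norm_upper[OF fn_C0[OF ux], of t] B(2)[OF ux]
        unfolding hnorm_unit_module[OF fn_C0[OF ux]] by linarith
      finally show ?thesis using u(2)[of t n] by linarith
    qed
    moreover have "(\<lambda>n. 1 / Suc n + B * hnorm X S (u n \<ominus>\<^bsub>S\<^esub> x)) \<longlonglongrightarrow> 0 + B * 0"
      by (intro tendsto_add tendsto_mult_left lim) real_asymp
    ultimately have "cmod (f t - fn x t) \<le> 0 + B * 0"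
      by (intro tendsto_lowerbound) auto
    then show "fn x t = f t" by simp
  qed
  then have "s x = a"
    using map_eq_Fun[OF x] a by simp
  then show "a \<in> s ` carrier S"
    using x by blast
qed

text \<open>
  The map \<open>s\<close>, with codomain restricted to its image, and its inverse are the two factorisations.
\<close>

lemma equivalent_ideal_inclusion:
  "((S, s, unit_module X), ideal_inclusion X support) \<in> sub_rel (Hilb X) (unit_module X)"
proof -
  interpret J: ideal_subunit X support "TYPE('v)"
    by unfold_locales (rule locally_compact Hausdorff)+
  have bij: "bij_betw s (carrier S) (Fun ` C0_ideal X support)"
    using inj image_eq by (simp add: bij_betw_def)
  have to_J: "hilbert_map X S J.S s"
  proof -
    obtain B where B: "\<And>x. x \<in> carrier S \<Longrightarrow> hnorm X (unit_module X) (s x) \<le> B * hnorm X S x"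
      using map_bounded by blast
    show ?thesis
      using image_eq B
      by (intro hilbert_mapI[where B = B] dom.hilbert_module_axioms J.ideal.hilbert_module_axioms)
        (auto simp: map_add map_scale map_act hnorm_def)
  qed
  obtain C where C: "\<And>x. x \<in> carrier S \<Longrightarrow> hnorm X S x \<le> C * sup_norm X (fn x)"
    using bounded_below by blast
  define g where "g = (\<lambda>y\<in>Fun ` C0_ideal X support. inv_into (carrier S) s y)"
  have from_J: "hilbert_map X J.S S g"
    unfolding g_def
  proof (rule inverse_hilbert_map[OF bij C0_ideal_hilbert_module])
    show "hnorm X S x \<le> C * hnorm X (unit_module X) (s x)" if "x \<in> carrier S" for x
      using C[OF that] unfolding hnorm_unit_module[OF fn_C0[OF that]] .
  qed
  have "s = compose (carrier S) J.\<iota> s"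
    using ext image_eq by (auto simp: compose_def fun_eq_iff extensional_def)
  moreover have "J.\<iota> = compose (carrier J.S) s g"
    using image_eq by (auto simp: compose_def fun_eq_iff g_def f_inv_into_f)
  moreover have "g \<in> extensional (carrier J.S)"
    by (simp add: g_def)
  ultimately have "factors_through (Hilb X) (S, s, unit_module X) (J.S, J.\<iota>, unit_module X)"
      "factors_through (Hilb X) (J.S, J.\<iota>, unit_module X) (S, s, unit_module X)"
    unfolding factors_through_Hilb using to_J from_J ext by blast+
  moreover have "(S, s, unit_module X) \<in> monos_into (Hilb X) (unit_module X)"
      "(J.S, J.\<iota>, unit_module X) \<in> monos_into (Hilb X) (unit_module X)"
    unfolding subunit_iff_monos_into using subunit_axioms J.subunit_axioms ext by auto
  ultimately show ?thesis
    unfolding J.inclusion_eq by (simp add: sub_rel_def)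
qed

end

theorem idempotent_subunits_Hilb:
  fixes X :: "'x topology"
  assumes top: "locally_compact_space X" "Hausdorff_space X"
  shows "idempotent_subunits (Hilb X :: (('x, 'v) hmodule, ('x, 'v) harrow) tensor_cat)
    = {subobject_of (Hilb X) (ideal_inclusion X U) | U. openin X U}"
proof -
  let ?C = "Hilb X :: (('x, 'v) hmodule, ('x, 'v) harrow) tensor_cat"
  let ?R = "sub_rel ?C (unit_module X)"
  have tgt: "subobject_of ?C (ideal_inclusion X U) = ?R `` {ideal_inclusion X U}" for U
    by (simp add: ideal_inclusion_def Let_def)
  show ?thesis
    unfolding tgt
  proof (intro equalityI subsetI)
    fix \<Sigma> assume "\<Sigma> \<in> idempotent_subunits ?C"
    then obtain a where \<Sigma>: "\<Sigma> \<in> subunits ?C" "a \<in> \<Sigma>"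
        and iso: "is_iso ?C (tensor_arr ?C a (ide ?C (src ?C a)))"
      by (auto simp: idempotent_subunits_def idempotent_subobject_def)
    obtain S s where S: "a = (S, s, unit_module X)" "subunit X S s" "s \<in> extensional (carrier S)"
      using subobject_members[OF \<Sigma>] unfolding Hilb_simps subunit_iff_monos_into by blast
    interpret subunit X S s by (rule S)
    interpret idempotent_subunit X S s
      using top S(3) iso unfolding S(1) Hilb_simps(2) by unfold_locales
    have "\<Sigma> \<in> monos_into ?C (unit_module X) // ?R"
      using \<Sigma>(1) by (simp add: subobjects_def)
    then obtain b where b: "\<Sigma> = ?R `` {b}"
      by (rule quotientE)
    then have "(b, a) \<in> ?R"
      using \<Sigma>(2) by simp
    moreover have "(a, ideal_inclusion X support) \<in> ?R"
      using equivalent_ideal_inclusion S(1) by simp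
    ultimately have "\<Sigma> = ?R `` {ideal_inclusion X support}"
      unfolding b using equiv_class_eq[OF equiv_sub_rel] by blast
    then show "\<Sigma> \<in> {?R `` {ideal_inclusion X U} | U. openin X U}"
      using openin_support by blast
  next
    fix \<Sigma> assume "\<Sigma> \<in> {?R `` {ideal_inclusion X U} | U. openin X U}"
    then obtain U where \<Sigma>: "\<Sigma> = ?R `` {ideal_inclusion X U}" by blast
    interpret ideal_subunit X U "TYPE('v)"
      by unfold_locales (rule top)+
    have mono: "ideal_inclusion X U \<in> monos_into ?C (unit_module X)"
      unfolding inclusion_eq subunit_iff_monos_into using subunit_axioms by auto
    then have "\<Sigma> \<in> subunits ?C" "ideal_inclusion X U \<in> \<Sigma>"
      using equiv_class_self[OF equiv_sub_rel mono] by (auto simp: \<Sigma> subobjects_def intro: quotientI)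
    moreover have "is_iso ?C (tensor_arr ?C (ideal_inclusion X U) (ide ?C (src ?C (ideal_inclusion X U))))"
      using idempotent unfolding inclusion_eq by simp
    ultimately show "\<Sigma> \<in> idempotent_subunits ?C"
      unfolding idempotent_subunits_def idempotent_subobject_def by blast
  qed
qed

theorem theorem6:
  fixes X :: "'x topology"
  assumes "locally_compact_space X" and "Hausdorff_space X"
  shows "firm (Hilb X :: (('x, 'v) hmodule, ('x, 'v) harrow) tensor_cat)
    \<and> idempotent_subunits (Hilb X :: (('x, 'v) hmodule, ('x, 'v) harrow) tensor_cat)
        = {subobject_of (Hilb X) (ideal_inclusion X U) | U. openin X U}
    \<and> (\<forall>U. openin X U \<longrightarrow> C0_ideal X U = C0 (subtopology X U))"
  using firm_Hilb[OF assms] idempotent_subunits_Hilb[OF assms] C0_ideal_eq_C0_subtopology[OF assms(2)]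
  by blast

end
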